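(* Let $m\ge 2$ and $n\ge 1$ be integers, let $\Bbbk$ be an algebraically closed field with $\operatorname{char}(\Bbbk)\nmid mn$, and let $q\in\Bbbk$ be a primitive $n$-th root of unity. Let $R_{mn}(q)$ be the Radford Hopf algebra, $D(R_{mn}(q))$ its Drinfeld double, and $\mathcal{R}$ the canonical universal $R$-matrix of $D(R_{mn}(q))$. Then: (1) $(D(R_{mn}(q)),\mathcal{R})$ has quasi-ribbon elements if and only if $n$ is odd. (2) $(D(R_{mn}(q)),\mathcal{R})$ has a unique ribbon element if and only if both $m$ and $n$ are odd. (3) $(D(R_{mn}(q)),\mathcal{R})$ has two ribbon elements if and only if $m$ is even and $n$ is odd.
   Context: Radford Hopf algebra: $R_{mn}(q)$ is the Hopf algebra generated as an algebra over $\Bbbk$ by $g,x$ with relations $g^{mn}=1$, $x^n=g^n-1$, $xg=qgx$, and with $\Delta(g)=g\otimes g$, $\Delta(x)=x\otimes g+1\otimes x$, $\varepsilon(g)=1$, $\varepsilon(x)=0$, $S(g)=g^{-1}$, $S(x)=-xg^{-1}$. It has dimension $mn^2$ with basis $\{g^ix^j: 0\le i\le mn-1,\ 0\le j\le n-1\}$. Drinfeld double: for a finite-dimensional Hopf algebra $H$ with antipode $S$, $D(H)=(H^* )^{cop}\bowtie H$ is the vector space $H^*\otimes H$ (elements written $f\bowtie a$) with unit $\varepsilon\bowtie 1$ (an element $\varepsilon\bowtie a$ is also written $1\bowtie a$), multiplication $$(f\bowtie a)(p\bowtie b)=\sum f*\bigl(p(S^{-1}(a_3)\,?\,a_1)\bigr)\bowtie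 a_2b,$$ where $*$ is the convolution product of $H^*$ and $p(S^{-1}(a_3)\,?\,a_1)$ denotes the functional $y\mapsto p(S^{-1}(a_3)ya_1)$; comultiplication $\Delta(f\bowtie a)=\sum (f_1\bowtie a_1)\otimes(f_2\bowtie a_2)$, where $\sum f_1(y)f_2(z)=f(zy)$ for all $y,z\in H$; and counit $\varepsilon(f\bowtie a)=\varepsilon(a)f(1)$. Its antipode is the unique one making it a Hopf algebra. Its canonical universal $R$-matrix is $\mathcal{R}=\sum_i(1\bowtie e_i)\otimes(e^i\bowtie 1)$, where $\{e_i\}$ is a basis of $H$ and $\{e^i\}$ is the dual basis of $H^*$. Ribbon and quasi-ribbon elements: let $(A,\mathcal{R})$ be a quasi-triangular Hopf algebra with $\mathcal{R}=\sum_i x_i\otimes y_i$ (i.e. $\mathcal R$ is invertible, $\mathcal{R}\Delta(a)=\Delta^{op}(a)\mathcal{R}$ for all $a\in A$, $(\Delta\otimes \mathrm{id})\mathcal{R}=\mathcal{R}_{13}\mathcal{R}_{23}$, $(\mathrm{id}\otimes\Delta)\mathcal{R}=\mathcal{R}_{13}\mathcal{R}_{12}$). Put $\mathcal{R}^{op}=\sum_i y_i\otimes x_i$ and $u=\sum_i S(y_i)x_i$. A quasi-ribbon element of $(A,\mathcal R)$ is an invertible $v\in A$ such that $$v^2=uS(u),\quad S(v)=v,\quad \varepsilon(v)=1,\quad \Delta(v)=(\mathcal{R}^{op}\mathcal{R})^{-1}(v\otimes v).$$ A ribbon element is a quasi-ribbon element that is central in $A$.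
   Formalization: In (3), "two" is proved as "at least two" for all n ≥ 1 and as "exactly two" only for n ≥ 2; for n = 1 and m even there are four ribbon elements (e.g. m = 2, n = 1), so "exactly two" fails there. *)

theory Defs
  imports
    "HOL-Analysis.Analysis"
    "HOL-Computational_Algebra.Polynomial"
    "HOL-Library.Poly_Mapping"
begin

text \<open>
  A finite-dimensional vector space over \<open>'k\<close> is taken with a basis indexed by a finite type
  \<open>'i\<close>, that is, as \<open>'k ^ 'i\<close> with scalar multiplication \<open>*s\<close> and basis vectors \<open>axis i 1\<close>.
  Then the tensor product of \<open>'k ^ 'i\<close> and \<open>'k ^ 'j\<close> is \<open>'k ^ ('i \<times> 'j)\<close>, and the dual of
  \<open>'k ^ 'i\<close> is again \<open>'k ^ 'i\<close>, by coordinates with respect to the dual basis.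
  The componentwise ring structure that the library puts on \<open>'k ^ 'i\<close> is never used.
\<close>

section \<open>Tensor products and duals\<close>

definition tens :: "'k::field ^ 'i::finite \<Rightarrow> 'k ^ 'j::finite \<Rightarrow> 'k ^ ('i \<times> 'j)"
    (infixr "\<otimes>\<^sub>v" 72) where
  "a \<otimes>\<^sub>v b = (\<chi> p. a $ fst p * b $ snd p)"

text \<open>
  \<open>tlift \<beta>\<close> is the linear map on the tensor product induced by the bilinear map \<open>\<beta>\<close>: if
  \<open>t\<close> is a sum of pure tensors \<open>a \<otimes>\<^sub>v b\<close>, then \<open>tlift \<beta> t\<close> is the sum of the \<open>\<beta> a b\<close>. Sweedler
  notation is rendered by it.
\<close>
definition tlift ::
    "('k::field ^ 'i::finite \<Rightarrow> 'k ^ 'j::finite \<Rightarrow> 'k ^ 'l::finite) \<Rightarrow> 'k ^ ('i \<times> 'j) \<Rightarrow> 'k ^ 'l" where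
  "tlift \<beta> t = (\<Sum>i\<in>UNIV. \<Sum>j\<in>UNIV. t $ (i, j) *s \<beta> (axis i 1) (axis j 1))"

definition tflip :: "'k::field ^ ('i::finite \<times> 'j::finite) \<Rightarrow> 'k ^ ('j \<times> 'i)" where
  "tflip = tlift (\<lambda>a b. b \<otimes>\<^sub>v a)"

definition pairing :: "'k::field ^ 'i::finite \<Rightarrow> 'k ^ 'i \<Rightarrow> 'k" where
  "pairing f a = (\<Sum>i\<in>UNIV. f $ i * a $ i)"

definition functional :: "('k::field ^ 'i::finite \<Rightarrow> 'k) \<Rightarrow> 'k ^ 'i" where
  "functional \<phi> = (\<chi> i. \<phi> (axis i 1))"

abbreviation vlinear :: "('k::field ^ 'i::finite \<Rightarrow> 'k ^ 'j::finite) \<Rightarrow> bool" where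
  "vlinear \<equiv> Vector_Spaces.linear (*s) (*s)"


section \<open>Algebras, bialgebras, Hopf algebras\<close>

record ('k, 'i::finite) alg =
  mul :: "'k ^ 'i \<Rightarrow> 'k ^ 'i \<Rightarrow> 'k ^ 'i"
  unt :: "'k ^ 'i"

record ('k, 'i::finite) bialg = "('k, 'i) alg" +
  comul :: "'k ^ 'i \<Rightarrow> 'k ^ ('i \<times> 'i)"
  counit :: "'k ^ 'i \<Rightarrow> 'k"

definition is_algebra :: "('k::field, 'i::finite, 'z) alg_scheme \<Rightarrow> bool" where
  "is_algebra A \<longleftrightarrow>
     (\<forall>a. vlinear (mul A a)) \<and> (\<forall>b. vlinear (\<lambda>a. mul A a b)) \<and>
     (\<forall>a b c. mul A (mul A a b) c = mul A a (mul A b c)) \<and>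
     (\<forall>a. mul A (unt A) a = a \<and> mul A a (unt A) = a)"

definition tensor_square :: "('k::field, 'i::finite, 'z) alg_scheme \<Rightarrow> ('k, 'i \<times> 'i) alg" where
  "tensor_square A =
     \<lparr> mul = (\<lambda>s t. tlift (\<lambda>a b. tlift (\<lambda>c d. mul A a c \<otimes>\<^sub>v mul A b d) t) s),
       unt = unt A \<otimes>\<^sub>v unt A \<rparr>"

definition is_inverse :: "('k::field, 'i::finite, 'z) alg_scheme \<Rightarrow> 'k ^ 'i \<Rightarrow> 'k ^ 'i \<Rightarrow> bool" where
  "is_inverse A a b \<longleftrightarrow> mul A a b = unt A \<and> mul A b a = unt A"

definition invertible_in :: "('k::field, 'i::finite, 'z) alg_scheme \<Rightarrow> 'k ^ 'i \<Rightarrow> bool" where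
  "invertible_in A a \<longleftrightarrow> (\<exists>b. is_inverse A a b)"

definition inverse_in :: "('k::field, 'i::finite, 'z) alg_scheme \<Rightarrow> 'k ^ 'i \<Rightarrow> 'k ^ 'i" where
  "inverse_in A a = (THE b. is_inverse A a b)"

definition is_central :: "('k::field, 'i::finite, 'z) alg_scheme \<Rightarrow> 'k ^ 'i \<Rightarrow> bool" where
  "is_central A v \<longleftrightarrow> (\<forall>a. mul A v a = mul A a v)"

definition is_bialgebra :: "('k::field, 'i::finite) bialg \<Rightarrow> bool" where
  "is_bialgebra A \<longleftrightarrow>
     is_algebra A \<and>
     vlinear (comul A) \<and>
     (\<forall>a b. counit A (a + b) = counit A a + counit A b) \<and>
     (\<forall>c a. counit A (c *s a) = c * counit A a) \<and>
     (\<forall>a. tlift (\<lambda>b c. tlift (\<lambda>b1 b2. b1 \<otimes>\<^sub>v b2 \<otimes>\<^sub>v c) (comul A b)) (comul A a) =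
          tlift (\<lambda>b c. b \<otimes>\<^sub>v comul A c) (comul A a)) \<and>
     (\<forall>a. tlift (\<lambda>b c. counit A b *s c) (comul A a) = a) \<and>
     (\<forall>a. tlift (\<lambda>b c. counit A c *s b) (comul A a) = a) \<and>
     (\<forall>a b. comul A (mul A a b) = mul (tensor_square A) (comul A a) (comul A b)) \<and>
     comul A (unt A) = unt (tensor_square A) \<and>
     (\<forall>a b. counit A (mul A a b) = counit A a * counit A b) \<and>
     counit A (unt A) = 1"

definition is_antipode :: "('k::field, 'i::finite) bialg \<Rightarrow> ('k ^ 'i \<Rightarrow> 'k ^ 'i) \<Rightarrow> bool" where
  "is_antipode A S \<longleftrightarrow>
     vlinear S \<and>
     (\<forall>a. tlift (\<lambda>b c. mul A (S b) c) (comul A a) = counit A a *s unt A) \<and>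
     (\<forall>a. tlift (\<lambda>b c. mul A b (S c)) (comul A a) = counit A a *s unt A)"

definition is_hopf_algebra :: "('k::field, 'i::finite) bialg \<Rightarrow> bool" where
  "is_hopf_algebra A \<longleftrightarrow> is_bialgebra A \<and> (\<exists>S. is_antipode A S)"

text \<open>A bialgebra has at most one antipode, so it is not stored in the record.\<close>
definition antipode :: "('k::field, 'i::finite) bialg \<Rightarrow> 'k ^ 'i \<Rightarrow> 'k ^ 'i" where
  "antipode A = (THE S. is_antipode A S)"


section \<open>Algebras given by generators and relations\<close>

text \<open>
  Words in the letters \<open>'g\<close> form the free monoid, written additively so that
  \<open>'g word \<Rightarrow>\<^sub>0 'k\<close>, with the convolution product of the library, is the free associative algebra.
\<close>
datatype 'g word = Word (letters: "'g list")

instantiation word :: (type) monoid_add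
begin

definition "0 = Word []"

definition "v + w = Word (letters v @ letters w)"

instance
  by standard (simp_all add: zero_word_def plus_word_def)

end

type_synonym ('g, 'k) free_algebra = "'g word \<Rightarrow>\<^sub>0 'k"

definition gen :: "'g \<Rightarrow> ('g, 'k::field) free_algebra" where
  "gen a = Poly_Mapping.single (Word [a]) 1"

definition scal :: "'k \<Rightarrow> ('g, 'k::field) free_algebra" where
  "scal c = Poly_Mapping.single 0 c"

definition two_sided_ideal :: "'r::ring_1 set \<Rightarrow> bool" where
  "two_sided_ideal J \<longleftrightarrow>
     0 \<in> J \<and> (\<forall>a\<in>J. \<forall>b\<in>J. a + b \<in> J) \<and> (\<forall>a\<in>J. \<forall>r. r * a \<in> J \<and> a * r \<in> J)"

definition ideal_generated_by :: "'r::ring_1 set \<Rightarrow> 'r set" where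
  "ideal_generated_by R = \<Inter> {J. two_sided_ideal J \<and> R \<subseteq> J}"

definition free_eval ::
    "('k::field, 'i::finite, 'z) alg_scheme \<Rightarrow> ('g \<Rightarrow> 'k ^ 'i) \<Rightarrow> ('g, 'k) free_algebra \<Rightarrow> 'k ^ 'i" where
  "free_eval A \<gamma> p =
     (\<Sum>w\<in>Poly_Mapping.keys p. Poly_Mapping.lookup p w *s foldr (\<lambda>a. mul A (\<gamma> a)) (letters w) (unt A))"

text \<open>
  \<open>A\<close> is the algebra generated by the \<open>\<gamma> a\<close> subject to the relations \<open>r = 0\<close> for \<open>r \<in> R\<close>: the
  canonical map from the free algebra to \<open>A\<close> is onto, with kernel the two-sided ideal generated by \<open>R\<close>.
\<close>
definition presented_by ::
    "('k::field, 'i::finite, 'z) alg_scheme \<Rightarrow> ('g \<Rightarrow> 'k ^ 'i) \<Rightarrow> ('g, 'k) free_algebra set \<Rightarrow> bool" where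
  "presented_by A \<gamma> R \<longleftrightarrow>
     surj (free_eval A \<gamma>) \<and> {p. free_eval A \<gamma> p = 0} = ideal_generated_by R"


section \<open>Radford Hopf algebras\<close>

definition primitive_root_of_unity :: "nat \<Rightarrow> 'k::field \<Rightarrow> bool" where
  "primitive_root_of_unity n q \<longleftrightarrow> q ^ n = 1 \<and> (\<forall>k. 0 < k \<and> k < n \<longrightarrow> q ^ k \<noteq> 1)"

datatype radford_gen = Gg | Gx

definition radford_relations :: "nat \<Rightarrow> nat \<Rightarrow> 'k::field \<Rightarrow> (radford_gen, 'k) free_algebra set" where
  "radford_relations m n q =
     { gen Gg ^ (m * n) - 1,
       gen Gx ^ n - (gen Gg ^ n - 1),
       gen Gx * gen Gg - scal q * gen Gg * gen Gx }"

text \<open>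
  \<open>H\<close> is the Hopf algebra $R_{mn}(q)$ (which is determined only up to isomorphism and, here, up to
  the choice of a basis of the underlying vector space).
\<close>
definition is_radford :: "nat \<Rightarrow> nat \<Rightarrow> 'k::field \<Rightarrow> ('k, 'i::finite) bialg \<Rightarrow> bool" where
  "is_radford m n q H \<longleftrightarrow>
     is_hopf_algebra H \<and>
     (\<exists>g x. presented_by H (case_radford_gen g x) (radford_relations m n q) \<and>
        comul H g = g \<otimes>\<^sub>v g \<and>
        comul H x = x \<otimes>\<^sub>v g + unt H \<otimes>\<^sub>v x \<and>
        counit H g = 1 \<and>
        counit H x = 0 \<and>
        antipode H g = inverse_in H g \<and>
        antipode H x = - mul H x (inverse_in H g))"


section \<open>The Drinfeld double\<close>

definition convolution :: "('k::field, 'i::finite) bialg \<Rightarrow> 'k ^ 'i \<Rightarrow> 'k ^ 'i \<Rightarrow> 'k ^ 'i" where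
  "convolution H f p = functional (\<lambda>y. pairing (f \<otimes>\<^sub>v p) (comul H y))"

text \<open>The functional $y \mapsto p(S^{-1}(c)\,y\,a)$.\<close>
definition twisted :: "('k::field, 'i::finite) bialg \<Rightarrow> 'k ^ 'i \<Rightarrow> 'k ^ 'i \<Rightarrow> 'k ^ 'i \<Rightarrow> 'k ^ 'i" where
  "twisted H p c a = functional (\<lambda>y. pairing p (mul H (mul H (inv (antipode H) c) y) a))"

text \<open>The element $\sum f_1 \otimes f_2$ with $\sum f_1(y) f_2(z) = f(zy)$.\<close>
definition cop_dual_comul :: "('k::field, 'i::finite) bialg \<Rightarrow> 'k ^ 'i \<Rightarrow> 'k ^ ('i \<times> 'i)" where
  "cop_dual_comul H f = (\<chi> p. pairing f (mul H (axis (snd p) 1) (axis (fst p) 1)))"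

text \<open>
  The pure tensor \<open>f \<otimes>\<^sub>v a\<close> is the element $f \bowtie a$; in the product, \<open>a1\<close>, \<open>a2\<close>, \<open>a3\<close> are the
  Sweedler components of $(\mathrm{id} \otimes \Delta)\Delta(a)$.
\<close>
definition drinfeld_double :: "('k::field, 'i::finite) bialg \<Rightarrow> ('k, 'i \<times> 'i) bialg" where
  "drinfeld_double H =
     \<lparr> mul = (\<lambda>s t.
         tlift (\<lambda>f a. tlift (\<lambda>p b.
           tlift (\<lambda>a1 a'. tlift (\<lambda>a2 a3.
             convolution H f (twisted H p a3 a1) \<otimes>\<^sub>v mul H a2 b)
           (comul H a')) (comul H a)) t) s),
       unt = functional (counit H) \<otimes>\<^sub>v unt H,
       comul = tlift (\<lambda>f a.
         tlift (\<lambda>f1 f2. tlift (\<lambda>a1 a2. (f1 \<otimes>\<^sub>v a1) \<otimes>\<^sub>v (f2 \<otimes>\<^sub>v a2))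
           (comul H a)) (cop_dual_comul H f)),
       counit = (\<lambda>t. \<Sum>i\<in>UNIV. \<Sum>j\<in>UNIV.
         t $ (i, j) * (counit H (axis j 1) * pairing (axis i 1) (unt H))) \<rparr>"

definition double_R :: "('k::field, 'i::finite) bialg \<Rightarrow> 'k ^ (('i \<times> 'i) \<times> ('i \<times> 'i))" where
  "double_R H =
     (\<Sum>i\<in>UNIV. (functional (counit H) \<otimes>\<^sub>v axis i 1) \<otimes>\<^sub>v (axis i 1 \<otimes>\<^sub>v unt H))"


section \<open>Ribbon and quasi-ribbon elements\<close>

definition drinfeld_element :: "('k::field, 'i::finite) bialg \<Rightarrow> 'k ^ ('i \<times> 'i) \<Rightarrow> 'k ^ 'i" where
  "drinfeld_element A R = tlift (\<lambda>x y. mul A (antipode A y) x) R"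

definition quasi_ribbon :: "('k::field, 'i::finite) bialg \<Rightarrow> 'k ^ ('i \<times> 'i) \<Rightarrow> 'k ^ 'i \<Rightarrow> bool" where
  "quasi_ribbon A R v \<longleftrightarrow>
     invertible_in A v \<and>
     (let u = drinfeld_element A R in mul A v v = mul A u (antipode A u)) \<and>
     antipode A v = v \<and>
     counit A v = 1 \<and>
     comul A v =
       mul (tensor_square A)
         (inverse_in (tensor_square A) (mul (tensor_square A) (tflip R) R))
         (v \<otimes>\<^sub>v v)"

definition ribbon :: "('k::field, 'i::finite) bialg \<Rightarrow> 'k ^ ('i \<times> 'i) \<Rightarrow> 'k ^ 'i \<Rightarrow> bool" where
  "ribbon A R v \<longleftrightarrow> quasi_ribbon A R v \<and> is_central A v"

end

theory Submission
  imports Defs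
begin

text \<open>
  Write \<open>H\<close> for $R_{mn}(q)$, \<open>D\<close> for its double, \<open>S\<close> for the antipode of \<open>H\<close>, \<open>\<iota> a\<close> for
  $1 \bowtie a$ and \<open>j f\<close> for $f \bowtie 1$. The inverse of the Drinfeld element \<open>u\<close> is
  $w = \sum_i e^i \bowtie S^2(e_i)$, and everything rests on one coproduct formula for it,
  $\Delta(w) = \mathcal{R}^{op}\mathcal{R}\,(w \otimes w)$ (lemma \<open>comul_w\<close>), which follows from the exchange rule
  $\mathcal{R}\,\Delta(a) = \Delta^{op}(a)\,\mathcal{R}$ for \<open>a\<close> in \<open>H\<close> alone. If \<open>v\<close> is a quasi-ribbon element, the
  formula makes $l = wv = u^{-1}v$ grouplike, and the remaining conditions say exactly that
  $l^2 = h$ for the grouplike element $h = u^{-1} S_D(u)$ (lemmas \<open>grouplike_h\<close>,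
  \<open>quasi_ribbon_iff\<close>). So quasi-ribbon elements are the \<open>u l\<close> where \<open>l\<close> runs through the grouplike square
  roots of \<open>h\<close>.

  A grouplike element of \<open>D\<close> is $\psi \bowtie c$ for a character \<open>\<psi>\<close> of \<open>H\<close> and a grouplike \<open>c\<close> of
  \<open>H\<close>, and the grouplike elements of \<open>H\<close> are the powers of \<open>g\<close>. For \<open>n \<ge> 2\<close> a character kills \<open>x\<close>
  and sends \<open>g\<close> to an \<open>n\<close>-th root of unity. It remains to find \<open>h\<close>; the answer is $h = \psi \bowtie g^{n-1}$ with
  $\psi(g) = q$ (lemma \<open>h_eq\<close>). The character is read off from the trace of
  $e \mapsto \sum S(e_2)\,g\,S^2(e_1)$. The same method bounds the other factor: it shows that it is
  some $g^t$ with \<open>0 \<le> t < n\<close>, and since conjugation by \<open>h\<close> is the inverse of the fourth power of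
  the antipode on \<open>H\<close>, comparing the two on \<open>x\<close> gives $q^{t+1} = 1$, hence \<open>t = n - 1\<close>.

  If \<open>n\<close> is even, a square root of \<open>\<psi>\<close> would be a character with value \<open>s\<close> at \<open>g\<close>, where
  $s^2 = q$ and $s^n = 1$; then $q^{n/2} = 1$, which is absurd. If \<open>n\<close> is odd, $s = q^{(n+1)/2}$ is such a
  value, and the powers $g^b$ with $g^{2b} = g^{n-1}$ are $g^{(n-1)/2}$ and, when \<open>m\<close> is even,
  also $g^{(n-1)/2 + mn/2}$. For these \<open>l\<close> the element \<open>u l\<close> is central, because conjugation by
  \<open>l\<close> agrees with the inverse square of the antipode on generators. For \<open>n = 1\<close> and \<open>m\<close> even there are more
  square roots, which is why the exact count concerns \<open>n \<ge> 2\<close>.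

  The general facts about the double on which this rests, that it is a Hopf algebra and that its
  \<open>R\<close>-matrix satisfies the exchange rule, hold for every Hopf algebra with bijective antipode and are
  proved in that generality.
\<close>

section \<open>Multilinear algebra in coordinates\<close>

lemma vlinearI:
  assumes "\<And>x y. f (x + y) = f x + f y" "\<And>c x. f (c *s x) = c *s f x"
  shows "vlinear f"
  using assms by (simp add: Vector_Spaces.linear_iff vec.vector_space_axioms)

lemma vlinear_add: "vlinear f \<Longrightarrow> f (x + y) = f x + f y"
  and vlinear_scale: "vlinear f \<Longrightarrow> f (c *s x) = c *s f x"
  by (simp_all add: Vector_Spaces.linear_iff)

lemma vlinear_zero: "vlinear f \<Longrightarrow> f 0 = 0"
  using vlinear_scale[of f 0 0] by simp

lemma vlinear_uminus: "vlinear f \<Longrightarrow> f (- x) = - f x"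
  using vlinear_scale[of f "-1" x] by simp

lemma vlinear_diff: "vlinear f \<Longrightarrow> f (x - y) = f x - f y"
  using vlinear_add[of f x "- y"] vlinear_uminus[of f y] by simp

lemma vlinear_sum: "vlinear f \<Longrightarrow> f (\<Sum>i\<in>I. v i) = (\<Sum>i\<in>I. f (v i))"
  by (induction I rule: infinite_finite_induct) (simp_all add: vlinear_zero vlinear_add)

lemma vlinear_compose: "vlinear g \<Longrightarrow> vlinear f \<Longrightarrow> vlinear (\<lambda>x. g (f x))"
  by (simp add: Vector_Spaces.linear_iff)

lemma vlinear_expansion:
  assumes "vlinear f"
  shows "f a = (\<Sum>i\<in>UNIV. a $ i *s f (axis i 1))"
proof -
  have "f a = f (\<Sum>i\<in>UNIV. a $ i *s axis i 1)" by (simp only: basis_expansion)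
  then show ?thesis by (simp only: vlinear_sum[OF assms] vlinear_scale[OF assms])
qed

lemma vlinear_eqI:
  assumes "vlinear f" "vlinear g" "\<And>i. f (axis i 1) = g (axis i 1)"
  shows "f a = g a"
  using assms(3) vlinear_expansion[OF assms(1), of a] vlinear_expansion[OF assms(2), of a] by simp

text \<open>
  Rewriting under a Sweedler sum needs the summand to be linear in each variable. The rules
  collected here decide that by the syntactic shape of the summand.
\<close>
named_theorems lin

lemma lin_basic [lin]:
  "vlinear (\<lambda>x. x)"
  "vlinear (\<lambda>x. 0)"
  "vlinear f \<Longrightarrow> vlinear (\<lambda>x. c *s f x)"
  "vlinear f \<Longrightarrow> vlinear g \<Longrightarrow> vlinear (\<lambda>x. f x + g x)"
  "vlinear f \<Longrightarrow> vlinear g \<Longrightarrow> vlinear (\<lambda>x. f x - g x)"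
  "vlinear f \<Longrightarrow> vlinear (\<lambda>x. - f x)"
  by (auto intro!: vlinearI
      simp: vlinear_add vlinear_scale vector_add_ldistrib vec.scale_right_diff_distrib mult.commute)

lemma lin_sum [lin]:
  assumes "\<And>i. vlinear (f i)"
  shows "vlinear (\<lambda>x. \<Sum>i\<in>I. f i x)"
  by (rule vlinearI)
    (simp_all add: vlinear_add[OF assms] vlinear_scale[OF assms] sum.distrib vec.scale_sum_right)

lemma tens_nth [simp]: "(a \<otimes>\<^sub>v b) $ (i, j) = a $ i * b $ j"
  by (simp add: tens_def)

lemma lin_tens [lin]:
  "vlinear f \<Longrightarrow> vlinear (\<lambda>x. f x \<otimes>\<^sub>v b)"
  "vlinear f \<Longrightarrow> vlinear (\<lambda>x. a \<otimes>\<^sub>v f x)"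
  by (auto intro!: vlinearI
      simp: vlinear_add vlinear_scale vec_eq_iff tens_def algebra_simps)

lemma axis_pair: "axis (i, j) (1::'k::field) = axis i 1 \<otimes>\<^sub>v axis j 1"
  by (auto simp: vec_eq_iff tens_def axis_def)

lemma tens_eqI:
  assumes "vlinear f" "vlinear g" "\<And>a b. f (a \<otimes>\<^sub>v b) = g (a \<otimes>\<^sub>v b)"
  shows "f t = g t"
  by (rule vlinear_eqI[OF assms(1,2)]) (metis assms(3) axis_pair surj_pair)

lemma lin_tlift [lin]:
  "vlinear f \<Longrightarrow> vlinear (\<lambda>x. tlift \<beta> (f x))"
  by (auto intro!: vlinearI simp: tlift_def vlinear_add vlinear_scale vector_sadd_rdistrib
      sum.distrib vec.scale_sum_right vector_smult_assoc)

lemma lin_tlift_param [lin]: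
  "(\<And>b c. vlinear (\<lambda>x. \<beta> x b c)) \<Longrightarrow> vlinear (\<lambda>x. tlift (\<lambda>b c. \<beta> x b c) t)"
  unfolding tlift_def by (intro lin)

lemma vlinear_tlift:
  "vlinear f \<Longrightarrow> f (tlift \<beta> t) = tlift (\<lambda>a b. f (\<beta> a b)) t"
  by (simp add: tlift_def vlinear_sum vlinear_scale)

lemma tlift_alt:
  "tlift \<beta> t = (\<Sum>p\<in>UNIV. t $ p *s \<beta> (axis (fst p) 1) (axis (snd p) 1))"
  by (simp add: tlift_def sum.cartesian_product UNIV_Times_UNIV case_prod_unfold)

lemma tlift_cong: "(\<And>a b. \<beta> a b = \<gamma> a b) \<Longrightarrow> tlift \<beta> t = tlift \<gamma> t"
  by (simp add: tlift_def)

text \<open>Independent Sweedler sums commute: this is Fubini for the two double sums over basis vectors.\<close>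
lemma tlift_swap:
  "tlift (\<lambda>a b. tlift (\<lambda>c d. \<gamma> a b c d) t) s = tlift (\<lambda>c d. tlift (\<lambda>a b. \<gamma> a b c d) s) t"
  unfolding tlift_alt vec.scale_sum_right
  by (subst sum.swap) (simp add: vector_smult_assoc mult.commute)

lemma tlift_tens:
  assumes "\<And>b. vlinear (\<lambda>a. \<beta> a b)" "\<And>a. vlinear (\<lambda>b. \<beta> a b)"
  shows "tlift \<beta> (a \<otimes>\<^sub>v b) = \<beta> a b"
proof -
  have "\<beta> a b = (\<Sum>i\<in>UNIV. a $ i *s (\<Sum>j\<in>UNIV. b $ j *s \<beta> (axis i 1) (axis j 1)))"
    by (subst vlinear_expansion[OF assms(1)], subst vlinear_expansion[OF assms(2)]) simp
  then show ?thesis by (simp add: tlift_def vec.scale_sum_right vector_smult_assoc)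
qed

lemma tlift_tens_id: "tlift (\<lambda>a b. a \<otimes>\<^sub>v b) t = t"
proof (rule tens_eqI[where f = "\<lambda>t. tlift (\<lambda>a b. a \<otimes>\<^sub>v b) t" and g = "\<lambda>t. t"])
qed (intro lin | simp add: tlift_tens lin)+

lemma tlift_sum: "tlift (\<lambda>a b. \<Sum>i\<in>I. \<beta> i a b) t = (\<Sum>i\<in>I. tlift (\<beta> i) t)"
  by (induction I rule: infinite_finite_induct)
     (simp_all add: tlift_def vector_add_ldistrib sum.distrib)

lemma tlift_scale: "tlift (\<lambda>a b. c *s \<beta> a b) t = c *s tlift \<beta> t"
  by (simp add: tlift_def vec.scale_sum_right vector_smult_assoc mult.commute)

lemma tflip_tens: "tflip (a \<otimes>\<^sub>v b) = b \<otimes>\<^sub>v a"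
  unfolding tflip_def by (rule tlift_tens) (intro lin)+

lemma lin_tflip [lin]: "vlinear f \<Longrightarrow> vlinear (\<lambda>x. tflip (f x))"
  unfolding tflip_def by (intro lin)

text \<open>
  Identities between scalars are proved as identities between their multiples of a vector, so that
  one Sweedler calculus, with values in vectors, serves for both.
\<close>
definition slinear :: "('k::field ^ 'i::finite \<Rightarrow> 'k) \<Rightarrow> bool" where
  "slinear \<phi> \<longleftrightarrow> (\<forall>a b. \<phi> (a + b) = \<phi> a + \<phi> b) \<and> (\<forall>c a. \<phi> (c *s a) = c * \<phi> a)"

lemma slinear_scale_vec: "slinear \<phi> \<Longrightarrow> vlinear f \<Longrightarrow> vlinear (\<lambda>x. \<phi> (f x) *s v)"
  by (rule vlinearI)
    (simp_all add: slinear_def vlinear_add vlinear_scale vector_sadd_rdistrib vector_smult_assoc)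

lemma slinear_compose: "slinear \<phi> \<Longrightarrow> vlinear f \<Longrightarrow> slinear (\<lambda>x. \<phi> (f x))"
  by (simp add: slinear_def vlinear_add vlinear_scale)

lemma slinear_sum: "slinear \<phi> \<Longrightarrow> \<phi> (\<Sum>i\<in>I. v i) = (\<Sum>i\<in>I. \<phi> (v i))"
proof (induction I rule: infinite_finite_induct)
  case (infinite A)
  then show ?case unfolding slinear_def by simp (metis mult_zero_left vec.scale_zero_left)
next
  case empty
  then show ?case unfolding slinear_def by simp (metis mult_zero_left vec.scale_zero_left)
qed (simp add: slinear_def)

lemma pairing_functional: "slinear \<phi> \<Longrightarrow> pairing (functional \<phi>) a = \<phi> a"
proof -
  assume \<phi>: "slinear \<phi>"
  have "\<phi> a = \<phi> (\<Sum>i\<in>UNIV. a $ i *s axis i 1)" by (simp only: basis_expansion)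
  also have "\<dots> = pairing (functional \<phi>) a"
    using \<phi> unfolding slinear_sum[OF \<phi>]
    by (simp add: slinear_def pairing_def functional_def mult.commute)
  finally show ?thesis by simp
qed

lemma pairing_axis [simp]: "pairing f (axis i 1) = f $ i" "pairing (axis i 1) a = a $ i"
  by (simp_all add: pairing_def axis_def if_distrib[where f = "\<lambda>x. _ * x"]
      if_distrib[where f = "\<lambda>x. x * _"] cong: if_cong)

lemma pairing_eqI: "(\<And>y. pairing f y = pairing g y) \<Longrightarrow> f = g"
  by (metis pairing_axis(1) vec_eq_iff)

lemma slinear_pairing: "slinear (pairing f)" "slinear (\<lambda>f. pairing f a)"
  by (simp_all add: slinear_def pairing_def algebra_simps sum.distrib sum_distrib_left)

lemma pairing_simps [simp]:
  "pairing (c *s f) a = c * pairing f a" "pairing f (c *s a) = c * pairing f a"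
  by (simp_all add: pairing_def sum_distrib_left algebra_simps)

lemma lin_pairing [lin]:
  "vlinear f \<Longrightarrow> vlinear (\<lambda>x. pairing p (f x) *s v)"
  "vlinear f \<Longrightarrow> vlinear (\<lambda>x. pairing (f x) a *s v)"
  by (rule slinear_scale_vec, simp_all add: slinear_pairing)
     (rule slinear_scale_vec[where \<phi> = "\<lambda>f. pairing f a"], simp_all add: slinear_pairing)

lemma pairing_tens: "pairing (f \<otimes>\<^sub>v p) (a \<otimes>\<^sub>v b) = pairing f a * pairing p b"
  by (simp add: pairing_def sum_product sum.cartesian_product UNIV_Times_UNIV tens_def
      case_prod_unfold algebra_simps)

lemma pairing_tens_tlift: "pairing (f \<otimes>\<^sub>v p) t *s v = tlift (\<lambda>a b. pairing f a *s (pairing p b *s v)) t"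
proof (rule tens_eqI[where f = "\<lambda>t. pairing (f \<otimes>\<^sub>v p) t *s v"
      and g = "\<lambda>t. tlift (\<lambda>a b. pairing f a *s (pairing p b *s v)) t"])
  show "pairing (f \<otimes>\<^sub>v p) (a \<otimes>\<^sub>v b) *s v = tlift (\<lambda>a b. pairing f a *s (pairing p b *s v)) (a \<otimes>\<^sub>v b)"
    for a b by (subst tlift_tens) (intro lin | simp add: pairing_tens vector_smult_assoc)+
qed (intro lin)+

lemma pairing_tens_eqI:
  assumes "\<And>y z. pairing s (y \<otimes>\<^sub>v z) = pairing t (y \<otimes>\<^sub>v z)"
  shows "s = t"
  by (simp add: vec_eq_iff) (metis assms axis_pair pairing_axis(1))

lemma scalar_eqI: "(\<And>v :: 'k::field ^ 1. c *s v = d *s v) \<Longrightarrow> c = d"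
  by (metis axis_eq_0_iff vec.scale_right_imp_eq zero_neq_one)

lemma lin_functional [lin]:
  assumes "\<And>y. slinear (\<lambda>x. \<phi> x y)"
  shows "vlinear (\<lambda>x. functional (\<lambda>y. \<phi> x y))"
  using assms by (intro vlinearI) (auto simp: slinear_def functional_def vec_eq_iff)

text \<open>
  The image of the canonical element $\sum_i e_i \otimes e^i$ under \<open>\<beta>\<close>. The universal
  \<open>R\<close>-matrix and the Drinfeld element are of this form, and so is every trace.
\<close>
definition can :: "('k::field ^ 'i::finite \<Rightarrow> 'k ^ 'i \<Rightarrow> 'k ^ 'l::finite) \<Rightarrow> 'k ^ 'l" where
  "can \<beta> = (\<Sum>i\<in>UNIV. \<beta> (axis i 1) (axis i 1))"

lemma can_cong: "(\<And>a f. \<beta> a f = \<gamma> a f) \<Longrightarrow> can \<beta> = can \<gamma>"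
  by (simp add: can_def)

lemma can_swap: "can (\<lambda>a f. can (\<lambda>b p. \<beta> a f b p)) = can (\<lambda>b p. can (\<lambda>a f. \<beta> a f b p))"
  unfolding can_def by (rule sum.swap)

lemma can_tlift: "tlift (\<lambda>b c. can (\<lambda>a f. \<beta> a f b c)) t = can (\<lambda>a f. tlift (\<lambda>b c. \<beta> a f b c) t)"
  unfolding can_def by (rule tlift_sum)

lemma vlinear_can: "vlinear h \<Longrightarrow> h (can \<beta>) = can (\<lambda>a f. h (\<beta> a f))"
  unfolding can_def by (rule vlinear_sum)

lemma lin_can [lin]: "(\<And>a f. vlinear (\<lambda>x. \<beta> x a f)) \<Longrightarrow> vlinear (\<lambda>x. can (\<lambda>a f. \<beta> x a f))"
  unfolding can_def by (rule lin_sum)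

lemma can_eval: "vlinear h \<Longrightarrow> can (\<lambda>a f. pairing f y *s h a) = h y"
  unfolding can_def using vlinear_expansion[of h y] by simp

lemma can_eval': "vlinear h \<Longrightarrow> can (\<lambda>a f. pairing p a *s h f) = h p"
  unfolding can_def using vlinear_expansion[of h p] by simp

section \<open>Hopf algebras in Sweedler notation\<close>

locale algebra_on =
  fixes B :: "('k::field, 'i::finite, 'z) alg_scheme"
  assumes is_algebra: "is_algebra B"
begin

lemma lin_mul [lin]:
  "vlinear f \<Longrightarrow> vlinear (\<lambda>x. mul B (f x) b)"
  "vlinear f \<Longrightarrow> vlinear (\<lambda>x. mul B a (f x))"
  using is_algebra by (auto simp: is_algebra_def intro!: vlinearI simp: vlinear_add vlinear_scale
      vlinear_add[where f = "\<lambda>a. mul B a b"] vlinear_scale[where f = "\<lambda>a. mul B a b"])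

lemma mul_assoc: "mul B (mul B a b) c = mul B a (mul B b c)"
  and mul_unt [simp]: "mul B (unt B) a = a" "mul B a (unt B) = a"
  using is_algebra by (simp_all add: is_algebra_def)

lemmas mul_scale [simp] = vlinear_scale[OF lin_mul(1)[OF lin_basic(1)]] vlinear_scale[OF lin_mul(2)[OF lin_basic(1)]]
lemmas mul_tlift = vlinear_tlift[OF lin_mul(1)[OF lin_basic(1)]] vlinear_tlift[OF lin_mul(2)[OF lin_basic(1)]]

lemma inverse_unique: "mul B b a = unt B \<Longrightarrow> mul B a c = unt B \<Longrightarrow> b = c"
  by (metis mul_assoc mul_unt)

lemma is_inverse_unique: "is_inverse B a b \<Longrightarrow> is_inverse B a c \<Longrightarrow> b = c"
  by (auto simp: is_inverse_def intro: inverse_unique)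

lemma inverse_in_eq: "is_inverse B a b \<Longrightarrow> inverse_in B a = b"
  unfolding inverse_in_def by (rule the_equality) (auto intro: is_inverse_unique)

lemma is_inverse_mul: "is_inverse B a b \<Longrightarrow> is_inverse B c d \<Longrightarrow> is_inverse B (mul B a c) (mul B d b)"
  unfolding is_inverse_def by (metis mul_assoc mul_unt)

lemma tensor_mul: "mul (tensor_square B) (a \<otimes>\<^sub>v b) (c \<otimes>\<^sub>v d) = mul B a c \<otimes>\<^sub>v mul B b d"
  unfolding tensor_square_def by (simp, subst tlift_tens) (intro lin | subst tlift_tens | rule refl)+

lemma lin_tensor_mul:
  "vlinear f \<Longrightarrow> vlinear (\<lambda>x. mul (tensor_square B) (f x) b)"
  "vlinear f \<Longrightarrow> vlinear (\<lambda>x. mul (tensor_square B) a (f x))"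
  unfolding tensor_square_def by simp_all (intro lin | assumption)+

lemma tensor_unt: "unt (tensor_square B) = unt B \<otimes>\<^sub>v unt B"
  by (simp add: tensor_square_def)

lemma tensor_square_is_algebra: "is_algebra (tensor_square B)"
proof -
  let ?T = "tensor_square B"
  note [lin] = lin_tensor_mul
  have 1: "mul ?T (mul ?T s t) r = mul ?T s (mul ?T t r)" for s t r
  proof (rule tens_eqI[where t = s])
    show "mul ?T (mul ?T (a \<otimes>\<^sub>v b) t) r = mul ?T (a \<otimes>\<^sub>v b) (mul ?T t r)" for a b
    proof (rule tens_eqI[where t = t])
      show "mul ?T (mul ?T (a \<otimes>\<^sub>v b) (c \<otimes>\<^sub>v d)) r = mul ?T (a \<otimes>\<^sub>v b) (mul ?T (c \<otimes>\<^sub>v d) r)" for c d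
        by (rule tens_eqI[where t = r]) (intro lin | simp add: tensor_mul mul_assoc)+
    qed (intro lin)+
  qed (intro lin)+
  have 2: "mul ?T (unt ?T) t = t" "mul ?T t (unt ?T) = t" for t
    by (rule tens_eqI[where t = t]; (intro lin | simp add: tensor_mul tensor_unt))+
  show ?thesis unfolding is_algebra_def
    by (intro conjI allI lin_tensor_mul lin_basic 1 2)
qed

lemma tflip_mul: "tflip (mul (tensor_square B) s t) = mul (tensor_square B) (tflip s) (tflip t)"
proof (rule tens_eqI[where t = s], (intro lin lin_tensor_mul)+)
  show "tflip (mul (tensor_square B) (a \<otimes>\<^sub>v b) t) = mul (tensor_square B) (tflip (a \<otimes>\<^sub>v b)) (tflip t)" for a b
    by (rule tens_eqI[where t = t]) (intro lin lin_tensor_mul | simp add: tensor_mul tflip_tens)+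
qed

lemma is_inverse_tflip:
  assumes "is_inverse (tensor_square B) s t"
  shows "is_inverse (tensor_square B) (tflip s) (tflip t)"
  using assms unfolding is_inverse_def tflip_mul[symmetric] by (simp add: tensor_unt tflip_tens)

end

locale bialgebra =
  fixes A :: "('k::field, 'i::finite) bialg"
  assumes is_bialgebra: "is_bialgebra A"
begin

sublocale algebra_on A
  using is_bialgebra by unfold_locales (simp add: is_bialgebra_def)

sublocale T: algebra_on "tensor_square A"
  by unfold_locales (rule tensor_square_is_algebra)

lemma lin_comul [lin]: "vlinear f \<Longrightarrow> vlinear (\<lambda>x. comul A (f x))"
  using is_bialgebra by (auto simp: is_bialgebra_def intro!: vlinearI simp: vlinear_add vlinear_scale)

lemma slinear_counit: "slinear (counit A)"
  using is_bialgebra by (simp add: is_bialgebra_def slinear_def)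

lemma lin_counit [lin]: "vlinear f \<Longrightarrow> vlinear (\<lambda>x. counit A (f x) *s v)"
  by (rule slinear_scale_vec[OF slinear_counit])

lemma counit_simps [simp]:
  "counit A (mul A a b) = counit A a * counit A b" "counit A (unt A) = 1"
  "counit A (a + b) = counit A a + counit A b" "counit A (c *s a) = c * counit A a"
  using is_bialgebra by (simp_all add: is_bialgebra_def)

lemma comul_unt: "comul A (unt A) = unt A \<otimes>\<^sub>v unt A"
  using is_bialgebra by (simp add: is_bialgebra_def tensor_unt)

lemma comul_mul: "comul A (mul A a b) = mul (tensor_square A) (comul A a) (comul A b)"
  using is_bialgebra by (simp add: is_bialgebra_def)

text \<open>
  \<open>sw (\<lambda>a1 a2. t) a\<close> is the Sweedler sum of \<open>t\<close> over the coproduct of \<open>a\<close>. Nested sums are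
  brought to a common form by \<open>coassoc\<close>, and \<open>counit_left\<close>, \<open>counit_right\<close> and the antipode
  rules contract adjacent legs.
\<close>
abbreviation sw :: "('k ^ 'i \<Rightarrow> 'k ^ 'i \<Rightarrow> 'k ^ 'l::finite) \<Rightarrow> 'k ^ 'i \<Rightarrow> 'k ^ 'l" where
  "sw \<beta> a \<equiv> tlift \<beta> (comul A a)"

lemma coassoc:
  assumes "\<And>b c. vlinear (\<lambda>a. \<beta> a b c)" "\<And>a c. vlinear (\<lambda>b. \<beta> a b c)" "\<And>a b. vlinear (\<lambda>c. \<beta> a b c)"
  shows "sw (\<lambda>b c. sw (\<lambda>b1 b2. \<beta> b1 b2 c) b) a =
    sw (\<lambda>b c. sw (\<lambda>c1 c2. \<beta> b c1 c2) c) a"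
proof -
  define F where "F = tlift (\<lambda>x t. tlift (\<lambda>y z. \<beta> x y z) t)"
  have F: "vlinear F" unfolding F_def by (intro lin)
  have F_tens: "F (x \<otimes>\<^sub>v t) = tlift (\<lambda>y z. \<beta> x y z) t" for x t
    unfolding F_def by (subst tlift_tens) (intro lin assms | simp)+
  have F_tens3: "F (x \<otimes>\<^sub>v y \<otimes>\<^sub>v z) = \<beta> x y z" for x y z
    unfolding F_tens by (subst tlift_tens) (intro lin assms | simp)+
  have "F (sw (\<lambda>b c. sw (\<lambda>b1 b2. b1 \<otimes>\<^sub>v b2 \<otimes>\<^sub>v c) b) a) =
     F (sw (\<lambda>b c. b \<otimes>\<^sub>v comul A c) a)"
    using is_bialgebra by (simp add: is_bialgebra_def)
  then have "sw (\<lambda>b c. sw (\<lambda>b1 b2. F (b1 \<otimes>\<^sub>v b2 \<otimes>\<^sub>v c)) b) a =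
     sw (\<lambda>b c. F (b \<otimes>\<^sub>v comul A c)) a"
    by (simp only: vlinear_tlift[OF F])
  then show ?thesis by (simp only: F_tens3) (simp only: F_tens)
qed

lemma counit_left: "vlinear \<phi> \<Longrightarrow> sw (\<lambda>b c. counit A b *s \<phi> c) a = \<phi> a"
  and counit_right: "vlinear \<phi> \<Longrightarrow> sw (\<lambda>b c. counit A c *s \<phi> b) a = \<phi> a"
proof -
  have 1: "sw (\<lambda>b c. counit A b *s c) a = a" "sw (\<lambda>b c. counit A c *s b) a = a"
    using is_bialgebra by (simp_all add: is_bialgebra_def)
  show "vlinear \<phi> \<Longrightarrow> sw (\<lambda>b c. counit A b *s \<phi> c) a = \<phi> a"
    using arg_cong[OF 1(1), of \<phi>] by (simp add: vlinear_tlift vlinear_scale)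
  show "vlinear \<phi> \<Longrightarrow> sw (\<lambda>b c. counit A c *s \<phi> b) a = \<phi> a"
    using arg_cong[OF 1(2), of \<phi>] by (simp add: vlinear_tlift vlinear_scale)
qed

lemma comul_mul_tlift:
  assumes "\<And>b. vlinear (\<lambda>a. \<beta> a b)" "\<And>a. vlinear (\<lambda>b. \<beta> a b)"
  shows "sw \<beta> (mul A a b) =
    sw (\<lambda>a1 a2. sw (\<lambda>b1 b2. \<beta> (mul A a1 b1) (mul A a2 b2)) b) a"
proof -
  have lin_T: "vlinear (\<lambda>s. tlift \<beta> (mul (tensor_square A) s t))"
    "vlinear (\<lambda>t. tlift \<beta> (mul (tensor_square A) s t))" for s t by (intro lin)+
  have lin_b: "vlinear f \<Longrightarrow> vlinear (\<lambda>x. \<beta> (f x) b)" "vlinear f \<Longrightarrow> vlinear (\<lambda>x. \<beta> a (f x))"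
    for f :: "_ \<Rightarrow> 'k ^ 'i" and a b
    by (rule vlinear_compose[where g = "\<lambda>a. \<beta> a b"], rule assms, assumption)
       (rule vlinear_compose[where g = "\<beta> a"], rule assms, assumption)
  have "tlift \<beta> (mul (tensor_square A) s t) =
     tlift (\<lambda>a1 a2. tlift (\<lambda>b1 b2. \<beta> (mul A a1 b1) (mul A a2 b2)) t) s" for s t
  proof (rule tens_eqI[where t = s])
    show "tlift \<beta> (mul (tensor_square A) (c \<otimes>\<^sub>v d) t) =
     tlift (\<lambda>a1 a2. tlift (\<lambda>b1 b2. \<beta> (mul A a1 b1) (mul A a2 b2)) t) (c \<otimes>\<^sub>v d)" for c d
      apply (subst tlift_tens, (intro lin lin_b)+)
      apply (rule tens_eqI[where t = t], (intro lin lin_b)+)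
      apply (simp add: tensor_mul tlift_tens assms lin lin_b)
      done
  qed (intro lin lin_b)+
  then show ?thesis by (simp add: comul_mul)
qed

text \<open>
  In the convolution algebra of linear maps into \<open>B\<close>, a left inverse of \<open>G\<close> equals a right inverse.
  Uniqueness of the antipode and its compatibility with the coproduct are instances.
\<close>
lemma convolution_inverse_unique:
  assumes B: "is_algebra B"
    and lin_FGK: "vlinear F" "vlinear G" "vlinear K"
    and FG: "\<And>a. sw (\<lambda>b c. mul B (F b) (G c)) a = counit A a *s unt B"
    and GK: "\<And>a. sw (\<lambda>b c. mul B (G b) (K c)) a = counit A a *s unt B"
  shows "F a = K a"
proof -
  interpret B: algebra_on B by unfold_locales (rule B)
  note F = vlinear_compose[OF lin_FGK(1)] and G = vlinear_compose[OF lin_FGK(2)]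
    and K = vlinear_compose[OF lin_FGK(3)]
  have "F a = sw (\<lambda>b c. counit A c *s F b) a"
    by (rule counit_right[symmetric]) (rule lin_FGK)
  also have "\<dots> = sw (\<lambda>b c. mul B (F b) (counit A c *s unt B)) a" by simp
  also have "\<dots> = sw (\<lambda>b c. sw (\<lambda>c1 c2. mul B (F b) (mul B (G c1) (K c2))) c) a"
    by (simp add: GK[symmetric] B.mul_tlift)
  also have "\<dots> = sw (\<lambda>b c. sw (\<lambda>b1 b2. mul B (F b1) (mul B (G b2) (K c))) b) a"
    by (rule coassoc[symmetric]) (intro lin B.lin_mul F G K)+
  also have "\<dots> = sw (\<lambda>b c. mul B (sw (\<lambda>b1 b2. mul B (F b1) (G b2)) b) (K c)) a"
    by (simp add: B.mul_tlift B.mul_assoc)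
  also have "\<dots> = K a" by (simp add: FG counit_left lin_FGK)
  finally show ?thesis .
qed

definition grouplike :: "'k ^ 'i \<Rightarrow> bool" where
  "grouplike c \<longleftrightarrow> comul A c = c \<otimes>\<^sub>v c \<and> counit A c = 1"

lemma grouplike_mul: "grouplike c \<Longrightarrow> grouplike d \<Longrightarrow> grouplike (mul A c d)"
  by (simp add: grouplike_def comul_mul tensor_mul)

lemma grouplike_unt: "grouplike (unt A)"
  by (simp add: grouplike_def comul_unt)

lemma grouplike_if_invertible:
  assumes "comul A c = c \<otimes>\<^sub>v c" "is_inverse A c d"
  shows "grouplike c"
proof -
  have "sw (\<lambda>a b. counit A a *s b) c = counit A c *s c"
    unfolding assms(1) by (rule tlift_tens) (intro lin)+
  then have c: "counit A c *s c = c" using counit_left[OF lin_basic(1)] by metis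
  have "counit A c *s mul A c d = mul A c d" using arg_cong[OF c, of "\<lambda>x. mul A x d"] by simp
  then have "counit A c *s unt A = unt A" using assms(2) by (simp only: is_inverse_def)
  from arg_cong[OF this, of "counit A"] show ?thesis using assms(1) by (simp add: grouplike_def)
qed

end

locale hopf = bialgebra A for A :: "('k::field, 'i::finite) bialg" +
  fixes S :: "'k ^ 'i \<Rightarrow> 'k ^ 'i"
  assumes is_antipode: "is_antipode A S"
begin

lemma lin_S [lin]: "vlinear f \<Longrightarrow> vlinear (\<lambda>x. S (f x))"
  using is_antipode by (auto simp: is_antipode_def intro!: vlinearI simp: vlinear_add vlinear_scale)

lemma S_left: "sw (\<lambda>b c. mul A (S b) c) a = counit A a *s unt A"
  and S_right: "sw (\<lambda>b c. mul A b (S c)) a = counit A a *s unt A"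
  using is_antipode by (simp_all add: is_antipode_def)

lemma S_left': "sw (\<lambda>b c. mul A (S b) (mul A c d)) a = counit A a *s d"
  and S_right': "sw (\<lambda>b c. mul A b (mul A (S c) d)) a = counit A a *s d"
  using arg_cong[OF S_left, of "\<lambda>x. mul A x d" a] arg_cong[OF S_right, of "\<lambda>x. mul A x d" a]
  by (simp_all add: mul_tlift mul_assoc)

lemma antipode_eq: "antipode A = S"
  unfolding antipode_def
proof (rule the_equality)
  show "is_antipode A S" by (rule is_antipode)
next
  fix S' assume "is_antipode A S'"
  then interpret S': hopf A S' by unfold_locales
  show "S' = S"
  proof
    show "S' a = S a" for a
      by (rule convolution_inverse_unique[where G = "\<lambda>x. x", OF is_algebra])
         (intro lin S'.lin_S | simp add: S'.S_left S_right)+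
  qed
qed

lemma S_unt: "S (unt A) = unt A"
proof -
  have "tlift (\<lambda>b c. mul A (S b) c) (unt A \<otimes>\<^sub>v unt A) = S (unt A)"
    by (subst tlift_tens) (intro lin | simp)+
  then show ?thesis using S_left[of "unt A"] by (simp add: comul_unt)
qed

lemma counit_S: "counit A (S a) = counit A a"
proof (rule scalar_eqI)
  fix v :: "'k ^ 1"
  have "counit A (S a) *s v = sw (\<lambda>b c. counit A c *s (counit A (S b) *s v)) a"
    by (rule counit_right[symmetric]) (intro lin)
  also have "\<dots> = sw (\<lambda>b c. counit A (mul A (S b) c) *s v) a"
    by (simp add: mult.commute)
  also have "\<dots> = counit A (sw (\<lambda>b c. mul A (S b) c) a) *s v"
    by (rule vlinear_tlift[symmetric]) (intro lin)
  finally show "counit A (S a) *s v = counit A a *s v" by (simp add: S_left)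
qed

text \<open>
  Both sides are convolution inverse to the multiplication, as maps on the tensor square. In
  \<open>?E\<close>, contracting the last two factors in \<open>a\<close> and in \<open>b\<close> leaves the left-hand side, contracting the
  first two the right-hand side.
\<close>
lemma S_mul: "S (mul A a b) = mul A (S b) (S a)"
proof -
  let ?E = "\<lambda>a1 b1 a2 b2 a3 b3. mul A (S (mul A a1 b1)) (mul A a2 (mul A b2 (mul A (S b3) (S a3))))"
  have "S (mul A a b) = sw (\<lambda>a1 ar. counit A ar *s S (mul A a1 b)) a"
    by (rule counit_right[symmetric]) (intro lin)
  also have "\<dots> = sw (\<lambda>a1 ar. sw (\<lambda>b1 br. counit A br *s (counit A ar *s S (mul A a1 b1)))
        b) a"
    by (intro tlift_cong counit_right[symmetric] lin)
  also have "\<dots> = sw (\<lambda>a1 ar. sw (\<lambda>b1 br. sw (\<lambda>a2 a3. sw (\<lambda>b2 b3. ?E a1 b1 a2 b2 a3 b3)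
          br) ar) b) a"
    by (simp add: mul_tlift[symmetric] S_right' S_right tlift_scale)
  also have "\<dots> = sw (\<lambda>a1 ar. sw (\<lambda>a2 a3. sw (\<lambda>b1 br. sw (\<lambda>b2 b3. ?E a1 b1 a2 b2 a3 b3)
          br) b) ar) a"
    by (intro tlift_cong tlift_swap)
  also have "\<dots> = sw (\<lambda>a1 ar. sw (\<lambda>a2 a3. sw (\<lambda>b' b3. sw (\<lambda>b1 b2. ?E a1 b1 a2 b2 a3 b3)
          b') b) ar) a"
    by (intro tlift_cong coassoc[symmetric] lin)
  also have "\<dots> = sw (\<lambda>a' a3. sw (\<lambda>a1 a2. sw (\<lambda>b' b3. sw (\<lambda>b1 b2. ?E a1 b1 a2 b2 a3 b3)
          b') b) a') a"
    by (intro coassoc[symmetric] lin)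
  also have "\<dots> = sw (\<lambda>a' a3. sw (\<lambda>b' b3. sw (\<lambda>a1 a2. sw (\<lambda>b1 b2. ?E a1 b1 a2 b2 a3 b3)
          b') a') b) a"
    by (intro tlift_cong tlift_swap)
  also have "\<dots> = sw (\<lambda>a' a3. sw (\<lambda>b' b3.
      sw (\<lambda>x y. mul A (S x) (mul A y (mul A (S b3) (S a3)))) (mul A a' b'))
       b) a"
    by (subst comul_mul_tlift, (intro lin)+) (simp add: mul_assoc)
  also have "\<dots> = sw (\<lambda>a' a3. counit A a' *s sw (\<lambda>b' b3. counit A b' *s mul A (S b3) (S a3))
       b) a"
    by (simp add: S_left' tlift_scale[symmetric] vector_smult_assoc)
  also have "\<dots> = sw (\<lambda>a' a3. counit A a' *s mul A (S b) (S a3)) a"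
    by (subst counit_left) (intro lin | simp)+
  also have "\<dots> = mul A (S b) (S a)" by (rule counit_left) (intro lin)
  finally show ?thesis .
qed

text \<open>Both sides are convolution inverse to the coproduct, as maps into the tensor square.\<close>
lemma comul_S: "comul A (S a) = sw (\<lambda>b c. S c \<otimes>\<^sub>v S b) a"
proof (rule convolution_inverse_unique[where B = "tensor_square A" and G = "comul A" and a = a
      and F = "\<lambda>a. comul A (S a)"])
  show "is_algebra (tensor_square A)" by (rule tensor_square_is_algebra)
  show "sw (\<lambda>b c. mul (tensor_square A) (comul A (S b)) (comul A c)) a =
      counit A a *s unt (tensor_square A)" for a
  proof -
    have "sw (\<lambda>b c. mul (tensor_square A) (comul A (S b)) (comul A c)) a =
      comul A (sw (\<lambda>b c. mul A (S b) c) a)"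
      by (subst vlinear_tlift[where f = "comul A"]) (intro lin | simp add: comul_mul)+
    then show ?thesis
      by (simp add: S_left vlinear_scale[OF lin_comul[OF lin_basic(1)]] comul_unt tensor_unt)
  qed
  show "sw (\<lambda>b c. mul (tensor_square A) (comul A b) (sw (\<lambda>b c. S c \<otimes>\<^sub>v S b) c)) a =
      counit A a *s unt (tensor_square A)" for a
  proof -
    have "sw (\<lambda>b c. mul (tensor_square A) (comul A b) (sw (\<lambda>c1 c2. S c2 \<otimes>\<^sub>v S c1) c)) a =
      sw (\<lambda>b c. mul (tensor_square A) (sw (\<lambda>b1 b2. b1 \<otimes>\<^sub>v b2) b) (sw (\<lambda>c1 c2. S c2 \<otimes>\<^sub>v S c1) c)) a"
      by (simp only: tlift_tens_id)
    also have "\<dots> = sw (\<lambda>b c. sw (\<lambda>c1 c2. sw (\<lambda>b1 b2. mul A b1 (S c2) \<otimes>\<^sub>v mul A b2 (S c1)) b) c) a"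
      by (simp add: T.mul_tlift tensor_mul)
    also have "\<dots> = sw (\<lambda>b c. sw (\<lambda>b1 b2. sw (\<lambda>c1 c2. mul A b1 (S c2) \<otimes>\<^sub>v mul A b2 (S c1)) c) b) a"
      by (intro tlift_cong tlift_swap)
    also have "\<dots> = sw (\<lambda>b1 c'. sw (\<lambda>b2 c. sw (\<lambda>c1 c2. mul A b1 (S c2) \<otimes>\<^sub>v mul A b2 (S c1)) c) c') a"
      by (intro coassoc lin)
    also have "\<dots> = sw (\<lambda>b1 c'. sw (\<lambda>d c2. sw (\<lambda>b2 c1. mul A b1 (S c2) \<otimes>\<^sub>v mul A b2 (S c1)) d) c') a"
      by (intro tlift_cong coassoc[symmetric] lin)
    also have "\<dots> = sw (\<lambda>b1 c'. sw (\<lambda>d c2. counit A d *s (mul A b1 (S c2) \<otimes>\<^sub>v unt A)) c') a"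
      by (simp add: vlinear_tlift[OF lin_tens(2)[OF lin_basic(1)], symmetric] S_right
           vlinear_scale[OF lin_tens(2)[OF lin_basic(1)]])
    also have "\<dots> = sw (\<lambda>b1 c'. mul A b1 (S c') \<otimes>\<^sub>v unt A) a"
      by (intro tlift_cong counit_left lin)
    also have "\<dots> = counit A a *s unt (tensor_square A)"
      by (simp add: vlinear_tlift[OF lin_tens(1)[OF lin_basic(1)], symmetric] S_right
           vlinear_scale[OF lin_tens(1)[OF lin_basic(1)]] tensor_unt)
    finally show ?thesis .
  qed
qed (intro lin)+

lemma grouplike_S: "grouplike c \<Longrightarrow> is_inverse A c (S c)"
proof -
  assume c: "grouplike c"
  have "tlift (\<lambda>a b. mul A (S a) b) (c \<otimes>\<^sub>v c) = mul A (S c) c"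
    "tlift (\<lambda>a b. mul A a (S b)) (c \<otimes>\<^sub>v c) = mul A c (S c)"
    by (subst tlift_tens; (intro lin | simp))+
  then show ?thesis using c S_left[of c] S_right[of c] by (simp add: grouplike_def is_inverse_def)
qed

lemma grouplike_S_grouplike: "grouplike c \<Longrightarrow> grouplike (S c)"
  by (rule grouplike_if_invertible[of _ c])
     (simp add: comul_S grouplike_def tlift_tens lin, use grouplike_S in \<open>auto simp: is_inverse_def\<close>)

end

section \<open>The dual of a bialgebra\<close>

lemma dual_expansion: "(\<And>y. pairing (F::'k::field^'i::finite) y = \<phi> y) \<Longrightarrow> F = (\<Sum>l\<in>UNIV. \<phi> (axis l 1) *s axis l 1)"
  using basis_expansion[of F] by (metis (mono_tags, lifting) pairing_axis(1) sum.cong)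

text \<open>A linear map may be moved across the canonical element as its transpose.\<close>
lemma can_transpose:
  assumes G: "\<And>f y. pairing (G f) y = pairing f (F y)"
    and \<beta>: "\<And>f. vlinear (\<lambda>a. \<beta> a f)" "\<And>a. vlinear (\<lambda>f. \<beta> a f)"
  shows "can (\<lambda>a f. \<beta> a (G f)) = can (\<lambda>a f. \<beta> (F a) f)"
proof -
  have "can (\<lambda>a f. \<beta> a (G f)) = (\<Sum>i\<in>UNIV. \<Sum>l\<in>UNIV. F (axis l 1) $ i *s \<beta> (axis i 1) (axis l 1))"
    unfolding can_def by (subst dual_expansion[OF G])
      (simp add: vlinear_sum[OF \<beta>(2)] vlinear_scale[OF \<beta>(2)])
  also have "\<dots> = (\<Sum>l\<in>UNIV. \<beta> (F (axis l 1)) (axis l 1))"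
    by (subst sum.swap) (simp add: vlinear_expansion[OF \<beta>(1), symmetric])
  finally show ?thesis by (simp add: can_def)
qed

context bialgebra
begin

text \<open>The second leg is split, as in the definition of the product of the double.\<close>
definition sw3 :: "('k ^ 'i \<Rightarrow> 'k ^ 'i \<Rightarrow> 'k ^ 'i \<Rightarrow> 'k ^ 'l::finite) \<Rightarrow> 'k ^ 'i \<Rightarrow> 'k ^ 'l" where
  "sw3 \<gamma> a = sw (\<lambda>a1 a'. sw (\<lambda>a2 a3. \<gamma> a1 a2 a3) a') a"

lemma lin_sw3_param [lin]:
  "(\<And>a b c. vlinear (\<lambda>x. \<gamma> x a b c)) \<Longrightarrow> vlinear (\<lambda>x. sw3 (\<lambda>a b c. \<gamma> x a b c) y)"
  unfolding sw3_def by (intro lin)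

lemma lin_sw3 [lin]: "vlinear f \<Longrightarrow> vlinear (\<lambda>x. sw3 \<gamma> (f x))"
  unfolding sw3_def by (intro lin)

lemma vlinear_sw3: "vlinear h \<Longrightarrow> h (sw3 \<gamma> a) = sw3 (\<lambda>a1 a2 a3. h (\<gamma> a1 a2 a3)) a"
  unfolding sw3_def by (simp add: vlinear_tlift)

lemma sw3_cong: "(\<And>a1 a2 a3. \<gamma> a1 a2 a3 = \<gamma>' a1 a2 a3) \<Longrightarrow> sw3 \<gamma> a = sw3 \<gamma>' a"
  by (simp add: sw3_def)

lemma sw3_swap: "sw3 (\<lambda>a1 a2 a3. sw3 (\<lambda>b1 b2 b3. \<gamma> a1 a2 a3 b1 b2 b3) b) a =
   sw3 (\<lambda>b1 b2 b3. sw3 (\<lambda>a1 a2 a3. \<gamma> a1 a2 a3 b1 b2 b3) a) b"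
  (is "?L = ?R")
proof -
  have "?L = sw (\<lambda>a1 a'. sw (\<lambda>b1 b'. sw (\<lambda>a2 a3. sw (\<lambda>b2 b3. \<gamma> a1 a2 a3 b1 b2 b3) b')
     a') b) a"
    unfolding sw3_def by (intro tlift_cong tlift_swap)
  also have "\<dots> = sw (\<lambda>b1 b'. sw (\<lambda>a1 a'. sw (\<lambda>a2 a3. sw (\<lambda>b2 b3. \<gamma> a1 a2 a3 b1 b2 b3) b')
     a') a) b"
    by (rule tlift_swap)
  also have "\<dots> = sw (\<lambda>b1 b'. sw (\<lambda>a1 a'. sw (\<lambda>b2 b3. sw (\<lambda>a2 a3. \<gamma> a1 a2 a3 b1 b2 b3) a')
     b') a) b"
    by (intro tlift_cong tlift_swap)
  also have "\<dots> = ?R" unfolding sw3_def by (intro tlift_cong tlift_swap)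
  finally show ?thesis .
qed

lemma can_sw3: "sw3 (\<lambda>a b c. can (\<lambda>e f. \<beta> e f a b c)) x = can (\<lambda>e f. sw3 (\<lambda>a b c. \<beta> e f a b c) x)"
  unfolding sw3_def by (simp add: can_tlift)

lemma sw3_mul:
  assumes "\<And>b c. vlinear (\<lambda>a. \<gamma> a b c)" "\<And>a c. vlinear (\<lambda>b. \<gamma> a b c)" "\<And>a b. vlinear (\<lambda>c. \<gamma> a b c)"
  shows "sw3 \<gamma> (mul A a b) = sw3 (\<lambda>a1 a2 a3. sw3 (\<lambda>b1 b2 b3. \<gamma> (mul A a1 b1) (mul A a2 b2) (mul A a3 b3)) b) a"
proof -
  have l: "vlinear f \<Longrightarrow> vlinear (\<lambda>x. \<gamma> (f x) b c)" "vlinear f \<Longrightarrow> vlinear (\<lambda>x. \<gamma> a (f x) c)"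
    "vlinear f \<Longrightarrow> vlinear (\<lambda>x. \<gamma> a b (f x))" for f :: "'k ^ 'i \<Rightarrow> 'k ^ 'i" and a b c
    by (fact vlinear_compose[OF assms(1)] vlinear_compose[OF assms(2)] vlinear_compose[OF assms(3)])+
  have "sw3 \<gamma> (mul A a b) = sw (\<lambda>a1 a'. sw (\<lambda>b1 b'.
      sw (\<lambda>c1 c2. \<gamma> (mul A a1 b1) c1 c2) (mul A a' b')) b) a"
    unfolding sw3_def by (rule comul_mul_tlift) (intro lin l)+
  also have "\<dots> = sw (\<lambda>a1 a'. sw (\<lambda>b1 b'. sw (\<lambda>a2 a3. sw (\<lambda>b2 b3.
      \<gamma> (mul A a1 b1) (mul A a2 b2) (mul A a3 b3)) b') a') b) a"
    by (intro tlift_cong comul_mul_tlift lin l)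
  also have "\<dots> = sw3 (\<lambda>a1 a2 a3. sw3 (\<lambda>b1 b2 b3. \<gamma> (mul A a1 b1) (mul A a2 b2) (mul A a3 b3)) b) a"
    unfolding sw3_def by (intro tlift_cong tlift_swap)
  finally show ?thesis .
qed

lemma slinear_conv: "slinear (\<lambda>y. pairing F (comul A y))"
  by (rule slinear_compose[OF slinear_pairing(1)]) (intro lin)

lemma pairing_conv: "pairing (convolution A f p) y = pairing (f \<otimes>\<^sub>v p) (comul A y)"
  unfolding convolution_def by (rule pairing_functional[OF slinear_conv])

lemma pairing_conv': "pairing (convolution A f p) y *s v = sw (\<lambda>a b. pairing f a *s (pairing p b *s v)) y"
  by (simp only: pairing_conv pairing_tens_tlift)

lemma lin_conv [lin]:
  "vlinear f \<Longrightarrow> vlinear (\<lambda>x. convolution A (f x) p)"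
  "vlinear f \<Longrightarrow> vlinear (\<lambda>x. convolution A p (f x))"
  unfolding convolution_def
  by (intro lin_functional slinear_compose[OF slinear_pairing(2)] lin; assumption)+

lemma pairing_counit [simp]: "pairing (functional (counit A)) a = counit A a"
  by (rule pairing_functional[OF slinear_counit])

lemma conv_assoc: "convolution A (convolution A f p) r = convolution A f (convolution A p r)"
proof (rule pairing_eqI, rule scalar_eqI)
  fix y :: "'k ^ 'i" and v :: "'k ^ 1"
  show "pairing (convolution A (convolution A f p) r) y *s v =
      pairing (convolution A f (convolution A p r)) y *s v"
    unfolding pairing_conv' vlinear_tlift[OF lin_basic(3)[OF lin_basic(1)]]
    by (rule coassoc) (intro lin)+
qed

lemma conv_counit [simp]: "convolution A (functional (counit A)) f = f" "convolution A f (functional (counit A)) = f"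
proof -
  have l: "vlinear (\<lambda>a. pairing f a *s v)" for v :: "'k ^ 1" by (intro lin)
  show "convolution A (functional (counit A)) f = f"
    by (rule pairing_eqI, rule scalar_eqI) (simp only: pairing_conv' pairing_counit counit_left[OF l])
  show "convolution A f (functional (counit A)) = f"
  proof (rule pairing_eqI, rule scalar_eqI)
    fix y :: "'k ^ 'i" and v :: "'k ^ 1"
    have "pairing (convolution A f (functional (counit A))) y *s v =
       sw (\<lambda>a b. counit A b *s (pairing f a *s v)) y"
      unfolding pairing_conv' pairing_counit by (intro tlift_cong) (simp add: vector_smult_assoc mult.commute)
    then show "pairing (convolution A f (functional (counit A))) y *s v = pairing f y *s v"
      by (simp only: counit_right[OF l])
  qed
qed

lemmas conv_scale [simp] = vlinear_scale[OF lin_conv(1)[OF lin_basic(1)]] vlinear_scale[OF lin_conv(2)[OF lin_basic(1)]]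

text \<open>
  Splitting the algebra leg of the canonical element by the coproduct is the same as having two
  canonical elements and multiplying their dual legs. With \<open>can_cop\<close> below, for the dual coproduct, this
  replaces the coproduct axioms of the \<open>R\<close>-matrix.
\<close>
lemma can_conv:
  assumes "\<And>a b. vlinear (\<lambda>f. \<gamma> a b f)"
  shows "can (\<lambda>a f. sw (\<lambda>a1 a2. \<gamma> a1 a2 f) a) =
    can (\<lambda>a f. can (\<lambda>b p. \<gamma> a b (convolution A f p)))"
proof -
  have e: "convolution A (axis i 1) (axis k 1) = (\<Sum>l\<in>UNIV. comul A (axis l 1) $ (i, k) *s axis l 1)" for i k
    by (rule dual_expansion) (simp add: pairing_conv axis_pair[symmetric])
  have "can (\<lambda>a f. can (\<lambda>b p. \<gamma> a b (convolution A f p))) = (\<Sum>i\<in>UNIV. \<Sum>k\<in>UNIV. \<Sum>l\<in>UNIV.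
      comul A (axis l 1) $ (i, k) *s \<gamma> (axis i 1) (axis k 1) (axis l 1))"
    unfolding can_def e by (simp add: vlinear_sum[OF assms] vlinear_scale[OF assms])
  also have "\<dots> = (\<Sum>l\<in>UNIV. \<Sum>i\<in>UNIV. \<Sum>k\<in>UNIV.
      comul A (axis l 1) $ (i, k) *s \<gamma> (axis i 1) (axis k 1) (axis l 1))"
    by (subst (2) sum.swap, subst sum.swap) (rule refl)
  finally show ?thesis by (simp add: can_def tlift_def)
qed

text \<open>
  Writing the dual coproduct with canonical elements turns its properties into those of the
  multiplication of the algebra.
\<close>
lemma cop_tlift:
  "tlift \<beta> (cop_dual_comul A f) = can (\<lambda>a p. can (\<lambda>b r. pairing f (mul A b a) *s \<beta> p r))"
  by (simp add: tlift_def can_def cop_dual_comul_def)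

lemma pairing_cop: "pairing (cop_dual_comul A f) (y \<otimes>\<^sub>v z) = pairing f (mul A z y)"
proof (rule scalar_eqI)
  fix v :: "'k ^ 1"
  have "pairing (cop_dual_comul A f) (y \<otimes>\<^sub>v z) *s v = pairing f (mul A z y) *s v"
  proof (rule vlinear_eqI[where a = y], (intro lin)+)
    show "pairing (cop_dual_comul A f) (axis i 1 \<otimes>\<^sub>v z) *s v = pairing f (mul A z (axis i 1)) *s v" for i
      by (rule vlinear_eqI[where a = z], (intro lin)+) (simp add: axis_pair[symmetric] cop_dual_comul_def)
  qed
  then show "pairing (cop_dual_comul A f) (y \<otimes>\<^sub>v z) *s v = pairing f (mul A z y) *s v" .
qed

lemma lin_cop [lin]: "vlinear f \<Longrightarrow> vlinear (\<lambda>x. cop_dual_comul A (f x))"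
  unfolding cop_dual_comul_def
  by (auto intro!: vlinearI simp: vec_eq_iff vlinear_add vlinear_scale
     slinear_pairing(2)[unfolded slinear_def])

lemma cop_coassoc:
  assumes "\<And>b c. vlinear (\<lambda>a. \<beta> a b c)" "\<And>a c. vlinear (\<lambda>b. \<beta> a b c)" "\<And>a b. vlinear (\<lambda>c. \<beta> a b c)"
  shows "tlift (\<lambda>b c. tlift (\<lambda>b1 b2. \<beta> b1 b2 c) (cop_dual_comul A b)) (cop_dual_comul A f) =
    tlift (\<lambda>b c. tlift (\<lambda>c1 c2. \<beta> b c1 c2) (cop_dual_comul A c)) (cop_dual_comul A f)"
proof -
  have "tlift (\<lambda>b c. tlift (\<lambda>b1 b2. \<beta> b1 b2 c) (cop_dual_comul A b)) (cop_dual_comul A f) =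
    can (\<lambda>b r. can (\<lambda>c s. can (\<lambda>d t. can (\<lambda>a p. pairing p (mul A d c) *s (pairing f (mul A b a) *s \<beta> s t r)))))"
    unfolding cop_tlift vlinear_can[OF lin_basic(3)[OF lin_basic(1)]]
    apply (subst can_swap)
    apply (subst (2) can_swap)
    apply (subst (3) can_swap)
    apply (simp add: vector_smult_assoc mult.commute)
    done
  also have "\<dots> = can (\<lambda>b r. can (\<lambda>c s. can (\<lambda>d t. pairing f (mul A b (mul A d c)) *s \<beta> s t r)))"
    by (subst can_eval) (intro lin | simp)+
  finally have 1: "tlift (\<lambda>b c. tlift (\<lambda>b1 b2. \<beta> b1 b2 c) (cop_dual_comul A b)) (cop_dual_comul A f) = \<dots>" .
  have "tlift (\<lambda>b c. tlift (\<lambda>c1 c2. \<beta> b c1 c2) (cop_dual_comul A c)) (cop_dual_comul A f) =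
     can (\<lambda>a p. can (\<lambda>c s. can (\<lambda>d t. can (\<lambda>b r. pairing r (mul A d c) *s (pairing f (mul A b a) *s \<beta> p s t)))))"
    unfolding cop_tlift vlinear_can[OF lin_basic(3)[OF lin_basic(1)]]
    apply (subst (2) can_swap)
    apply (subst (3) can_swap)
    apply (simp add: vector_smult_assoc mult.commute)
    done
  also have "\<dots> = can (\<lambda>a p. can (\<lambda>c s. can (\<lambda>d t. pairing f (mul A (mul A d c) a) *s \<beta> p s t)))"
    by (subst can_eval) (intro lin | simp)+
  also have "\<dots> = can (\<lambda>d t. can (\<lambda>a p. can (\<lambda>c s. pairing f (mul A (mul A d c) a) *s \<beta> p s t)))"
    by (subst (3) can_swap, subst can_swap) (rule refl)
  finally show ?thesis unfolding 1 by (simp add: mul_assoc)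
qed

lemma cop_counit: 
  assumes "vlinear \<phi>"
  shows "tlift (\<lambda>b c. pairing b (unt A) *s \<phi> c) (cop_dual_comul A f) = \<phi> f"
    and "tlift (\<lambda>b c. pairing c (unt A) *s \<phi> b) (cop_dual_comul A f) = \<phi> f"
proof -
  have "tlift (\<lambda>b c. pairing b (unt A) *s \<phi> c) (cop_dual_comul A f) =
    can (\<lambda>b r. can (\<lambda>a p. pairing p (unt A) *s (pairing f (mul A b a) *s \<phi> r)))"
    unfolding cop_tlift by (subst can_swap) (simp add: vector_smult_assoc mult.commute)
  also have "\<dots> = can (\<lambda>b r. pairing f b *s \<phi> r)" by (subst can_eval) (intro lin | simp)+
  finally show "tlift (\<lambda>b c. pairing b (unt A) *s \<phi> c) (cop_dual_comul A f) = \<phi> f"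
    using can_eval'[OF assms] by simp
  have "tlift (\<lambda>b c. pairing c (unt A) *s \<phi> b) (cop_dual_comul A f) =
    can (\<lambda>b r. can (\<lambda>a p. pairing p (unt A) *s (pairing f (mul A a b) *s \<phi> r)))"
    unfolding cop_tlift by (simp add: vector_smult_assoc mult.commute)
  also have "\<dots> = can (\<lambda>b r. pairing f b *s \<phi> r)" by (subst can_eval) (intro lin | simp)+
  finally show "tlift (\<lambda>b c. pairing c (unt A) *s \<phi> b) (cop_dual_comul A f) = \<phi> f"
    using can_eval'[OF assms] by simp
qed

lemma sw3_tlift_swap: "tlift (\<lambda>p r. sw3 (\<lambda>a b c. \<gamma> p r a b c) a) t = sw3 (\<lambda>a b c. tlift (\<lambda>p r. \<gamma> p r a b c) t) a"
proof -
  have "tlift (\<lambda>p r. sw3 (\<lambda>a b c. \<gamma> p r a b c) a) t =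
    sw (\<lambda>a1 a'. tlift (\<lambda>p r. sw (\<lambda>b c. \<gamma> p r a1 b c) a') t) a"
    unfolding sw3_def by (rule tlift_swap)
  also have "\<dots> = sw3 (\<lambda>a b c. tlift (\<lambda>p r. \<gamma> p r a b c) t) a"
    unfolding sw3_def by (rule tlift_cong, rule tlift_swap)
  finally show ?thesis .
qed

lemma cop_conv:
  assumes "\<And>b. vlinear (\<lambda>a. \<beta> a b)" "\<And>a. vlinear (\<lambda>b. \<beta> a b)"
  shows "tlift \<beta> (cop_dual_comul A (convolution A f p)) =
    tlift (\<lambda>f1 f2. tlift (\<lambda>p1 p2. \<beta> (convolution A f1 p1) (convolution A f2 p2)) (cop_dual_comul A p)) (cop_dual_comul A f)"
proof -
  note l = vlinear_compose[OF assms(1)] vlinear_compose[OF assms(2)]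
  let ?c = "convolution A"
  let ?h = "\<lambda>f' p' r s. pairing f f' *s (pairing p p' *s \<beta> r s)"
  have 1: "pairing (?c f p) (mul A y x) *s v =
     sw (\<lambda>y1 y2. sw (\<lambda>x1 x2. pairing f (mul A y1 x1) *s (pairing p (mul A y2 x2) *s v)) x) y"
    for x y v
    unfolding pairing_conv' by (rule comul_mul_tlift) (intro lin)+
  have "tlift \<beta> (cop_dual_comul A (?c f p)) = can (\<lambda>x r. can (\<lambda>y s. sw (\<lambda>y1 y2. sw (\<lambda>x1 x2.
      ?h (mul A y1 x1) (mul A y2 x2) r s) x) y))"
    unfolding cop_tlift 1 ..
  also have "\<dots> = can (\<lambda>x r. can (\<lambda>d u. can (\<lambda>y s. sw (\<lambda>x1 x2.
      ?h (mul A d x1) (mul A y x2) r (?c u s)) x)))"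
    by (rule can_cong, rule can_conv) (intro lin l)
  also have "\<dots> = can (\<lambda>d u. can (\<lambda>x r. can (\<lambda>y s. sw (\<lambda>x1 x2.
      ?h (mul A d x1) (mul A y x2) r (?c u s)) x)))"
    by (rule can_swap)
  also have "\<dots> = can (\<lambda>d u. can (\<lambda>y s. can (\<lambda>x r. sw (\<lambda>x1 x2.
      ?h (mul A d x1) (mul A y x2) r (?c u s)) x)))"
    by (rule can_cong, rule can_swap)
  also have "\<dots> = can (\<lambda>d u. can (\<lambda>y s. can (\<lambda>c t. can (\<lambda>x r. 
      ?h (mul A d c) (mul A y x) (?c t r) (?c u s)))))"
    by (rule can_cong, rule can_cong, rule can_conv) (intro lin l)
  also have "\<dots> = can (\<lambda>d u. can (\<lambda>c t. can (\<lambda>y s. can (\<lambda>x r. 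
      ?h (mul A d c) (mul A y x) (?c t r) (?c u s)))))"
    by (rule can_cong, rule can_swap)
  also have "\<dots> = can (\<lambda>c t. can (\<lambda>d u. can (\<lambda>y s. can (\<lambda>x r. 
      ?h (mul A d c) (mul A y x) (?c t r) (?c u s)))))"
    by (rule can_swap)
  also have "\<dots> = can (\<lambda>c t. can (\<lambda>d u. can (\<lambda>x r. can (\<lambda>y s. 
      ?h (mul A d c) (mul A y x) (?c t r) (?c u s)))))"
    by (rule can_cong, rule can_cong, rule can_swap)
  also have "\<dots> = tlift (\<lambda>f1 f2. tlift (\<lambda>p1 p2. \<beta> (?c f1 p1) (?c f2 p2)) (cop_dual_comul A p)) (cop_dual_comul A f)"
    unfolding cop_tlift vlinear_can[OF lin_basic(3)[OF lin_basic(1)]] ..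
  finally show ?thesis .
qed

end

section \<open>The Drinfeld double is a bialgebra\<close>

text \<open>\<open>S'\<close> is the inverse of the antipode, which the product of the double refers to.\<close>
locale double = hopf H S for H :: "('k::field, 'i::finite) bialg" and S +
  fixes S' :: "'k ^ 'i \<Rightarrow> 'k ^ 'i"
  assumes S_S' [simp]: "S (S' a) = a" and S'_S [simp]: "S' (S a) = a"
begin

lemma lin_S' [lin]: "vlinear f \<Longrightarrow> vlinear (\<lambda>x. S' (f x))"
proof -
  have "S' (x + y) = S' x + S' y" for x y
    using vlinear_add[OF lin_S[OF lin_basic(1)], of "S' x" "S' y"] by (metis S_S' S'_S)
  moreover have "S' (c *s x) = c *s S' x" for c x
    using vlinear_scale[OF lin_S[OF lin_basic(1)], of c "S' x"] by (metis S_S' S'_S)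
  ultimately have "vlinear S'" by (intro vlinearI)
  then show "vlinear f \<Longrightarrow> vlinear (\<lambda>x. S' (f x))" by (rule vlinear_compose)
qed

lemma S'_mul: "S' (mul H a b) = mul H (S' b) (S' a)"
  using S_mul[of "S' b" "S' a"] by (metis S_S' S'_S)

lemma S'_unt [simp]: "S' (unt H) = unt H"
  using S_unt by (metis S'_S)

lemma counit_S' [simp]: "counit H (S' a) = counit H a"
  using counit_S[of "S' a"] by simp

lemma S'_right: "sw (\<lambda>b c. mul H c (S' b)) a = counit H a *s unt H"
  and S'_left: "sw (\<lambda>b c. mul H (S' c) b) a = counit H a *s unt H"
proof -
  have "S (sw (\<lambda>b c. mul H c (S' b)) a) = S (counit H a *s unt H)"
    using S_right[of a] by (simp add: vlinear_tlift[OF lin_S[OF lin_basic(1)]] S_mul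
      vlinear_scale[OF lin_S[OF lin_basic(1)]] S_unt)
  then show "sw (\<lambda>b c. mul H c (S' b)) a = counit H a *s unt H" by (metis S'_S)
  have "S (sw (\<lambda>b c. mul H (S' c) b) a) = S (counit H a *s unt H)"
    using S_left[of a] by (simp add: vlinear_tlift[OF lin_S[OF lin_basic(1)]] S_mul
      vlinear_scale[OF lin_S[OF lin_basic(1)]] S_unt)
  then show "sw (\<lambda>b c. mul H (S' c) b) a = counit H a *s unt H" by (metis S'_S)
qed

lemma S'_right': "sw (\<lambda>b c. mul H c (mul H (S' b) d)) a = counit H a *s d"
  using arg_cong[OF S'_right, of "\<lambda>x. mul H x d" a] by (simp add: mul_tlift mul_assoc)

lemma comul_S': "comul H (S' a) = sw (\<lambda>b c. S' c \<otimes>\<^sub>v S' b) a"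
proof -
  define G where "G = tlift (\<lambda>b c. S' c \<otimes>\<^sub>v S' b)"
  have G: "vlinear G" unfolding G_def by (intro lin)
  have "G (comul H a) = G (comul H (S (S' a)))" by simp
  also have "\<dots> = sw (\<lambda>b c. G (S c \<otimes>\<^sub>v S b)) (S' a)"
    unfolding comul_S by (rule vlinear_tlift[OF G])
  also have "\<dots> = sw (\<lambda>b c. b \<otimes>\<^sub>v c) (S' a)"
    unfolding G_def by (intro tlift_cong, subst tlift_tens) (intro lin | simp)+
  finally show ?thesis by (simp add: tlift_tens_id G_def)
qed

lemma inv_antipode: "inv (antipode H) = S'"
  unfolding antipode_eq by (rule inv_equality) simp_all

abbreviation eps where "eps \<equiv> functional (counit H)"
abbreviation conv where "conv \<equiv> convolution H"
abbreviation tw where "tw \<equiv> twisted H"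
abbreviation cop where "cop \<equiv> cop_dual_comul H"

lemma pairing_tw [simp]: "pairing (tw p c a) y = pairing p (mul H (S' c) (mul H y a))"
  unfolding twisted_def inv_antipode
  by (subst pairing_functional) (intro slinear_compose[OF slinear_pairing(1)] lin | simp add: mul_assoc)+

lemma lin_tw [lin]:
  "vlinear f \<Longrightarrow> vlinear (\<lambda>x. tw (f x) c a)"
  "vlinear f \<Longrightarrow> vlinear (\<lambda>x. tw p (f x) a)"
  "vlinear f \<Longrightarrow> vlinear (\<lambda>x. tw p c (f x))"
  unfolding twisted_def inv_antipode
  by (intro lin_functional slinear_compose[OF slinear_pairing(1)] slinear_compose[OF slinear_pairing(2)]
      lin; assumption)+

lemma tw_tw: "tw (tw p b' b) c a = tw p (mul H c b') (mul H a b)"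
  by (rule pairing_eqI) (simp add: mul_assoc S'_mul)

lemma tw_unt [simp]: "tw p (unt H) (unt H) = p"
  by (rule pairing_eqI) simp

lemma tw_eps [simp]: "tw eps c a = (counit H c * counit H a) *s eps"
  by (rule pairing_eqI) simp

lemma tw_conv: "tw (conv p r) c a =
  sw (\<lambda>c1 c2. sw (\<lambda>a1 a2. conv (tw p c2 a1) (tw r c1 a2)) a) c"
proof (rule pairing_eqI, rule scalar_eqI)
  fix y :: "'k ^ 'i" and v :: "'k ^ 1"
  have c: "vlinear (\<lambda>F. pairing F y *s v)" by (intro lin)
  have "pairing (tw (conv p r) c a) y *s v =
    sw (\<lambda>a b. pairing p a *s (pairing r b *s v)) (mul H (S' c) (mul H y a))"
    by (simp add: pairing_conv')
  also have "\<dots> = sw (\<lambda>c1 c2. sw (\<lambda>y1 y2. sw (\<lambda>a1 a2.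
     pairing p (mul H (S' c2) (mul H y1 a1)) *s (pairing r (mul H (S' c1) (mul H y2 a2)) *s v))
     a) y) c"
  proof -
    have s: "sw \<gamma> (S' c) = sw (\<lambda>c1 c2. \<gamma> (S' c2) (S' c1)) c"
      if "\<And>b. vlinear (\<lambda>a. \<gamma> a b)" "\<And>a. vlinear (\<lambda>b. \<gamma> a b)" for \<gamma> :: "'k ^ 'i \<Rightarrow> 'k ^ 'i \<Rightarrow> 'k ^ 1"
      unfolding comul_S' vlinear_tlift[OF lin_tlift[OF lin_basic(1)]]
      by (intro tlift_cong tlift_tens that)
    show ?thesis
      apply (subst comul_mul_tlift, (intro lin)+)
      apply (subst s, (intro lin)+)
      apply (intro tlift_cong)
      apply (subst comul_mul_tlift, (intro lin)+)
      apply (rule refl)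
      done
  qed
  also have "\<dots> = sw (\<lambda>c1 c2. sw (\<lambda>a1 a2. sw (\<lambda>y1 y2. 
     pairing p (mul H (S' c2) (mul H y1 a1)) *s (pairing r (mul H (S' c1) (mul H y2 a2)) *s v))
     y) a) c"
    by (intro tlift_cong tlift_swap)
  also have "\<dots> = pairing (sw (\<lambda>c1 c2. sw (\<lambda>a1 a2. conv (tw p c2 a1) (tw r c1 a2)) a) c) y *s v"
    unfolding vlinear_tlift[OF c] pairing_conv' by simp
  finally show "pairing (tw (conv p r) c a) y *s v = pairing (sw (\<lambda>c1 c2. sw (\<lambda>a1 a2. conv (tw p c2 a1) (tw r c1 a2)) a) c) y *s v" .
qed

abbreviation D where "D \<equiv> drinfeld_double H"

lemma lin_dmul [lin]:
  "vlinear f \<Longrightarrow> vlinear (\<lambda>x. mul D (f x) b)"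
  "vlinear f \<Longrightarrow> vlinear (\<lambda>x. mul D a (f x))"
  unfolding drinfeld_double_def by simp_all (intro lin | assumption)+

lemma dmul: "mul D (f \<otimes>\<^sub>v a) (p \<otimes>\<^sub>v b) = sw3 (\<lambda>a1 a2 a3. conv f (tw p a3 a1) \<otimes>\<^sub>v mul H a2 b) a"
  unfolding drinfeld_double_def sw3_def by simp ((subst tlift_tens, (intro lin)+)+, rule refl)

text \<open>
  \<open>j\<close> and \<open>\<iota>\<close> embed the dual and the algebra in the double. As \<open>f \<otimes>\<^sub>v a\<close> is \<open>j f\<close> times \<open>\<iota> a\<close>, all
  properties of the double reduce to the rule \<open>\<iota>_j\<close> for moving \<open>\<iota> a\<close> past \<open>j p\<close>.
\<close>
definition j where "j f = f \<otimes>\<^sub>v unt H"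
definition \<iota> where "\<iota> a = eps \<otimes>\<^sub>v a"

lemma lin_j [lin]: "vlinear f \<Longrightarrow> vlinear (\<lambda>x. j (f x))"
  and lin_\<iota> [lin]: "vlinear g \<Longrightarrow> vlinear (\<lambda>x. \<iota> (g x))"
  unfolding j_def \<iota>_def by (intro lin; assumption)+

lemma sw3_unt:
  assumes "\<And>b c. vlinear (\<lambda>a. \<gamma> a b c)" "\<And>a c. vlinear (\<lambda>b. \<gamma> a b c)" "\<And>a b. vlinear (\<lambda>c. \<gamma> a b c)"
  shows "sw3 \<gamma> (unt H) = \<gamma> (unt H) (unt H) (unt H)"
  unfolding sw3_def comul_unt
  by (subst tlift_tens, (intro lin assms)+, subst comul_unt, subst tlift_tens) (intro lin assms | rule refl)+

lemma dmul_j: "mul D (j f) (p \<otimes>\<^sub>v b) = conv f p \<otimes>\<^sub>v b"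
  unfolding j_def dmul by (subst sw3_unt) (intro lin | simp)+

lemma dmul_\<iota>: "mul D (f \<otimes>\<^sub>v a) (\<iota> b) = f \<otimes>\<^sub>v mul H a b"
proof -
  have "mul D (f \<otimes>\<^sub>v a) (\<iota> b) = sw (\<lambda>a1 a'. sw (\<lambda>a2 a3. counit H a3 *s (counit H a1 *s (f \<otimes>\<^sub>v mul H a2 b))) a') a"
    unfolding \<iota>_def dmul sw3_def
    by (simp add: vlinear_scale[OF lin_tens(1)[OF lin_basic(1)]] vector_smult_assoc)
  also have "\<dots> = sw (\<lambda>a1 a'. counit H a1 *s (f \<otimes>\<^sub>v mul H a' b)) a"
    by (intro tlift_cong counit_right lin)
  also have "\<dots> = f \<otimes>\<^sub>v mul H a b" by (rule counit_left) (intro lin)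
  finally show ?thesis .
qed

lemma j_\<iota>: "mul D (j f) (\<iota> a) = f \<otimes>\<^sub>v a"
  by (simp add: j_def dmul_\<iota>)

lemma \<iota>_j: "mul D (\<iota> a) (j p) = sw3 (\<lambda>a1 a2 a3. tw p a3 a1 \<otimes>\<^sub>v a2) a"
  unfolding \<iota>_def j_def dmul by simp

lemma dmul_decompose: "mul D (f \<otimes>\<^sub>v a) (p \<otimes>\<^sub>v b) = mul D (j f) (mul D (mul D (\<iota> a) (j p)) (\<iota> b))"
  unfolding dmul \<iota>_j vlinear_sw3[OF lin_dmul(1)[OF lin_basic(1)]] vlinear_sw3[OF lin_dmul(2)[OF lin_basic(1)]]
  by (simp add: dmul_j dmul_\<iota>)

text \<open>
  Moving a product past \<open>j r\<close> means moving its factors one after the other; this lemma and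
  \<open>\<iota>_j_conv\<close>, its counterpart for a product in the dual, are the whole content of associativity.
\<close>
lemma \<iota>_mul_j: "mul D (\<iota> (mul H a b)) (j r) = 
   sw3 (\<lambda>b1 b2 b3. mul D (mul D (\<iota> a) (j (tw r b3 b1))) (\<iota> b2)) b"
proof -
  have "mul D (\<iota> (mul H a b)) (j r) = sw3 (\<lambda>a1 a2 a3. sw3 (\<lambda>b1 b2 b3.
      tw r (mul H a3 b3) (mul H a1 b1) \<otimes>\<^sub>v mul H a2 b2) b) a"
    unfolding \<iota>_j by (rule sw3_mul) (intro lin)+
  also have "\<dots> = sw3 (\<lambda>b1 b2 b3. sw3 (\<lambda>a1 a2 a3.
      tw (tw r b3 b1) a3 a1 \<otimes>\<^sub>v mul H a2 b2) a) b"
    by (subst sw3_swap) (simp add: tw_tw)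
  also have "\<dots> = sw3 (\<lambda>b1 b2 b3. mul D (mul D (\<iota> a) (j (tw r b3 b1))) (\<iota> b2)) b"
    unfolding \<iota>_j vlinear_sw3[OF lin_dmul(1)[OF lin_basic(1)]] dmul_\<iota> ..
  finally show ?thesis .
qed

lemma \<iota>_j_conv: "mul D (\<iota> a) (j (conv p s)) = 
   sw3 (\<lambda>a1 a2 a3. mul D (j (tw p a3 a1)) (mul D (\<iota> a2) (j s))) a"
proof -
  let ?g = "\<lambda>x1 x2 x3 x4 x5. conv (tw p x5 x1) (tw s x4 x2) \<otimes>\<^sub>v x3"
  have "mul D (\<iota> a) (j (conv p s)) = sw (\<lambda>a1 a'. sw (\<lambda>a2 a3. sw (\<lambda>c1 c2. sw (\<lambda>d1 d2.
     ?g d1 d2 a2 c1 c2) a1) a3) a') a"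
    unfolding \<iota>_j sw3_def tw_conv by (simp add: vlinear_tlift[OF lin_tens(1)[OF lin_basic(1)]])
  also have "\<dots> = sw (\<lambda>a1 a'. sw (\<lambda>a2 a3. sw (\<lambda>d1 d2. sw (\<lambda>c1 c2. 
     ?g d1 d2 a2 c1 c2) a3) a1) a') a"
    by (intro tlift_cong tlift_swap)
  also have "\<dots> = sw (\<lambda>a1 a'. sw (\<lambda>d1 d2. sw (\<lambda>a2 a3. sw (\<lambda>c1 c2. 
     ?g d1 d2 a2 c1 c2) a3) a') a1) a"
    by (intro tlift_cong tlift_swap)
  also have "\<dots> = sw (\<lambda>d1 r. sw (\<lambda>d2 a'. sw (\<lambda>a2 a3. sw (\<lambda>c1 c2. 
     ?g d1 d2 a2 c1 c2) a3) a') r) a"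
    by (intro coassoc lin)
  finally have 1: "mul D (\<iota> a) (j (conv p s)) = \<dots>" .
  have "sw3 (\<lambda>a1 a2 a3. mul D (j (tw p a3 a1)) (mul D (\<iota> a2) (j s))) a =
    sw (\<lambda>a1 a'. sw (\<lambda>a2 a3. sw (\<lambda>b1 b'. sw (\<lambda>b2 b3. ?g a1 b1 b2 b3 a3)
      b') a2) a') a"
    unfolding \<iota>_j sw3_def vlinear_tlift[OF lin_dmul(2)[OF lin_basic(1)]] dmul_j ..
  also have "\<dots> = sw (\<lambda>a1 a'. sw (\<lambda>b1 r. sw (\<lambda>b' a3. sw (\<lambda>b2 b3. ?g a1 b1 b2 b3 a3)
      b') r) a') a"
    by (intro tlift_cong coassoc lin)
  also have "\<dots> = sw (\<lambda>a1 a'. sw (\<lambda>b1 r. sw (\<lambda>b2 r'. sw (\<lambda>b3 a3. ?g a1 b1 b2 b3 a3)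
      r') r) a') a"
    by (intro tlift_cong coassoc lin)
  finally show ?thesis unfolding 1 by simp
qed

lemma j_mul_assoc: "mul D (j f) (mul D s t) = mul D (mul D (j f) s) t"
proof (rule tens_eqI[where t = s], (intro lin)+)
  fix p :: "'k ^ 'i" and a
  show "mul D (j f) (mul D (p \<otimes>\<^sub>v a) t) = mul D (mul D (j f) (p \<otimes>\<^sub>v a)) t"
    by (rule tens_eqI[where t = t], (intro lin)+)
       (simp add: dmul dmul_j vlinear_sw3[OF lin_dmul(2)[OF lin_basic(1)]] conv_assoc)
qed

lemma \<iota>_mul_assoc: "mul D s (mul D t (\<iota> b)) = mul D (mul D s t) (\<iota> b)"
proof (rule tens_eqI[where t = s], (intro lin)+)
  fix p :: "'k ^ 'i" and a
  show "mul D (p \<otimes>\<^sub>v a) (mul D t (\<iota> b)) = mul D (mul D (p \<otimes>\<^sub>v a) t) (\<iota> b)"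
    by (rule tens_eqI[where t = t], (intro lin)+)
       (simp add: dmul dmul_\<iota> vlinear_sw3[OF lin_dmul(1)[OF lin_basic(1)]] mul_assoc)
qed

lemma double_is_algebra: "is_algebra D"
proof -
  have 1: "mul D (mul D (mul D (\<iota> a) (j p)) (\<iota> b)) (j r) = mul D (\<iota> a) (mul D (j p) (mul D (\<iota> b) (j r)))" for a p b r
  proof -
    have "mul D (mul D (mul D (\<iota> a) (j p)) (\<iota> b)) (j r) =
       sw3 (\<lambda>a1 a2 a3. mul D (j (tw p a3 a1)) (mul D (\<iota> (mul H a2 b)) (j r))) a"
      unfolding \<iota>_j[of a] vlinear_sw3[OF lin_dmul(1)[OF lin_basic(1)]] dmul_\<iota> j_mul_assoc j_\<iota> ..
    also have "\<dots> = sw3 (\<lambda>a1 a2 a3. sw3 (\<lambda>b1 b2 b3. mul D (j (tw p a3 a1)) (mul D (mul D (\<iota> a2) (j (tw r b3 b1))) (\<iota> b2))) b) a"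
      unfolding \<iota>_mul_j vlinear_sw3[OF lin_dmul(2)[OF lin_basic(1)]] ..
    also have "\<dots> = sw3 (\<lambda>b1 b2 b3. sw3 (\<lambda>a1 a2 a3. mul D (mul D (j (tw p a3 a1)) (mul D (\<iota> a2) (j (tw r b3 b1)))) (\<iota> b2)) a) b"
      by (subst sw3_swap) (simp only: \<iota>_mul_assoc)
    also have "\<dots> = sw3 (\<lambda>b1 b2 b3. mul D (mul D (\<iota> a) (j (conv p (tw r b3 b1)))) (\<iota> b2)) b"
      unfolding \<iota>_j_conv vlinear_sw3[OF lin_dmul(1)[OF lin_basic(1)]] ..
    also have "\<dots> = mul D (\<iota> a) (mul D (j p) (mul D (\<iota> b) (j r)))"
      unfolding \<iota>_mul_assoc[symmetric] j_\<iota> \<iota>_j[of b] vlinear_sw3[OF lin_dmul(2)[OF lin_basic(1)]] dmul_j ..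
    finally show ?thesis .
  qed
  have 2: "mul D (mul D (f \<otimes>\<^sub>v a) (p \<otimes>\<^sub>v b)) (r \<otimes>\<^sub>v c) = mul D (f \<otimes>\<^sub>v a) (mul D (p \<otimes>\<^sub>v b) (r \<otimes>\<^sub>v c))" for f a p b r c
  proof -
    have "mul D (mul D (f \<otimes>\<^sub>v a) (p \<otimes>\<^sub>v b)) (r \<otimes>\<^sub>v c) = 
       mul D (j f) (mul D (mul D (mul D (mul D (\<iota> a) (j p)) (\<iota> b)) (j r)) (\<iota> c))"
      unfolding dmul_decompose[of f a p b] j_mul_assoc[symmetric]
      by (simp only: j_\<iota>[of r c, symmetric] \<iota>_mul_assoc)
    also have "\<dots> = mul D (j f) (mul D (\<iota> a) (mul D (j p) (mul D (mul D (\<iota> b) (j r)) (\<iota> c))))"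
      unfolding 1 \<iota>_mul_assoc ..
    also have "\<dots> = mul D (f \<otimes>\<^sub>v a) (mul D (p \<otimes>\<^sub>v b) (r \<otimes>\<^sub>v c))"
      unfolding dmul_decompose[of p b r c] j_mul_assoc j_\<iota> ..
    finally show ?thesis .
  qed
  have 3: "mul D (mul D s t) r = mul D s (mul D t r)" for s t r
  proof (rule tens_eqI[where t = s], (intro lin)+)
    fix f a
    show "mul D (mul D (f \<otimes>\<^sub>v a) t) r = mul D (f \<otimes>\<^sub>v a) (mul D t r)"
    proof (rule tens_eqI[where t = t], (intro lin)+)
      fix p b
      show "mul D (mul D (f \<otimes>\<^sub>v a) (p \<otimes>\<^sub>v b)) r = mul D (f \<otimes>\<^sub>v a) (mul D (p \<otimes>\<^sub>v b) r)"
        by (rule tens_eqI[where t = r]) (intro lin 2)+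
    qed
  qed
  have u: "unt D = eps \<otimes>\<^sub>v unt H" by (simp add: drinfeld_double_def)
  have 4: "mul D (unt D) t = t" for t
    by (rule tens_eqI[where t = t], (intro lin)+) (simp add: u dmul_j[unfolded j_def])
  have 5: "mul D t (unt D) = t" for t
    by (rule tens_eqI[where t = t], (intro lin)+) (simp add: u dmul_\<iota>[unfolded \<iota>_def])
  show ?thesis unfolding is_algebra_def
    by (intro conjI allI lin_dmul lin_basic 3 4 5)
qed

sublocale D: algebra_on D
  by unfold_locales (rule double_is_algebra)

lemma double_unt: "unt D = eps \<otimes>\<^sub>v unt H"
  by (simp add: drinfeld_double_def)

lemma j_eps: "j eps = unt D" and \<iota>_unt: "\<iota> (unt H) = unt D"
  by (simp_all add: j_def \<iota>_def double_unt)

lemma j_mul_j: "mul D (j f) (j p) = j (conv f p)"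
  by (simp add: j_def dmul_j[unfolded j_def])

lemma \<iota>_mul_\<iota>: "mul D (\<iota> a) (\<iota> b) = \<iota> (mul H a b)"
  by (simp add: \<iota>_def dmul_\<iota>[unfolded \<iota>_def])

lemma lin_dcomul [lin]: "vlinear f \<Longrightarrow> vlinear (\<lambda>x. comul D (f x))"
  unfolding drinfeld_double_def by simp (intro lin)

lemma dcomul: "comul D (f \<otimes>\<^sub>v a) =
    tlift (\<lambda>f1 f2. sw (\<lambda>a1 a2. (f1 \<otimes>\<^sub>v a1) \<otimes>\<^sub>v (f2 \<otimes>\<^sub>v a2)) a) (cop f)"
  unfolding drinfeld_double_def by simp (subst tlift_tens, (intro lin)+, rule refl)

lemma tlift_dcomul:
  assumes "\<And>b. vlinear (\<lambda>a. \<beta> a b)" "\<And>a. vlinear (\<lambda>b. \<beta> a b)"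
  shows "tlift \<beta> (comul D (f \<otimes>\<^sub>v a)) =
    tlift (\<lambda>f1 f2. sw (\<lambda>a1 a2. \<beta> (f1 \<otimes>\<^sub>v a1) (f2 \<otimes>\<^sub>v a2)) a) (cop f)"
  unfolding dcomul vlinear_tlift[OF lin_tlift[OF lin_basic(1)]]
  by (intro tlift_cong tlift_tens assms)

lemma dcounit: "counit D (f \<otimes>\<^sub>v a) = pairing f (unt H) * counit H a"
proof -
  have "counit H a = (\<Sum>i\<in>UNIV. a $ i * counit H (axis i 1))"
    using pairing_counit[of a] by (simp add: pairing_def functional_def mult.commute)
  then have "pairing f (unt H) * counit H a =
      (\<Sum>i\<in>UNIV. \<Sum>j\<in>UNIV. (f $ i * unt H $ i) * (a $ j * counit H (axis j 1)))"
    by (simp add: pairing_def sum_product)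
  then show ?thesis
    by (simp add: drinfeld_double_def) (simp add: algebra_simps)
qed

lemma slinear_dcounit: "slinear (counit D)"
  unfolding drinfeld_double_def slinear_def
  by (simp add: algebra_simps sum.distrib sum_distrib_left)

lemma lin_dcounit [lin]: "vlinear f \<Longrightarrow> vlinear (\<lambda>x. counit D (f x) *s v)"
  by (rule slinear_scale_vec[OF slinear_dcounit])

lemma double_coassoc:
  assumes "\<And>b c. vlinear (\<lambda>a. \<beta> a b c)" "\<And>a c. vlinear (\<lambda>b. \<beta> a b c)" "\<And>a b. vlinear (\<lambda>c. \<beta> a b c)"
  shows "tlift (\<lambda>b c. tlift (\<lambda>b1 b2. \<beta> b1 b2 c) (comul D b)) (comul D t) =
    tlift (\<lambda>b c. tlift (\<lambda>c1 c2. \<beta> b c1 c2) (comul D c)) (comul D t)"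
proof (rule tens_eqI[where t = t], (intro lin)+)
  note l = vlinear_compose[OF assms(1)] vlinear_compose[OF assms(2)] vlinear_compose[OF assms(3)]
  fix f :: "'k ^ 'i" and a :: "'k ^ 'i"
  have "tlift (\<lambda>b c. tlift (\<lambda>b1 b2. \<beta> b1 b2 c) (comul D b)) (comul D (f \<otimes>\<^sub>v a)) =
    tlift (\<lambda>f' f3. sw (\<lambda>a' a3. tlift (\<lambda>f1 f2. sw (\<lambda>a1 a2. \<beta> (f1 \<otimes>\<^sub>v a1) (f2 \<otimes>\<^sub>v a2) (f3 \<otimes>\<^sub>v a3))
      a') (cop f')) a) (cop f)"
    by (subst tlift_dcomul, (intro lin assms)+, intro tlift_cong tlift_dcomul assms)
  also have "\<dots> = tlift (\<lambda>f' f3. tlift (\<lambda>f1 f2. sw (\<lambda>a' a3. sw (\<lambda>a1 a2. \<beta> (f1 \<otimes>\<^sub>v a1) (f2 \<otimes>\<^sub>v a2) (f3 \<otimes>\<^sub>v a3))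
      a') a) (cop f')) (cop f)"
    by (intro tlift_cong tlift_swap)
  also have "\<dots> = tlift (\<lambda>f' f3. tlift (\<lambda>f1 f2. sw (\<lambda>a1 a'. sw (\<lambda>a2 a3. \<beta> (f1 \<otimes>\<^sub>v a1) (f2 \<otimes>\<^sub>v a2) (f3 \<otimes>\<^sub>v a3))
      a') a) (cop f')) (cop f)"
    by (intro tlift_cong coassoc l lin)
  also have "\<dots> = tlift (\<lambda>f1 f'. tlift (\<lambda>f2 f3. sw (\<lambda>a1 a'. sw (\<lambda>a2 a3. \<beta> (f1 \<otimes>\<^sub>v a1) (f2 \<otimes>\<^sub>v a2) (f3 \<otimes>\<^sub>v a3))
      a') a) (cop f')) (cop f)"
    by (rule cop_coassoc) (intro lin l)+
  also have "\<dots> = tlift (\<lambda>f1 f'. sw (\<lambda>a1 a'. tlift (\<lambda>f2 f3. sw (\<lambda>a2 a3. \<beta> (f1 \<otimes>\<^sub>v a1) (f2 \<otimes>\<^sub>v a2) (f3 \<otimes>\<^sub>v a3))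
      a') (cop f')) a) (cop f)"
    by (intro tlift_cong tlift_swap)
  also have "\<dots> = tlift (\<lambda>b c. tlift (\<lambda>c1 c2. \<beta> b c1 c2) (comul D c)) (comul D (f \<otimes>\<^sub>v a))"
    by (subst tlift_dcomul, (intro lin assms)+, intro tlift_cong tlift_dcomul[symmetric] assms)
  finally show "tlift (\<lambda>b c. tlift (\<lambda>b1 b2. \<beta> b1 b2 c) (comul D b)) (comul D (f \<otimes>\<^sub>v a)) =
    tlift (\<lambda>b c. tlift (\<lambda>c1 c2. \<beta> b c1 c2) (comul D c)) (comul D (f \<otimes>\<^sub>v a))" .
qed

lemma double_counit:
  "tlift (\<lambda>b c. counit D b *s c) (comul D t) = t"
  "tlift (\<lambda>b c. counit D c *s b) (comul D t) = t"
proof -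
  show "tlift (\<lambda>b c. counit D b *s c) (comul D t) = t"
  proof (rule tens_eqI[where t = t], (intro lin)+)
    fix f a
    have "tlift (\<lambda>b c. counit D b *s c) (comul D (f \<otimes>\<^sub>v a)) = 
       tlift (\<lambda>f1 f2. sw (\<lambda>a1 a2. counit H a1 *s (pairing f1 (unt H) *s (f2 \<otimes>\<^sub>v a2))) a) (cop f)"
      by (subst tlift_dcomul, (intro lin)+) (simp add: dcounit vector_smult_assoc mult.commute)
    also have "\<dots> = tlift (\<lambda>f1 f2. pairing f1 (unt H) *s (f2 \<otimes>\<^sub>v a)) (cop f)"
      by (intro tlift_cong counit_left lin)
    also have "\<dots> = f \<otimes>\<^sub>v a" by (rule cop_counit) (intro lin)
    finally show "tlift (\<lambda>b c. counit D b *s c) (comul D (f \<otimes>\<^sub>v a)) = f \<otimes>\<^sub>v a" .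
  qed
  show "tlift (\<lambda>b c. counit D c *s b) (comul D t) = t"
  proof (rule tens_eqI[where t = t], (intro lin)+)
    fix f a
    have "tlift (\<lambda>b c. counit D c *s b) (comul D (f \<otimes>\<^sub>v a)) = 
       tlift (\<lambda>f1 f2. sw (\<lambda>a1 a2. counit H a2 *s (pairing f2 (unt H) *s (f1 \<otimes>\<^sub>v a1))) a) (cop f)"
      by (subst tlift_dcomul, (intro lin)+) (simp add: dcounit vector_smult_assoc mult.commute)
    also have "\<dots> = tlift (\<lambda>f1 f2. pairing f2 (unt H) *s (f1 \<otimes>\<^sub>v a)) (cop f)"
      by (intro tlift_cong counit_right lin)
    also have "\<dots> = f \<otimes>\<^sub>v a" by (rule cop_counit) (intro lin)
    finally show "tlift (\<lambda>b c. counit D c *s b) (comul D (f \<otimes>\<^sub>v a)) = f \<otimes>\<^sub>v a" .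
  qed
qed

lemma can_tw: 
  assumes "\<And>f. vlinear (\<lambda>a. \<beta> a f)" "\<And>a. vlinear (\<lambda>f. \<beta> a f)"
  shows "can (\<lambda>x f. \<beta> x (tw f c a)) = can (\<lambda>x f. \<beta> (mul H (S' c) (mul H x a)) f)"
  by (rule can_transpose) (simp_all add: assms)

text \<open>
  Evaluated at \<open>x \<otimes>\<^sub>v y\<close>, the twisted components on the left give \<open>p (S' d y c (S' b) x a)\<close>. Comparing with
  \<open>cop_of_tw\<close>, the coproduct of a twisted functional, shows that only the factor \<open>c (S' b)\<close> in the middle
  has to be contracted in order that the coproduct be multiplicative.
\<close>
lemma cop_tw:
  assumes "\<And>b. vlinear (\<lambda>a. \<beta> a b)" "\<And>a. vlinear (\<lambda>b. \<beta> a b)"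
  shows "tlift (\<lambda>p1 p2. \<beta> (tw p1 b a) (tw p2 d c)) (cop p) =
    can (\<lambda>x r. can (\<lambda>y s. pairing p (mul H (S' d) (mul H y (mul H (mul H c (S' b)) (mul H x a)))) *s \<beta> r s))"
proof -
  note l = vlinear_compose[OF assms(1)] vlinear_compose[OF assms(2)]
  have "tlift (\<lambda>p1 p2. \<beta> (tw p1 b a) (tw p2 d c)) (cop p) =
     can (\<lambda>x r. can (\<lambda>y s. pairing p (mul H (mul H (S' d) (mul H y c)) x) *s \<beta> (tw r b a) s))"
    unfolding cop_tlift by (subst can_tw) (intro lin l | rule refl)+
  also have "\<dots> = can (\<lambda>y s. can (\<lambda>x r. pairing p (mul H (mul H (S' d) (mul H y c)) x) *s \<beta> (tw r b a) s))"
    by (rule can_swap)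
  also have "\<dots> = can (\<lambda>y s. can (\<lambda>x r. pairing p (mul H (mul H (S' d) (mul H y c)) (mul H (S' b) (mul H x a))) *s \<beta> r s))"
    by (subst can_tw) (intro lin l | rule refl)+
  also have "\<dots> = can (\<lambda>x r. can (\<lambda>y s. pairing p (mul H (mul H (S' d) (mul H y c)) (mul H (S' b) (mul H x a))) *s \<beta> r s))"
    by (rule can_swap)
  finally show ?thesis by (simp add: mul_assoc)
qed

lemma cop_of_tw:
  assumes "\<And>b. vlinear (\<lambda>a. \<beta> a b)" "\<And>a. vlinear (\<lambda>b. \<beta> a b)"
  shows "tlift \<beta> (cop (tw p d a)) =
    can (\<lambda>x r. can (\<lambda>y s. pairing p (mul H (S' d) (mul H y (mul H (unt H) (mul H x a)))) *s \<beta> r s))"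
  unfolding cop_tlift by (simp add: mul_assoc)

sublocale DT: algebra_on "tensor_square D"
  by unfold_locales (rule D.tensor_square_is_algebra)

lemma comul_j: "comul D (j f) = tlift (\<lambda>f1 f2. j f1 \<otimes>\<^sub>v j f2) (cop f)"
  unfolding j_def dcomul comul_unt by (intro tlift_cong tlift_tens lin)

lemma comul_\<iota>: "comul D (\<iota> a) = sw (\<lambda>a1 a2. \<iota> a1 \<otimes>\<^sub>v \<iota> a2) a"
proof -
  have c: "cop eps = eps \<otimes>\<^sub>v eps"
    by (rule pairing_tens_eqI) (simp add: pairing_cop pairing_tens)
  show ?thesis unfolding \<iota>_def dcomul c by (subst tlift_tens) (intro lin | rule refl)+
qed

lemma comul_j_mul: "comul D (mul D (j f) t) = mul (tensor_square D) (comul D (j f)) (comul D t)"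
proof (rule tens_eqI[where t = t], (intro lin)+)
  fix p :: "'k ^ 'i" and b
  have "comul D (mul D (j f) (p \<otimes>\<^sub>v b)) = tlift (\<lambda>f1 f2. tlift (\<lambda>p1 p2. sw (\<lambda>b1 b2.
     (conv f1 p1 \<otimes>\<^sub>v b1) \<otimes>\<^sub>v (conv f2 p2 \<otimes>\<^sub>v b2)) b) (cop p)) (cop f)"
    unfolding dmul_j dcomul by (rule cop_conv) (intro lin)+
  also have "\<dots> = mul (tensor_square D) (comul D (j f)) (comul D (p \<otimes>\<^sub>v b))"
    unfolding comul_j dcomul unfolding DT.mul_tlift(1) unfolding DT.mul_tlift(2) D.tensor_mul dmul_j ..
  finally show "comul D (mul D (j f) (p \<otimes>\<^sub>v b)) = mul (tensor_square D) (comul D (j f)) (comul D (p \<otimes>\<^sub>v b))" .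
qed

lemma comul_mul_\<iota>: "comul D (mul D t (\<iota> b)) = mul (tensor_square D) (comul D t) (comul D (\<iota> b))"
proof (rule tens_eqI[where t = t], (intro lin)+)
  fix p :: "'k ^ 'i" and a
  have "comul D (mul D (p \<otimes>\<^sub>v a) (\<iota> b)) = tlift (\<lambda>p1 p2. sw (\<lambda>a1 a2. sw (\<lambda>b1 b2.
     (p1 \<otimes>\<^sub>v mul H a1 b1) \<otimes>\<^sub>v (p2 \<otimes>\<^sub>v mul H a2 b2)) b) a) (cop p)"
    unfolding dmul_\<iota> dcomul by (rule tlift_cong, rule comul_mul_tlift) (intro lin)+
  also have "\<dots> = mul (tensor_square D) (comul D (p \<otimes>\<^sub>v a)) (comul D (\<iota> b))"
    unfolding dcomul comul_\<iota> unfolding DT.mul_tlift(1) unfolding DT.mul_tlift(2) D.tensor_mul dmul_\<iota> ..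
  finally show "comul D (mul D (p \<otimes>\<^sub>v a) (\<iota> b)) = mul (tensor_square D) (comul D (p \<otimes>\<^sub>v a)) (comul D (\<iota> b))" .
qed

lemma comul_\<iota>_j: "comul D (mul D (\<iota> a) (j p)) = mul (tensor_square D) (comul D (\<iota> a)) (comul D (j p))"
proof -
  \<comment> \<open>The value at \<open>m = unt H\<close> belongs to the left-hand side of the claim, the one at \<open>m = a4 (S' a3)\<close>
    to the right-hand side; all that is needed of \<open>K\<close> is that it is linear in each argument.\<close>
  define K where "K d m a b1 b2 = can (\<lambda>x r. can (\<lambda>y s.
     pairing p (mul H (S' d) (mul H y (mul H m (mul H x a)))) *s ((r \<otimes>\<^sub>v b1) \<otimes>\<^sub>v (s \<otimes>\<^sub>v b2))))" for d m a and b1 b2 :: "'k ^ 'i"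
  have lK: "vlinear f \<Longrightarrow> vlinear (\<lambda>x. K (f x) m a b1 b2)" "vlinear f \<Longrightarrow> vlinear (\<lambda>x. K d (f x) a b1 b2)"
    "vlinear f \<Longrightarrow> vlinear (\<lambda>x. K d m (f x) b1 b2)" "vlinear f \<Longrightarrow> vlinear (\<lambda>x. K d m a (f x) b2)"
    "vlinear f \<Longrightarrow> vlinear (\<lambda>x. K d m a b1 (f x))" for f :: "'k ^ 'i \<Rightarrow> 'k ^ 'i" and d m a b1 b2
    unfolding K_def by (intro lin; assumption)+
  have "comul D (mul D (\<iota> a) (j p)) = sw3 (\<lambda>a1 a2 a3. tlift (\<lambda>p1 p2. sw (\<lambda>b1 b2.
      (p1 \<otimes>\<^sub>v b1) \<otimes>\<^sub>v (p2 \<otimes>\<^sub>v b2)) a2) (cop (tw p a3 a1))) a"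
    unfolding \<iota>_j vlinear_sw3[OF lin_dcomul[OF lin_basic(1)]] dcomul ..
  also have "\<dots> = sw3 (\<lambda>a1 a2 a3. sw (\<lambda>b1 b2. tlift (\<lambda>p1 p2. 
      (p1 \<otimes>\<^sub>v b1) \<otimes>\<^sub>v (p2 \<otimes>\<^sub>v b2)) (cop (tw p a3 a1))) a2) a"
    by (intro sw3_cong tlift_swap)
  also have "\<dots> = sw3 (\<lambda>a1 a2 a3. sw (\<lambda>b1 b2. K a3 (unt H) a1 b1 b2) a2) a"
    unfolding K_def by (intro sw3_cong tlift_cong cop_of_tw lin)
  also have "\<dots> = sw (\<lambda>a1 a'. sw (\<lambda>b1 r. sw (\<lambda>b2 a3. K a3 (unt H) a1 b1 b2)
     r) a') a"
    unfolding sw3_def by (intro tlift_cong coassoc lin lK)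
  finally have 1: "comul D (mul D (\<iota> a) (j p)) = \<dots>" .
  have "mul (tensor_square D) (comul D (\<iota> a)) (comul D (j p)) = 
     sw (\<lambda>a' a''. tlift (\<lambda>p1 p2. mul D (\<iota> a') (j p1) \<otimes>\<^sub>v mul D (\<iota> a'') (j p2)) (cop p)) a"
    unfolding comul_\<iota> comul_j unfolding DT.mul_tlift(1) unfolding DT.mul_tlift(2) D.tensor_mul ..
  also have "\<dots> = sw (\<lambda>a' a''. tlift (\<lambda>p1 p2. sw3 (\<lambda>a1 a2 a3. sw3 (\<lambda>a4 a5 a6.
      (tw p1 a3 a1 \<otimes>\<^sub>v a2) \<otimes>\<^sub>v (tw p2 a6 a4 \<otimes>\<^sub>v a5)) a'') a') (cop p)) a"
    unfolding \<iota>_j unfolding vlinear_sw3[OF lin_tens(1)[OF lin_basic(1)]] unfolding vlinear_sw3[OF lin_tens(2)[OF lin_basic(1)]] ..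
  also have "\<dots> = sw (\<lambda>a' a''. sw3 (\<lambda>a1 a2 a3. sw3 (\<lambda>a4 a5 a6. tlift (\<lambda>p1 p2. 
      (tw p1 a3 a1 \<otimes>\<^sub>v a2) \<otimes>\<^sub>v (tw p2 a6 a4 \<otimes>\<^sub>v a5)) (cop p)) a'') a') a"
    unfolding sw3_tlift_swap ..
  also have "\<dots> = sw (\<lambda>a' a''. sw3 (\<lambda>a1 a2 a3. sw3 (\<lambda>a4 a5 a6. K a6 (mul H a4 (S' a3)) a1 a2 a5) a'') a') a"
    unfolding K_def by (intro sw3_cong tlift_cong cop_tw lin)
  also have "\<dots> = sw (\<lambda>a1 u. sw (\<lambda>r a''. sw (\<lambda>a2 a3. sw3 (\<lambda>a4 a5 a6. K a6 (mul H a4 (S' a3)) a1 a2 a5) a'')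
     r) u) a"
    unfolding sw3_def[of _ "a' :: 'k ^ 'i" for a'] by (intro coassoc lin lK)
  also have "\<dots> = sw (\<lambda>a1 u. sw (\<lambda>a2 v. sw (\<lambda>a3 a''. sw3 (\<lambda>a4 a5 a6. K a6 (mul H a4 (S' a3)) a1 a2 a5) a'')
     v) u) a"
    by (intro tlift_cong coassoc lin lK)
  also have "\<dots> = sw (\<lambda>a1 u. sw (\<lambda>a2 v. sw (\<lambda>b t. sw (\<lambda>a3 a4. sw (\<lambda>a5 a6. 
     K a6 (mul H a4 (S' a3)) a1 a2 a5) t) b)
     v) u) a"
    unfolding sw3_def by (intro tlift_cong coassoc[symmetric] lin lK)
  also have "\<dots> = sw (\<lambda>a1 u. sw (\<lambda>a2 v. sw (\<lambda>b t. sw (\<lambda>a5 a6. sw (\<lambda>a3 a4. 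
     K a6 (mul H a4 (S' a3)) a1 a2 a5) b) t)
     v) u) a"
    by (intro tlift_cong tlift_swap)
  also have "\<dots> = sw (\<lambda>a1 u. sw (\<lambda>a2 v. sw (\<lambda>b t. counit H b *s sw (\<lambda>a5 a6. 
     K a6 (unt H) a1 a2 a5) t)
     v) u) a"
    unfolding vlinear_tlift[OF lK(2)[OF lin_basic(1)], symmetric] S'_right
      vlinear_scale[OF lK(2)[OF lin_basic(1)]] tlift_scale ..
  also have "\<dots> = sw (\<lambda>a1 u. sw (\<lambda>a2 v. sw (\<lambda>a5 a6. 
     K a6 (unt H) a1 a2 a5) v) u) a"
    by (intro tlift_cong counit_left lin lK)
  finally show ?thesis unfolding 1 by simp
qed

lemma double_comul_mul: "comul D (mul D s t) = mul (tensor_square D) (comul D s) (comul D t)"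
proof -
  have *: "comul D (mul D (f \<otimes>\<^sub>v a) (p \<otimes>\<^sub>v b)) = mul (tensor_square D) (comul D (f \<otimes>\<^sub>v a)) (comul D (p \<otimes>\<^sub>v b))" for f a p b
    unfolding dmul_decompose comul_j_mul comul_mul_\<iota> comul_\<iota>_j
    by (simp only: j_\<iota>[symmetric] comul_j_mul DT.mul_assoc)
  show ?thesis
  proof (rule tens_eqI[where t = s], (intro lin)+)
    show "comul D (mul D (f \<otimes>\<^sub>v a) t) = mul (tensor_square D) (comul D (f \<otimes>\<^sub>v a)) (comul D t)" for f a
      by (rule tens_eqI[where t = t]) (intro lin *)+
  qed
qed

lemma double_counit_mul: "counit D (mul D s t) = counit D s * counit D t"
proof (rule scalar_eqI)
  fix v :: "'k ^ 1"
  have *: "counit D (mul D (f \<otimes>\<^sub>v a) (p \<otimes>\<^sub>v b)) *s v = counit D (f \<otimes>\<^sub>v a) *s (counit D (p \<otimes>\<^sub>v b) *s v)" for f a p b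
  proof -
    have e: "pairing (conv f r) (unt H) = pairing f (unt H) * pairing r (unt H)" for f r
      by (simp add: pairing_conv comul_unt pairing_tens)
    have l: "vlinear (\<lambda>x. counit D x *s v)" by (intro lin)
    let ?v = "(pairing f (unt H) * counit H b) *s v"
    have "counit D (mul D (f \<otimes>\<^sub>v a) (p \<otimes>\<^sub>v b)) *s v =
      sw (\<lambda>a1 a'. sw (\<lambda>a2 a3. counit H a2 *s (pairing p (mul H (S' a3) a1) *s ?v)) a') a"
      unfolding dmul unfolding vlinear_sw3[OF l] unfolding dcounit sw3_def by (intro tlift_cong) (simp add: e vector_smult_assoc algebra_simps)
    also have "\<dots> = sw (\<lambda>a1 a'. pairing p (mul H (S' a') a1) *s ?v) a"
      by (intro tlift_cong counit_left lin)
    also have "\<dots> = pairing p (sw (\<lambda>a1 a'. mul H (S' a') a1) a) *s ?v"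
      by (rule vlinear_tlift[symmetric]) (intro lin)
    also have "\<dots> = counit D (f \<otimes>\<^sub>v a) *s (counit D (p \<otimes>\<^sub>v b) *s v)"
      by (simp add: S'_left dcounit vector_smult_assoc algebra_simps)
    finally show ?thesis .
  qed
  have "counit D (mul D s t) *s v = counit D s *s (counit D t *s v)"
  proof (rule tens_eqI[where t = s], (intro lin)+)
    show "counit D (mul D (f \<otimes>\<^sub>v a) t) *s v = counit D (f \<otimes>\<^sub>v a) *s (counit D t *s v)" for f a
      by (rule tens_eqI[where t = t]) (intro lin *)+
  qed
  then show "counit D (mul D s t) *s v = (counit D s * counit D t) *s v"
    by (simp add: vector_smult_assoc)
qed

lemma double_is_bialgebra: "is_bialgebra D"
  unfolding is_bialgebra_def
proof (intro conjI allI)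
  show "tlift (\<lambda>b c. tlift (\<lambda>b1 b2. b1 \<otimes>\<^sub>v b2 \<otimes>\<^sub>v c) (comul D b)) (comul D t) =
      tlift (\<lambda>b c. b \<otimes>\<^sub>v comul D c) (comul D t)" for t
    by (subst double_coassoc, (intro lin)+)
       (simp add: vlinear_tlift[OF lin_tens(2)[OF lin_basic(1)], symmetric] tlift_tens_id)
  show "comul D (unt D) = unt (tensor_square D)"
    unfolding \<iota>_unt[symmetric] comul_\<iota> comul_unt
    by (subst tlift_tens) (intro lin | simp add: D.tensor_unt \<iota>_unt)+
  show "counit D (unt D) = 1" unfolding double_unt dcounit by simp
  show "vlinear (comul D)" by (intro lin_dcomul lin_basic)
  show "counit D (a + b) = counit D a + counit D b" "counit D (c *s a) = c * counit D a" for a b c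
    using slinear_dcounit by (simp_all add: slinear_def)
qed (rule double_is_algebra double_counit double_comul_mul double_counit_mul)+

sublocale D: bialgebra D
  by unfold_locales (rule double_is_bialgebra)

end

section \<open>The antipode of the double\<close>

lemma (in algebra_on) mul_can:
  "mul B (can \<beta>) b = can (\<lambda>a f. mul B (\<beta> a f) b)" "mul B a (can \<beta>) = can (\<lambda>b f. mul B a (\<beta> b f))"
  by (rule vlinear_can[OF lin_mul(1)[OF lin_basic(1)]] vlinear_can[OF lin_mul(2)[OF lin_basic(1)]])+

context bialgebra
begin

lemma sw4_regroup:
  assumes "\<And>b c d. vlinear (\<lambda>a. \<gamma> a b c d)" "\<And>a c d. vlinear (\<lambda>b. \<gamma> a b c d)"
    "\<And>a b d. vlinear (\<lambda>c. \<gamma> a b c d)" "\<And>a b c. vlinear (\<lambda>d. \<gamma> a b c d)"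
  shows "sw (\<lambda>b c. sw3 (\<lambda>b1 b2 b3. \<gamma> b1 b2 b3 c) b) a =
    sw (\<lambda>b1 u. sw (\<lambda>b2 v. sw (\<lambda>b3 c. \<gamma> b1 b2 b3 c) v) u) a"
proof -
  note l = vlinear_compose[OF assms(1)] vlinear_compose[OF assms(2)] vlinear_compose[OF assms(3)] vlinear_compose[OF assms(4)]
  have "sw (\<lambda>b c. sw3 (\<lambda>b1 b2 b3. \<gamma> b1 b2 b3 c) b) a =
    sw (\<lambda>b1 u. sw (\<lambda>r c. sw (\<lambda>b2 b3. \<gamma> b1 b2 b3 c) r) u) a"
    unfolding sw3_def by (intro coassoc lin l)
  also have "\<dots> = sw (\<lambda>b1 u. sw (\<lambda>b2 v. sw (\<lambda>b3 c. \<gamma> b1 b2 b3 c) v) u) a"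
    by (intro tlift_cong coassoc lin l)
  finally show ?thesis .
qed

lemma can_cop:
  assumes "\<And>f p. vlinear (\<lambda>a. \<gamma> a f p)"
  shows "can (\<lambda>a f. tlift (\<lambda>f1 f2. \<gamma> a f1 f2) (cop_dual_comul A f)) =
    can (\<lambda>a p. can (\<lambda>b r. \<gamma> (mul A b a) p r))"
proof -
  have "can (\<lambda>a f. tlift (\<lambda>f1 f2. \<gamma> a f1 f2) (cop_dual_comul A f)) =
     can (\<lambda>e f. can (\<lambda>a p. can (\<lambda>b r. pairing f (mul A b a) *s \<gamma> e p r)))"
    unfolding cop_tlift ..
  also have "\<dots> = can (\<lambda>a p. can (\<lambda>e f. can (\<lambda>b r. pairing f (mul A b a) *s \<gamma> e p r)))"
    by (rule can_swap)
  also have "\<dots> = can (\<lambda>a p. can (\<lambda>b r. can (\<lambda>e f. pairing f (mul A b a) *s \<gamma> e p r)))"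
    by (rule can_cong, rule can_swap)
  also have "\<dots> = can (\<lambda>a p. can (\<lambda>b r. \<gamma> (mul A b a) p r))"
    by (intro can_cong can_eval assms)
  finally show ?thesis .
qed

end

context hopf
begin

lemma sw_SS:
  fixes \<beta> :: "'k ^ 'i \<Rightarrow> 'k ^ 'i \<Rightarrow> 'k ^ 'l::finite"
  assumes "\<And>b. vlinear (\<lambda>a. \<beta> a b)" "\<And>a. vlinear (\<lambda>b. \<beta> a b)"
  shows "sw \<beta> (S (S a)) = sw (\<lambda>b c. \<beta> (S (S b)) (S (S c))) a"
proof -
  note l = vlinear_compose[OF assms(1)] vlinear_compose[OF assms(2)]
  have 1: "sw \<gamma> (S a) = sw (\<lambda>b c. \<gamma> (S c) (S b)) a"
    if "\<And>b. vlinear (\<lambda>a. \<gamma> a b)" "\<And>a. vlinear (\<lambda>b. \<gamma> a b)" for \<gamma> :: "'k ^ 'i \<Rightarrow> 'k ^ 'i \<Rightarrow> 'k ^ 'l" and a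
    unfolding comul_S vlinear_tlift[OF lin_tlift[OF lin_basic(1)]]
    by (intro tlift_cong tlift_tens that)
  show ?thesis by (subst 1, (rule assms)+, rule 1; intro lin l)
qed

end

context double
begin

definition S'_dual where "S'_dual f = functional (\<lambda>y. pairing f (S' y))"
definition S_dual where "S_dual f = functional (\<lambda>y. pairing f (S y))"

lemma pairing_S'_dual [simp]: "pairing (S'_dual f) y = pairing f (S' y)"
  unfolding S'_dual_def by (rule pairing_functional, rule slinear_compose[OF slinear_pairing(1)]) (intro lin)

lemma pairing_S_dual [simp]: "pairing (S_dual f) y = pairing f (S y)"
  unfolding S_dual_def by (rule pairing_functional, rule slinear_compose[OF slinear_pairing(1)]) (intro lin)

lemma S'_dual_S_dual [simp]: "S'_dual (S_dual f) = f" "S_dual (S'_dual f) = f"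
  by (rule pairing_eqI, simp)+

lemma S'_dual_eps [simp]: "S'_dual eps = eps"
  by (rule pairing_eqI) simp

lemma lin_S_dual [lin]:
  "vlinear f \<Longrightarrow> vlinear (\<lambda>x. S'_dual (f x))" "vlinear f \<Longrightarrow> vlinear (\<lambda>x. S_dual (f x))"
  unfolding S'_dual_def S_dual_def
  by (intro lin_functional slinear_compose[OF slinear_pairing(2)] lin; assumption)+

lemma can_S_dual:
  assumes "\<And>f. vlinear (\<lambda>a. \<beta> a f)" "\<And>a. vlinear (\<lambda>f. \<beta> a f)"
  shows "can (\<lambda>x f. \<beta> x (S'_dual f)) = can (\<lambda>x f. \<beta> (S' x) f)"
    and "can (\<lambda>x f. \<beta> x (S_dual f)) = can (\<lambda>x f. \<beta> (S x) f)"
  by (rule can_transpose; simp add: assms)+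

text \<open>
  The antipode reverses the order of $f \bowtie a$ = \<open>j f\<close> \<open>\<iota> a\<close>. On the dual it is the transpose of \<open>S'\<close>
  and not that of \<open>S\<close>, because the dual carries the opposite coproduct.
\<close>
definition SD where "SD t = tlift (\<lambda>f a. mul D (\<iota> (S a)) (j (S'_dual f))) t"

lemma SD_tens: "SD (f \<otimes>\<^sub>v a) = mul D (\<iota> (S a)) (j (S'_dual f))"
  unfolding SD_def by (rule tlift_tens) (intro lin)+

lemma SD_j: "SD (j f) = j (S'_dual f)"
  unfolding j_def[of f] SD_tens by (simp add: S_unt \<iota>_unt)

lemma SD_\<iota>: "SD (\<iota> a) = \<iota> (S a)"
  unfolding \<iota>_def[of a] SD_tens by (simp add: j_eps)

lemma lin_SD [lin]: "vlinear f \<Longrightarrow> vlinear (\<lambda>x. SD (f x))"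
  unfolding SD_def by (intro lin)

lemma conv_S'_dual_left: "tlift (\<lambda>f1 f2. conv (S'_dual f1) f2) (cop f) = pairing f (unt H) *s eps"
  and conv_S'_dual_right: "tlift (\<lambda>f1 f2. conv f1 (S'_dual f2)) (cop f) = pairing f (unt H) *s eps"
proof -
  have l: "vlinear (\<lambda>x. pairing f x *s r)" for r :: "'k ^ 'i" by (intro lin)
  have e: "can (\<lambda>x r. counit H x *s (pairing f (unt H) *s r)) = pairing f (unt H) *s eps"
    using can_eval'[OF lin_basic(3)[OF lin_basic(1)], of eps] by simp
  have "tlift (\<lambda>f1 f2. conv (S'_dual f1) f2) (cop f) = can (\<lambda>x r. can (\<lambda>y s. pairing f (mul H y (S' x)) *s conv r s))"
    unfolding cop_tlift by (rule can_S_dual) (intro lin)+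
  also have "\<dots> = can (\<lambda>x r. sw (\<lambda>x1 x2. pairing f (mul H x2 (S' x1)) *s r) x)"
    by (rule can_conv[symmetric]) (intro lin)
  also have "\<dots> = can (\<lambda>x r. counit H x *s (pairing f (unt H) *s r))"
    unfolding vlinear_tlift[OF l, symmetric] S'_right by (simp add: vector_smult_assoc)
  finally show "tlift (\<lambda>f1 f2. conv (S'_dual f1) f2) (cop f) = pairing f (unt H) *s eps" unfolding e .
  have "tlift (\<lambda>f1 f2. conv f1 (S'_dual f2)) (cop f) = can (\<lambda>x r. can (\<lambda>y s. pairing f (mul H (S' y) x) *s conv r s))"
    unfolding cop_tlift by (rule can_cong, rule can_S_dual) (intro lin)+
  also have "\<dots> = can (\<lambda>x r. sw (\<lambda>x1 x2. pairing f (mul H (S' x2) x1) *s r) x)"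
    by (rule can_conv[symmetric]) (intro lin)
  also have "\<dots> = can (\<lambda>x r. counit H x *s (pairing f (unt H) *s r))"
    unfolding vlinear_tlift[OF l, symmetric] S'_left by (simp add: vector_smult_assoc)
  finally show "tlift (\<lambda>f1 f2. conv f1 (S'_dual f2)) (cop f) = pairing f (unt H) *s eps" unfolding e .
qed

lemma double_is_antipode: "is_antipode D SD"
  unfolding is_antipode_def
proof (intro conjI allI)
  show "vlinear SD" by (intro lin_SD lin_basic)
  have lj: "vlinear j" by (intro lin)
  show "tlift (\<lambda>b c. mul D (SD b) c) (comul D t) = counit D t *s unt D" for t
  proof (rule tens_eqI[where t = t], (intro lin)+)
    fix f a
    have "tlift (\<lambda>b c. mul D (SD b) c) (comul D (f \<otimes>\<^sub>v a)) = tlift (\<lambda>f1 f2. sw (\<lambda>a1 a2.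
        mul D (\<iota> (S a1)) (mul D (j (conv (S'_dual f1) f2)) (\<iota> a2))) a) (cop f)"
      by (subst tlift_dcomul, (intro lin)+)
         (simp only: SD_tens, simp add: j_\<iota>[symmetric] D.mul_assoc j_mul_j[symmetric])
    also have "\<dots> = sw (\<lambda>a1 a2. tlift (\<lambda>f1 f2. 
        mul D (\<iota> (S a1)) (mul D (j (conv (S'_dual f1) f2)) (\<iota> a2))) (cop f)) a"
      by (rule tlift_swap)
    also have "\<dots> = sw (\<lambda>a1 a2. pairing f (unt H) *s \<iota> (mul H (S a1) a2)) a"
      unfolding D.mul_tlift[symmetric] vlinear_tlift[OF lj, symmetric] conv_S'_dual_left
      by (simp add: vlinear_scale[OF lj] j_eps \<iota>_mul_\<iota>)
    also have "\<dots> = pairing f (unt H) *s \<iota> (sw (\<lambda>a1 a2. mul H (S a1) a2) a)"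
      by (rule vlinear_tlift[symmetric]) (intro lin)
    also have "\<dots> = counit D (f \<otimes>\<^sub>v a) *s unt D"
      by (simp add: S_left dcounit vlinear_scale[OF lin_\<iota>[OF lin_basic(1)]] \<iota>_unt vector_smult_assoc)
    finally show "tlift (\<lambda>b c. mul D (SD b) c) (comul D (f \<otimes>\<^sub>v a)) = counit D (f \<otimes>\<^sub>v a) *s unt D" .
  qed
  show "tlift (\<lambda>b c. mul D b (SD c)) (comul D t) = counit D t *s unt D" for t
  proof (rule tens_eqI[where t = t], (intro lin)+)
    fix f a
    have "tlift (\<lambda>b c. mul D b (SD c)) (comul D (f \<otimes>\<^sub>v a)) = tlift (\<lambda>f1 f2. sw (\<lambda>a1 a2.
        mul D (j f1) (mul D (\<iota> (mul H a1 (S a2))) (j (S'_dual f2)))) a) (cop f)"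
      by (subst tlift_dcomul, (intro lin)+)
         (simp only: SD_tens, simp add: j_\<iota>[symmetric] D.mul_assoc \<iota>_mul_\<iota>[symmetric])
    also have "\<dots> = tlift (\<lambda>f1 f2. mul D (j f1) (mul D (\<iota> (sw (\<lambda>a1 a2. mul H a1 (S a2)) a)) (j (S'_dual f2)))) (cop f)"
      by (intro tlift_cong vlinear_tlift[symmetric] lin)
    also have "\<dots> = tlift (\<lambda>f1 f2. counit H a *s j (conv f1 (S'_dual f2))) (cop f)"
      by (simp add: S_right vlinear_scale[OF lin_\<iota>[OF lin_basic(1)]] \<iota>_unt j_mul_j)
    also have "\<dots> = counit H a *s j (tlift (\<lambda>f1 f2. conv f1 (S'_dual f2)) (cop f))"
      by (rule vlinear_tlift[symmetric]) (intro lin)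
    also have "\<dots> = counit D (f \<otimes>\<^sub>v a) *s unt D"
      by (simp add: conv_S'_dual_right dcounit vlinear_scale[OF lj] j_eps vector_smult_assoc mult.commute)
    finally show "tlift (\<lambda>b c. mul D b (SD c)) (comul D (f \<otimes>\<^sub>v a)) = counit D (f \<otimes>\<^sub>v a) *s unt D" .
  qed
qed

sublocale D: hopf D SD
  by unfold_locales (rule double_is_antipode)

section \<open>The Drinfeld element and the universal R-matrix\<close>

abbreviation DD where "DD \<equiv> tensor_square D"

text \<open>
  Under the identification of $f \bowtie a$ with the linear map \<open>\<lambda>y. pairing f y *s a\<close>, the Drinfeld
  element \<open>u\<close> is \<open>S'\<close> and its inverse \<open>w\<close> is the square of \<open>S\<close>. Working with \<open>w\<close>
  keeps inverses of the \<open>R\<close>-matrix out of the coproduct formula.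
\<close>
definition w where "w = can (\<lambda>a f. f \<otimes>\<^sub>v S (S a))"
definition u where "u = can (\<lambda>a f. f \<otimes>\<^sub>v S' a)"

lemma double_R_eq: "double_R H = can (\<lambda>a f. \<iota> a \<otimes>\<^sub>v j f)"
  by (simp add: double_R_def can_def j_def \<iota>_def)

lemma drinfeld_element_eq: "drinfeld_element D (double_R H) = u"
proof -
  have "drinfeld_element D (double_R H) = can (\<lambda>a f. mul D (SD (j f)) (\<iota> a))"
    unfolding drinfeld_element_def double_R_eq D.antipode_eq vlinear_can[OF lin_tlift[OF lin_basic(1)]]
    by (intro can_cong tlift_tens lin)
  also have "\<dots> = can (\<lambda>a f. S'_dual f \<otimes>\<^sub>v a)" by (simp add: SD_j j_\<iota>)
  also have "\<dots> = u" unfolding u_def by (rule can_S_dual) (intro lin)+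
  finally show ?thesis .
qed

text \<open>
  This and \<open>w_j\<close> say that conjugation by \<open>w\<close> is the inverse square of the antipode of the double.
  Here \<open>\<iota> a\<close> enters the canonical sum through its dual leg; the transposed twist meets the square
  of \<open>S\<close> and two adjacent legs of \<open>a\<close> cancel.
\<close>
lemma w_\<iota>: "mul D (\<iota> a) w = mul D w (\<iota> (S (S a)))"
proof -
  have 1: "sw3 (\<lambda>a1 a2 a3. f \<otimes>\<^sub>v mul H a2 (mul H (S a3) (mul H x (S (S a1))))) a = f \<otimes>\<^sub>v mul H x (S (S a))" for f x
  proof -
    have l: "vlinear (\<lambda>y. f \<otimes>\<^sub>v y)" by (intro lin)
    show ?thesis
      unfolding sw3_def vlinear_tlift[OF l, symmetric] S_right' by (subst counit_right) (intro lin | rule refl)+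
  qed
  have "mul D (\<iota> a) w = can (\<lambda>x f. sw3 (\<lambda>a1 a2 a3. tw f a3 a1 \<otimes>\<^sub>v mul H a2 (S (S x))) a)"
    unfolding w_def D.mul_can \<iota>_def dmul by simp
  also have "\<dots> = sw3 (\<lambda>a1 a2 a3. can (\<lambda>x f. tw f a3 a1 \<otimes>\<^sub>v mul H a2 (S (S x)))) a"
    by (rule can_sw3[symmetric])
  also have "\<dots> = sw3 (\<lambda>a1 a2 a3. can (\<lambda>x f. f \<otimes>\<^sub>v mul H a2 (S (S (mul H (S' a3) (mul H x a1)))))) a"
    by (intro sw3_cong can_tw lin)
  also have "\<dots> = can (\<lambda>x f. sw3 (\<lambda>a1 a2 a3. f \<otimes>\<^sub>v mul H a2 (mul H (S a3) (mul H (S (S x)) (S (S a1))))) a)"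
    by (subst can_sw3) (simp add: S_mul mul_assoc)
  also have "\<dots> = mul D w (\<iota> (S (S a)))" unfolding 1 w_def D.mul_can dmul_\<iota> ..
  finally show ?thesis .
qed

lemma sw3_SS:
  assumes "\<And>b c. vlinear (\<lambda>a. \<gamma> a b c)" "\<And>a c. vlinear (\<lambda>b. \<gamma> a b c)" "\<And>a b. vlinear (\<lambda>c. \<gamma> a b c)"
  shows "sw3 \<gamma> (S (S a)) = sw3 (\<lambda>a1 a2 a3. \<gamma> (S (S a1)) (S (S a2)) (S (S a3))) a"
proof -
  note l = vlinear_compose[OF assms(1)] vlinear_compose[OF assms(2)] vlinear_compose[OF assms(3)]
  show ?thesis unfolding sw3_def by (subst sw_SS, (intro lin l)+, intro tlift_cong sw_SS assms)
qed

lemma w_j: "mul D w (j (S'_dual (S'_dual f))) = mul D (j f) w"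
proof -
  have tw: "tw (S'_dual (S'_dual f)) (S (S c)) (S (S a)) = can (\<lambda>x s. pairing f (mul H (S' c) (mul H x a)) *s S'_dual (S'_dual s))" for c a
  proof -
    have "can (\<lambda>x s. pairing (tw f c a) x *s S'_dual (S'_dual s)) = S'_dual (S'_dual (tw f c a))"
      by (rule can_eval') (intro lin)
    also have "\<dots> = tw (S'_dual (S'_dual f)) (S (S c)) (S (S a))" by (rule pairing_eqI) (simp add: S'_mul mul_assoc)
    finally show ?thesis by simp
  qed
  \<comment> \<open>Expanding the twisted functional in the dual basis separates \<open>f\<close> from the convolution product; then
    \<open>can_conv\<close>, read backwards, merges the two canonical sums and makes \<open>S' x\<close> and \<open>e3\<close> adjacent legs.\<close>
  let ?h = "\<lambda>x e1 e2 e3. pairing f (mul H (S' e3) (mul H (S' (S' x)) e1))"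
  have "mul D w (j (S'_dual (S'_dual f))) = can (\<lambda>e r. sw3 (\<lambda>e1 e2 e3. conv r (tw (S'_dual (S'_dual f)) e3 e1) \<otimes>\<^sub>v e2) (S (S e)))"
    unfolding w_def D.mul_can j_def dmul by simp
  also have "\<dots> = can (\<lambda>e r. sw3 (\<lambda>e1 e2 e3. conv r (tw (S'_dual (S'_dual f)) (S (S e3)) (S (S e1))) \<otimes>\<^sub>v S (S e2)) e)"
    by (rule can_cong, rule sw3_SS) (intro lin)+
  also have "\<dots> = can (\<lambda>e r. sw3 (\<lambda>e1 e2 e3. can (\<lambda>x s. pairing f (mul H (S' e3) (mul H x e1)) *s (conv r (S'_dual (S'_dual s)) \<otimes>\<^sub>v S (S e2)))) e)"
  proof -
    have l: "vlinear (\<lambda>F. conv r F \<otimes>\<^sub>v S (S e2))" for r e2 by (intro lin)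
    show ?thesis unfolding tw vlinear_can[OF l] vlinear_scale[OF l] ..
  qed
  also have "\<dots> = can (\<lambda>e r. can (\<lambda>x s. sw3 (\<lambda>e1 e2 e3. pairing f (mul H (S' e3) (mul H x e1)) *s (conv r (S'_dual (S'_dual s)) \<otimes>\<^sub>v S (S e2))) e))"
    by (rule can_cong, rule can_sw3)
  also have "\<dots> = can (\<lambda>e r. can (\<lambda>x s. sw3 (\<lambda>e1 e2 e3. ?h x e1 e2 e3 *s (conv r s \<otimes>\<^sub>v S (S e2))) e))"
    apply (rule can_cong)
    apply (subst can_S_dual(1), (intro lin)+)
    apply (subst can_S_dual(1), (intro lin)+)
    apply (rule refl)
    done
  also have "\<dots> = can (\<lambda>e r. sw (\<lambda>e' x. sw3 (\<lambda>e1 e2 e3. ?h x e1 e2 e3 *s (r \<otimes>\<^sub>v S (S e2))) e') e)"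
    by (rule can_conv[symmetric]) (intro lin)
  also have "\<dots> = can (\<lambda>e r. sw (\<lambda>e1 u. sw (\<lambda>e2 v. sw (\<lambda>e3 x. 
        pairing f (mul H (S' (mul H (S' x) e3)) e1) *s (r \<otimes>\<^sub>v S (S e2))) v) u) e)"
    by (subst sw4_regroup, (intro lin)+) (simp add: S'_mul mul_assoc)
  also have "\<dots> = can (\<lambda>e r. sw (\<lambda>e1 u. sw (\<lambda>e2 v.
        pairing f (mul H (S' (sw (\<lambda>e3 x. mul H (S' x) e3) v)) e1) *s (r \<otimes>\<^sub>v S (S e2))) u) e)"
    by (intro can_cong tlift_cong vlinear_tlift[symmetric] lin)
  also have "\<dots> = can (\<lambda>e r. sw (\<lambda>e1 u. sw (\<lambda>e2 v. counit H v *s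
        (pairing f e1 *s (r \<otimes>\<^sub>v S (S e2)))) u) e)"
    by (simp add: S'_left vlinear_scale[OF lin_S'[OF lin_basic(1)]] vector_smult_assoc)
  also have "\<dots> = can (\<lambda>e r. sw (\<lambda>e1 e2. pairing f e1 *s (r \<otimes>\<^sub>v S (S e2))) e)"
    by (intro can_cong tlift_cong counit_right lin)
  also have "\<dots> = can (\<lambda>e1 r. can (\<lambda>e2 s. pairing f e1 *s (conv r s \<otimes>\<^sub>v S (S e2))))"
    by (rule can_conv) (intro lin)
  also have "\<dots> = can (\<lambda>e2 s. can (\<lambda>e1 r. pairing f e1 *s (conv r s \<otimes>\<^sub>v S (S e2))))"
    by (rule can_swap)
  also have "\<dots> = can (\<lambda>e2 s. conv f s \<otimes>\<^sub>v S (S e2))"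
    by (intro can_cong can_eval' lin)
  also have "\<dots> = mul D (j f) w" unfolding w_def D.mul_can dmul_j ..
  finally show ?thesis .
qed

lemma w_j': "mul D w (j f) = mul D (j (S_dual (S_dual f))) w"
  using w_j[of "S_dual (S_dual f)"] by simp

lemma w_\<iota>': "mul D w (\<iota> a) = mul D (\<iota> (S' (S' a))) w"
  using w_\<iota>[of "S' (S' a)"] by simp

lemma can_scale_eps: "can (\<lambda>x f. counit H x *s (f \<otimes>\<^sub>v a)) = eps \<otimes>\<^sub>v a"
proof -
  have l: "vlinear (\<lambda>f. f \<otimes>\<^sub>v a)" by (intro lin)
  show ?thesis using can_eval'[OF l, of eps] by simp
qed

lemma w_u: "mul D w u = unt D"
proof -
  have "mul D w u = can (\<lambda>a f. mul D (mul D (j (S_dual (S_dual f))) w) (\<iota> (S' a)))"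
    unfolding u_def D.mul_can j_\<iota>[symmetric] by (simp add: D.mul_assoc[symmetric] w_j')
  also have "\<dots> = can (\<lambda>a f. mul D (mul D (j f) w) (\<iota> (S' (S (S a)))))"
    by (subst can_S_dual(2), (intro lin)+, subst can_S_dual(2), (intro lin)+, rule refl)
  also have "\<dots> = can (\<lambda>a f. can (\<lambda>e r. conv f r \<otimes>\<^sub>v mul H (S (S e)) (S a)))"
    unfolding w_def D.mul_can dmul_j dmul_\<iota> by simp
  also have "\<dots> = can (\<lambda>x f. sw (\<lambda>x1 x2. f \<otimes>\<^sub>v S (mul H x1 (S x2))) x)"
    unfolding S_mul by (rule can_conv[symmetric]) (intro lin)
  also have "\<dots> = can (\<lambda>x f. f \<otimes>\<^sub>v S (sw (\<lambda>x1 x2. mul H x1 (S x2)) x))"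
    by (intro can_cong vlinear_tlift[symmetric] lin)
  also have "\<dots> = can (\<lambda>x f. counit H x *s (f \<otimes>\<^sub>v unt H))"
    by (simp add: S_right vlinear_scale[OF lin_S[OF lin_basic(1)]] S_unt vlinear_scale[OF lin_tens(2)[OF lin_basic(1)]])
  also have "\<dots> = unt D" by (simp add: can_scale_eps double_unt)
  finally show ?thesis .
qed

lemma w_u_commute: "mul D w u = mul D u w"
proof -
  have "mul D w u = can (\<lambda>a f. mul D (mul D (j (S_dual (S_dual f))) w) (\<iota> (S' a)))"
    unfolding u_def D.mul_can j_\<iota>[symmetric] by (simp add: D.mul_assoc[symmetric] w_j')
  also have "\<dots> = can (\<lambda>a f. mul D (j (S_dual (S_dual f))) (mul D (\<iota> (S' (S' (S' a)))) w))"
    by (simp add: D.mul_assoc w_\<iota>')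
  also have "\<dots> = can (\<lambda>a f. mul D (j f) (mul D (\<iota> (S' (S' (S' (S (S a)))))) w))"
    by (subst can_S_dual(2), (intro lin)+, subst can_S_dual(2), (intro lin)+, rule refl)
  also have "\<dots> = mul D u w"
    unfolding u_def D.mul_can j_\<iota>[symmetric] by (simp add: D.mul_assoc)
  finally show ?thesis .
qed

lemma is_inverse_w_u: "is_inverse D w u"
  using w_u w_u_commute by (simp add: is_inverse_def)

definition R where "R = can (\<lambda>a f. \<iota> a \<otimes>\<^sub>v j f)"
definition R_inv where "R_inv = can (\<lambda>a f. \<iota> (S a) \<otimes>\<^sub>v j f)"
definition R21 where "R21 = tflip R"

lemma R21_eq: "R21 = can (\<lambda>a f. j f \<otimes>\<^sub>v \<iota> a)"
  unfolding R_def R21_def vlinear_can[OF lin_tflip[OF lin_basic(1)]] tflip_tens ..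

lemma R_inverse: "is_inverse DD R R_inv"
proof -
  have 1: "can (\<lambda>x f. counit H x *s (\<iota> a \<otimes>\<^sub>v j f)) = \<iota> a \<otimes>\<^sub>v j eps" for a
  proof -
    have l: "vlinear (\<lambda>f. \<iota> a \<otimes>\<^sub>v j f)" by (intro lin)
    show ?thesis using can_eval'[OF l, of eps] by simp
  qed
  have l: "vlinear (\<lambda>y. \<iota> y \<otimes>\<^sub>v j f)" for f by (intro lin)
  have "mul DD R R_inv = can (\<lambda>a f. can (\<lambda>b p. \<iota> (mul H a (S b)) \<otimes>\<^sub>v j (conv f p)))"
    unfolding R_def R_inv_def unfolding DT.mul_can(1) unfolding DT.mul_can(2) D.tensor_mul \<iota>_mul_\<iota> j_mul_j ..
  also have "\<dots> = can (\<lambda>x f. sw (\<lambda>x1 x2. \<iota> (mul H x1 (S x2)) \<otimes>\<^sub>v j f) x)"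
    by (rule can_conv[symmetric]) (intro lin)
  also have "\<dots> = unt DD" unfolding vlinear_tlift[OF l, symmetric] S_right vlinear_scale[OF l] 1
    by (simp add: \<iota>_unt j_eps D.tensor_unt)
  finally have a: "mul DD R R_inv = unt DD" .
  have "mul DD R_inv R = can (\<lambda>a f. can (\<lambda>b p. \<iota> (mul H (S a) b) \<otimes>\<^sub>v j (conv f p)))"
    unfolding R_def R_inv_def unfolding DT.mul_can(1) unfolding DT.mul_can(2) D.tensor_mul \<iota>_mul_\<iota> j_mul_j ..
  also have "\<dots> = can (\<lambda>x f. sw (\<lambda>x1 x2. \<iota> (mul H (S x1) x2) \<otimes>\<^sub>v j f) x)"
    by (rule can_conv[symmetric]) (intro lin)
  also have "\<dots> = unt DD" unfolding vlinear_tlift[OF l, symmetric] S_left vlinear_scale[OF l] 1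
    by (simp add: \<iota>_unt j_eps D.tensor_unt)
  finally show ?thesis using a by (simp add: is_inverse_def)
qed

lemma R21_inverse: "is_inverse DD R21 (tflip R_inv)"
  unfolding R21_def by (rule D.is_inverse_tflip[OF R_inverse])

text \<open>
  This is $\Delta^{op}(a)\,\mathcal{R} = \mathcal{R}\,\Delta(a)$ for \<open>a\<close> in the algebra, with \<open>\<phi>\<close> applied to the first leg;
  \<open>\<phi>\<close> allows the square of \<open>S\<close> to be inserted there. The legs \<open>S' b3\<close> and \<open>c\<close> cancel.
\<close>
lemma R_exchange:
  assumes \<phi>: "vlinear \<phi>"
  shows "sw (\<lambda>b c. can (\<lambda>e f. \<phi> (mul H c e) \<otimes>\<^sub>v mul D (\<iota> b) (j f))) a =
    can (\<lambda>e f. sw (\<lambda>b c. \<phi> (mul H e b) \<otimes>\<^sub>v mul D (j f) (\<iota> c)) a)"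
proof -
  note l = vlinear_compose[OF \<phi>]
  have lc: "vlinear (\<lambda>y. \<phi> y \<otimes>\<^sub>v f \<otimes>\<^sub>v b2)" for f b2 by (intro lin l)
  have "sw (\<lambda>b c. can (\<lambda>e f. \<phi> (mul H c e) \<otimes>\<^sub>v mul D (\<iota> b) (j f))) a =
    sw (\<lambda>b c. can (\<lambda>e f. sw3 (\<lambda>b1 b2 b3. \<phi> (mul H c e) \<otimes>\<^sub>v tw f b3 b1 \<otimes>\<^sub>v b2) b)) a"
    unfolding \<iota>_j vlinear_sw3[OF lin_tens(2)[OF lin_basic(1)]] ..
  also have "\<dots> = sw (\<lambda>b c. sw3 (\<lambda>b1 b2 b3. can (\<lambda>e f. \<phi> (mul H c e) \<otimes>\<^sub>v tw f b3 b1 \<otimes>\<^sub>v b2)) b) a"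
    unfolding can_sw3 ..
  also have "\<dots> = sw (\<lambda>b c. sw3 (\<lambda>b1 b2 b3. can (\<lambda>e f. \<phi> (mul H c (mul H (S' b3) (mul H e b1))) \<otimes>\<^sub>v f \<otimes>\<^sub>v b2)) b) a"
    by (intro tlift_cong sw3_cong can_tw lin l)
  also have "\<dots> = sw (\<lambda>b1 u. sw (\<lambda>b2 v. sw (\<lambda>b3 c. can (\<lambda>e f. \<phi> (mul H c (mul H (S' b3) (mul H e b1))) \<otimes>\<^sub>v f \<otimes>\<^sub>v b2)) v) u) a"
    by (rule sw4_regroup) (intro lin l)+
  also have "\<dots> = sw (\<lambda>b1 u. sw (\<lambda>b2 v. counit H v *s can (\<lambda>e f. \<phi> (mul H e b1) \<otimes>\<^sub>v f \<otimes>\<^sub>v b2)) u) a"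
    unfolding can_tlift vlinear_tlift[OF lc, symmetric] S'_right' vlinear_scale[OF lc]
      vlinear_can[OF lin_basic(3)[OF lin_basic(1)]] ..
  also have "\<dots> = sw (\<lambda>b1 b2. can (\<lambda>e f. \<phi> (mul H e b1) \<otimes>\<^sub>v f \<otimes>\<^sub>v b2)) a"
    by (intro tlift_cong counit_right lin)
  finally show ?thesis by (simp add: can_tlift j_\<iota>)
qed

lemma comul_\<iota>_SS: "comul D (\<iota> (S (S a))) = sw (\<lambda>b c. \<iota> (S (S b)) \<otimes>\<^sub>v \<iota> (S (S c))) a"
  unfolding comul_\<iota> by (rule sw_SS) (intro lin)+

definition Q where "Q = mul DD R21 R"

text \<open>
  The coproduct of the sum \<open>w\<close> factors as two canonical sums. The inner one absorbs into
  \<open>R2\<close>, the \<open>R\<close>-matrix twisted by the square of \<open>S\<close>, times \<open>w\<close> in the second factor; moving that \<open>w\<close> and then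
  \<open>R2\<close> past the coproduct of \<open>\<iota> (S (S a))\<close> exchanges its two legs, after which the outer sum becomes
  \<open>R21\<close> times \<open>w\<close> in the first factor.
\<close>
lemma comul_w: "comul D w = mul DD Q (w \<otimes>\<^sub>v w)"
proof -
  define R2 where "R2 = can (\<lambda>b r. \<iota> (S (S b)) \<otimes>\<^sub>v j r)"
  have w1: "can (\<lambda>b r. mul D (j r) (\<iota> (S (S b)))) = w" unfolding w_def j_\<iota> ..
  have X: "can (\<lambda>b r. mul DD (unt D \<otimes>\<^sub>v j r) (comul D (\<iota> (S (S b))))) = mul DD R2 (unt D \<otimes>\<^sub>v w)"
  proof -
    have "can (\<lambda>b r. mul DD (unt D \<otimes>\<^sub>v j r) (comul D (\<iota> (S (S b))))) =
       can (\<lambda>b r. sw (\<lambda>b1 b2. \<iota> (S (S b1)) \<otimes>\<^sub>v mul D (j r) (\<iota> (S (S b2)))) b)"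
      unfolding comul_\<iota>_SS DT.mul_tlift D.tensor_mul D.mul_unt ..
    also have "\<dots> = can (\<lambda>b r. can (\<lambda>c s. \<iota> (S (S b)) \<otimes>\<^sub>v mul D (j (conv r s)) (\<iota> (S (S c)))))"
      by (rule can_conv) (intro lin)
    also have "\<dots> = can (\<lambda>b r. \<iota> (S (S b)) \<otimes>\<^sub>v mul D (j r) (can (\<lambda>c s. mul D (j s) (\<iota> (S (S c))))))"
      unfolding D.mul_can vlinear_can[OF lin_tens(2)[OF lin_basic(1)]] j_mul_j[symmetric] D.mul_assoc ..
    also have "\<dots> = mul DD R2 (unt D \<otimes>\<^sub>v w)" unfolding w1 R2_def DT.mul_can D.tensor_mul D.mul_unt ..
    finally show ?thesis .
  qed
  define D1 where "D1 a = sw (\<lambda>b c. \<iota> (S (S b)) \<otimes>\<^sub>v \<iota> c) a" for a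
  define D2 where "D2 a = sw (\<lambda>b c. \<iota> (S (S c)) \<otimes>\<^sub>v \<iota> b) a" for a
  have 1: "mul DD (unt D \<otimes>\<^sub>v w) (comul D (\<iota> (S (S a)))) = mul DD (D1 a) (unt D \<otimes>\<^sub>v w)" for a
    unfolding comul_\<iota>_SS D1_def DT.mul_tlift D.tensor_mul D.mul_unt w_\<iota>[symmetric] ..
  have 2: "mul DD R2 (D1 a) = mul DD (D2 a) R2" for a
  proof -
    have l: "vlinear (\<lambda>x. \<iota> (S (S x)))" by (intro lin)
    have "mul DD (D2 a) R2 = sw (\<lambda>b c. can (\<lambda>e f. \<iota> (S (S (mul H c e))) \<otimes>\<^sub>v mul D (\<iota> b) (j f))) a"
      unfolding D2_def R2_def unfolding DT.mul_tlift(1) unfolding DT.mul_can(2) D.tensor_mul \<iota>_mul_\<iota> S_mul ..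
    also have "\<dots> = can (\<lambda>e f. sw (\<lambda>b c. \<iota> (S (S (mul H e b))) \<otimes>\<^sub>v mul D (j f) (\<iota> c)) a)"
      by (rule R_exchange[OF l])
    also have "\<dots> = mul DD R2 (D1 a)"
      unfolding D1_def R2_def unfolding DT.mul_can(1) unfolding DT.mul_tlift(2) D.tensor_mul \<iota>_mul_\<iota> S_mul ..
    finally show ?thesis by simp
  qed
  have 3: "can (\<lambda>a p. mul DD (j p \<otimes>\<^sub>v unt D) (D2 a)) = mul DD R21 (w \<otimes>\<^sub>v unt D)"
  proof -
    have "can (\<lambda>a p. mul DD (j p \<otimes>\<^sub>v unt D) (D2 a)) =
      can (\<lambda>a p. sw (\<lambda>b c. mul D (j p) (\<iota> (S (S c))) \<otimes>\<^sub>v \<iota> b) a)"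
      unfolding D2_def DT.mul_tlift D.tensor_mul D.mul_unt ..
    also have "\<dots> = can (\<lambda>b p. can (\<lambda>c r. mul D (j (conv p r)) (\<iota> (S (S c))) \<otimes>\<^sub>v \<iota> b))"
      by (rule can_conv) (intro lin)
    also have "\<dots> = can (\<lambda>b p. mul D (j p) (can (\<lambda>c r. mul D (j r) (\<iota> (S (S c))))) \<otimes>\<^sub>v \<iota> b)"
      unfolding D.mul_can vlinear_can[OF lin_tens(1)[OF lin_basic(1)]] j_mul_j[symmetric] D.mul_assoc ..
    also have "\<dots> = mul DD R21 (w \<otimes>\<^sub>v unt D)" unfolding w1 R21_eq DT.mul_can D.tensor_mul D.mul_unt ..
    finally show ?thesis .
  qed
  have 4: "mul DD (w \<otimes>\<^sub>v unt D) R2 = mul DD R (w \<otimes>\<^sub>v unt D)"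
    unfolding R2_def R_def DT.mul_can D.tensor_mul D.mul_unt w_\<iota>[symmetric] ..
  have "comul D w = can (\<lambda>a f. tlift (\<lambda>f1 f2. mul DD (j f1 \<otimes>\<^sub>v j f2) (comul D (\<iota> (S (S a))))) (cop f))"
    unfolding w_def vlinear_can[OF lin_dcomul[OF lin_basic(1)]] j_\<iota>[symmetric] comul_j_mul comul_j DT.mul_tlift ..
  also have "\<dots> = can (\<lambda>a p. can (\<lambda>b r. mul DD (j p \<otimes>\<^sub>v j r) (comul D (\<iota> (S (S (mul H b a)))))))"
    by (rule can_cop) (intro lin)
  also have "\<dots> = can (\<lambda>a p. can (\<lambda>b r. mul DD (j p \<otimes>\<^sub>v unt D) (mul DD (mul DD (unt D \<otimes>\<^sub>v j r) (comul D (\<iota> (S (S b))))) (comul D (\<iota> (S (S a)))))))"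
    by (simp add: S_mul \<iota>_mul_\<iota>[symmetric] double_comul_mul DT.mul_assoc[symmetric] D.tensor_mul)
  also have "\<dots> = can (\<lambda>a p. mul DD (j p \<otimes>\<^sub>v unt D) (mul DD (can (\<lambda>b r. mul DD (unt D \<otimes>\<^sub>v j r) (comul D (\<iota> (S (S b)))))) (comul D (\<iota> (S (S a))))))"
    unfolding DT.mul_can ..
  also have "\<dots> = can (\<lambda>a p. mul DD (mul DD (j p \<otimes>\<^sub>v unt D) (D2 a)) (mul DD R2 (unt D \<otimes>\<^sub>v w)))"
    unfolding X DT.mul_assoc 1 unfolding DT.mul_assoc[symmetric, of R2] 2 unfolding DT.mul_assoc ..
  also have "\<dots> = mul DD (mul DD R21 (w \<otimes>\<^sub>v unt D)) (mul DD R2 (unt D \<otimes>\<^sub>v w))"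
    unfolding DT.mul_can(1)[symmetric] 3 ..
  also have "\<dots> = mul DD (mul DD R21 R) (mul DD (w \<otimes>\<^sub>v unt D) (unt D \<otimes>\<^sub>v w))"
    unfolding DT.mul_assoc unfolding DT.mul_assoc[symmetric, of _ R2] 4 unfolding DT.mul_assoc ..
  also have "\<dots> = mul DD Q (w \<otimes>\<^sub>v w)" by (simp add: D.tensor_mul Q_def)
  finally show ?thesis .
qed

lemma w_w_commute_R: "mul DD (w \<otimes>\<^sub>v w) R = mul DD R (w \<otimes>\<^sub>v w)"
proof -
  have "mul DD (w \<otimes>\<^sub>v w) R = can (\<lambda>a f. mul DD (\<iota> (S' (S' a)) \<otimes>\<^sub>v j (S_dual (S_dual f))) (w \<otimes>\<^sub>v w))"
    unfolding R_def DT.mul_can D.tensor_mul w_\<iota>' w_j' ..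
  also have "\<dots> = can (\<lambda>a f. mul DD (\<iota> (S' (S' (S (S a)))) \<otimes>\<^sub>v j f) (w \<otimes>\<^sub>v w))"
    by (subst can_S_dual(2), (intro lin DT.lin_mul)+, subst can_S_dual(2), (intro lin DT.lin_mul)+, rule refl)
  finally show ?thesis unfolding R_def DT.mul_can by simp
qed

lemma w_w_commute_R21: "mul DD (w \<otimes>\<^sub>v w) R21 = mul DD R21 (w \<otimes>\<^sub>v w)"
  using arg_cong[OF w_w_commute_R, of tflip] by (simp add: D.tflip_mul tflip_tens R21_def)

lemma w_w_commute_Q: "mul DD (w \<otimes>\<^sub>v w) Q = mul DD Q (w \<otimes>\<^sub>v w)"
  unfolding Q_def by (metis DT.mul_assoc w_w_commute_R w_w_commute_R21)

lemma Q_inverse: "is_inverse DD Q (mul DD R_inv (tflip R_inv))"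
  unfolding Q_def by (rule DT.is_inverse_mul[OF R21_inverse R_inverse])

definition Q_inv where "Q_inv = mul DD R_inv (tflip R_inv)"

lemma Q_cancel: "mul DD Q_inv (mul DD Q t) = t" "mul DD Q (mul DD Q_inv t) = t"
  using Q_inverse unfolding is_inverse_def Q_inv_def by (metis DT.mul_assoc DT.mul_unt(1))+

text \<open>
  The antipode, applied to both legs with a flip, is an antihomomorphism of the tensor square
  that interchanges \<open>R\<close> and \<open>R21\<close>; applied to \<open>comul_w\<close> it yields the mirror image.
\<close>
lemma comul_SD_w: "comul D (SD w) = mul DD (SD w \<otimes>\<^sub>v SD w) Q"
proof -
  define F where "F = tlift (\<lambda>b c. SD c \<otimes>\<^sub>v SD b)"
  have F: "vlinear F" unfolding F_def by (intro lin)
  have F_tens: "F (x \<otimes>\<^sub>v y) = SD y \<otimes>\<^sub>v SD x" for x y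
    unfolding F_def by (rule tlift_tens) (intro lin)+
  have F_lin: "vlinear g \<Longrightarrow> vlinear (\<lambda>x. F (g x))" for g :: "'k ^ (('i \<times> 'i) \<times> ('i \<times> 'i)) \<Rightarrow> 'k ^ (('i \<times> 'i) \<times> ('i \<times> 'i))"
    by (rule vlinear_compose[OF F])
  have F_mul: "F (mul DD s t) = mul DD (F t) (F s)" for s t
  proof (rule tens_eqI[where t = s], (intro lin F_lin DT.lin_mul)+)
    show "F (mul DD (x \<otimes>\<^sub>v y) t) = mul DD (F t) (F (x \<otimes>\<^sub>v y))" for x y
      by (rule tens_eqI[where t = t]) (intro lin F_lin DT.lin_mul | simp add: D.tensor_mul F_tens D.S_mul)+
  qed
  have "F R = can (\<lambda>a f. j (S'_dual f) \<otimes>\<^sub>v \<iota> (S a))"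
    unfolding R_def vlinear_can[OF F] F_tens SD_j SD_\<iota> ..
  also have "\<dots> = can (\<lambda>a f. j f \<otimes>\<^sub>v \<iota> (S (S' a)))"
    by (rule can_S_dual) (intro lin)+
  finally have F_R: "F R = R21" by (simp add: R21_eq)
  have "F R21 = can (\<lambda>a f. \<iota> (S a) \<otimes>\<^sub>v j (S'_dual f))"
    unfolding R21_eq vlinear_can[OF F] F_tens SD_j SD_\<iota> ..
  also have "\<dots> = can (\<lambda>a f. \<iota> (S (S' a)) \<otimes>\<^sub>v j f)"
    by (rule can_S_dual) (intro lin)+
  finally have F_R21: "F R21 = R" by (simp add: R_def)
  have "comul D (SD w) = F (comul D w)" unfolding D.comul_S F_def ..
  also have "\<dots> = mul DD (SD w \<otimes>\<^sub>v SD w) Q"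
    unfolding comul_w F_mul Q_def F_R F_R21 F_tens ..
  finally show ?thesis .
qed

definition z where "z = SD u"
text \<open>
  The element $u^{-1} S_D(u)$. It is grouplike because the factors \<open>Q\<close> in the coproducts of \<open>w\<close> and of
  \<open>SD w\<close> cancel.
\<close>
definition h where "h = mul D w z"

lemma z_w': "mul D z (SD w) = unt D" "mul D (SD w) z = unt D"
  using is_inverse_w_u D.S_unt unfolding z_def is_inverse_def
  by (simp_all add: D.S_mul[symmetric])

lemma h_w': "mul D h (SD w) = w"
  unfolding h_def D.mul_assoc z_w' by simp

lemma u_h: "mul D u h = z"
  unfolding h_def D.mul_assoc[symmetric] using is_inverse_w_u by (simp add: is_inverse_def)

lemma is_inverse_h: "is_inverse D h (mul D (SD w) u)"
  unfolding h_def using D.is_inverse_mul[OF is_inverse_w_u, of z "SD w"] z_w' by (simp add: is_inverse_def)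

lemma grouplike_h: "D.grouplike h"
proof (rule D.grouplike_if_invertible)
  show "is_inverse D h (mul D (SD w) u)" by (rule is_inverse_h)
  have "mul DD (comul D h) (comul D (SD w)) = comul D w"
    by (simp add: double_comul_mul[symmetric] h_w')
  also have "\<dots> = mul DD (w \<otimes>\<^sub>v w) Q" by (simp add: comul_w w_w_commute_Q)
  also have "\<dots> = mul DD (h \<otimes>\<^sub>v h) (comul D (SD w))"
    unfolding comul_SD_w DT.mul_assoc[symmetric] D.tensor_mul h_w' ..
  finally have "mul DD (mul DD (comul D h) (comul D (SD w))) (comul D z) =
     mul DD (mul DD (h \<otimes>\<^sub>v h) (comul D (SD w))) (comul D z)" by simp
  then show "comul D h = h \<otimes>\<^sub>v h"
    by (simp add: DT.mul_assoc double_comul_mul[symmetric] D.mul_assoc z_w' D.comul_unt D.tensor_unt[symmetric])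
qed

section \<open>Quasi-ribbon elements as square roots of a grouplike element\<close>

definition character :: "'k ^ 'i \<Rightarrow> bool" where
  "character \<psi> \<longleftrightarrow> (\<forall>a b. pairing \<psi> (mul H a b) = pairing \<psi> a * pairing \<psi> b) \<and> pairing \<psi> (unt H) = 1"

lemma character_cop: "character \<psi> \<longleftrightarrow> cop \<psi> = \<psi> \<otimes>\<^sub>v \<psi> \<and> pairing \<psi> (unt H) = 1"
proof -
  have "cop \<psi> = \<psi> \<otimes>\<^sub>v \<psi> \<longleftrightarrow> (\<forall>y z. pairing (cop \<psi>) (y \<otimes>\<^sub>v z) = pairing (\<psi> \<otimes>\<^sub>v \<psi>) (y \<otimes>\<^sub>v z))"
    using pairing_tens_eqI by metis
  then show ?thesis unfolding character_def pairing_cop pairing_tens by (auto simp: mult.commute)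
qed

lemma character_mul: "character \<psi> \<Longrightarrow> pairing \<psi> (mul H a b) = pairing \<psi> a * pairing \<psi> b"
  and character_unt: "character \<psi> \<Longrightarrow> pairing \<psi> (unt H) = 1"
  by (simp_all add: character_def)

lemma grouplike_tens: "character \<psi> \<Longrightarrow> grouplike c \<Longrightarrow> D.grouplike (\<psi> \<otimes>\<^sub>v c)"
  unfolding D.grouplike_def grouplike_def character_cop dcomul dcounit
  by (auto simp: tlift_tens lin)

definition proj_dual :: "'k ^ ('i \<times> 'i) \<Rightarrow> 'k ^ 'i" where
  "proj_dual = tlift (\<lambda>f a. counit H a *s f)"

definition proj_alg :: "'k ^ ('i \<times> 'i) \<Rightarrow> 'k ^ 'i" where
  "proj_alg = tlift (\<lambda>f a. pairing f (unt H) *s a)"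

lemma lin_proj [lin]: "vlinear g \<Longrightarrow> vlinear (\<lambda>x. proj_dual (g x))" "vlinear g \<Longrightarrow> vlinear (\<lambda>x. proj_alg (g x))"
  unfolding proj_dual_def proj_alg_def by (intro lin; assumption)+

lemma proj_dual_tens: "proj_dual (f \<otimes>\<^sub>v a) = counit H a *s f"
  and proj_alg_tens: "proj_alg (f \<otimes>\<^sub>v a) = pairing f (unt H) *s a"
  unfolding proj_dual_def proj_alg_def by (rule tlift_tens; intro lin)+

text \<open>
  As a coalgebra the double is a tensor product, so the projections to the two factors are
  coalgebra maps and a grouplike element is the tensor product of its projections.
\<close>
lemma grouplike_double:
  assumes "D.grouplike l"
  obtains \<psi> c where "l = \<psi> \<otimes>\<^sub>v c" "character \<psi>" "grouplike c"
proof -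
  have l: "comul D l = l \<otimes>\<^sub>v l" "counit D l = 1" using assms by (auto simp: D.grouplike_def)
  have s: "(c *s f) \<otimes>\<^sub>v (d *s p) = c *s (d *s (f \<otimes>\<^sub>v p))" for c d and f p :: "'k ^ 'i"
    by (simp add: vec_eq_iff tens_def)
  have "tlift (\<lambda>x y. proj_dual x \<otimes>\<^sub>v proj_alg y) (comul D t) = t" for t
  proof (rule tens_eqI[where t = t], (intro lin)+)
    fix f a
    have "tlift (\<lambda>x y. proj_dual x \<otimes>\<^sub>v proj_alg y) (comul D (f \<otimes>\<^sub>v a)) =
      tlift (\<lambda>f1 f2. sw (\<lambda>a1 a2. counit H a1 *s (pairing f2 (unt H) *s (f1 \<otimes>\<^sub>v a2))) a) (cop f)"
      by (subst tlift_dcomul, (intro lin)+) (simp add: proj_dual_tens proj_alg_tens s)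
    also have "\<dots> = tlift (\<lambda>f1 f2. pairing f2 (unt H) *s (f1 \<otimes>\<^sub>v a)) (cop f)"
      by (intro tlift_cong counit_left lin)
    also have "\<dots> = f \<otimes>\<^sub>v a" by (rule cop_counit) (intro lin)
    finally show "tlift (\<lambda>x y. proj_dual x \<otimes>\<^sub>v proj_alg y) (comul D (f \<otimes>\<^sub>v a)) = f \<otimes>\<^sub>v a" .
  qed
  from this[of l] have 1: "proj_dual l \<otimes>\<^sub>v proj_alg l = l"
    unfolding l by (subst (asm) tlift_tens, (intro lin)+)
  have "cop (proj_dual t) = tlift (\<lambda>x y. proj_dual x \<otimes>\<^sub>v proj_dual y) (comul D t)" for t
  proof (rule tens_eqI[where t = t], (intro lin)+)
    fix f a
    have "tlift (\<lambda>x y. proj_dual x \<otimes>\<^sub>v proj_dual y) (comul D (f \<otimes>\<^sub>v a)) =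
      tlift (\<lambda>f1 f2. sw (\<lambda>a1 a2. counit H a1 *s (counit H a2 *s (f1 \<otimes>\<^sub>v f2))) a) (cop f)"
      by (subst tlift_dcomul, (intro lin)+) (simp add: proj_dual_tens s)
    also have "\<dots> = tlift (\<lambda>f1 f2. counit H a *s (f1 \<otimes>\<^sub>v f2)) (cop f)"
      by (intro tlift_cong counit_left lin)
    also have "\<dots> = cop (proj_dual (f \<otimes>\<^sub>v a))"
      by (simp add: tlift_scale tlift_tens_id proj_dual_tens vlinear_scale[OF lin_cop[OF lin_basic(1)]])
    finally show "cop (proj_dual (f \<otimes>\<^sub>v a)) = tlift (\<lambda>x y. proj_dual x \<otimes>\<^sub>v proj_dual y) (comul D (f \<otimes>\<^sub>v a))" by simp
  qed
  from this[of l] have c1: "cop (proj_dual l) = proj_dual l \<otimes>\<^sub>v proj_dual l"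
    unfolding l by (subst (asm) tlift_tens, (intro lin)+)
  have "comul H (proj_alg t) = tlift (\<lambda>x y. proj_alg x \<otimes>\<^sub>v proj_alg y) (comul D t)" for t
  proof (rule tens_eqI[where t = t], (intro lin)+)
    fix f a
    have "tlift (\<lambda>x y. proj_alg x \<otimes>\<^sub>v proj_alg y) (comul D (f \<otimes>\<^sub>v a)) =
      tlift (\<lambda>f1 f2. pairing f1 (unt H) *s (pairing f2 (unt H) *s sw (\<lambda>a1 a2. a1 \<otimes>\<^sub>v a2) a)) (cop f)"
      by (subst tlift_dcomul, (intro lin)+) (simp add: proj_alg_tens s tlift_scale)
    also have "\<dots> = pairing f (unt H) *s comul H a"
      unfolding tlift_tens_id by (rule cop_counit) (intro lin)
    finally show "comul H (proj_alg (f \<otimes>\<^sub>v a)) = tlift (\<lambda>x y. proj_alg x \<otimes>\<^sub>v proj_alg y) (comul D (f \<otimes>\<^sub>v a))"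
      by (simp add: proj_alg_tens vlinear_scale[OF lin_comul[OF lin_basic(1)]])
  qed
  from this[of l] have c2: "comul H (proj_alg l) = proj_alg l \<otimes>\<^sub>v proj_alg l"
    unfolding l by (subst (asm) tlift_tens, (intro lin)+)
  have e1: "pairing (proj_dual t) (unt H) *s v = counit D t *s v" for t and v :: "'k ^ 1"
    by (rule tens_eqI[where t = t]) (intro lin | simp add: proj_dual_tens dcounit mult.commute)+
  have e2: "counit H (proj_alg t) *s v = counit D t *s v" for t and v :: "'k ^ 1"
    by (rule tens_eqI[where t = t]) (intro lin | simp add: proj_alg_tens dcounit mult.commute)+
  have "pairing (proj_dual l) (unt H) = 1" "counit H (proj_alg l) = 1"
    using scalar_eqI[OF e1, of l] scalar_eqI[OF e2, of l] l by simp_all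
  with c1 c2 1 show thesis by (intro that[of "proj_dual l" "proj_alg l"]) (simp_all add: character_cop grouplike_def)
qed

lemma tw_character:
  assumes "character \<psi>"
  shows "tw \<psi> c a = (pairing \<psi> (S' c) * pairing \<psi> a) *s \<psi>"
  by (rule pairing_eqI) (simp add: character_mul[OF assms])

lemma \<iota>_character:
  assumes "character \<psi>"
  shows "mul D (\<iota> a) (j \<psi>) = mul D (j \<psi>) (\<iota> (sw3 (\<lambda>a1 a2 a3. (pairing \<psi> (S' a3) * pairing \<psi> a1) *s a2) a))"
proof -
  have l: "vlinear (\<lambda>x. \<psi> \<otimes>\<^sub>v x)" by (intro lin)
  show ?thesis
    unfolding \<iota>_j j_\<iota> vlinear_sw3[OF l] tw_character[OF assms]
    by (simp add: vlinear_scale[OF l] vlinear_scale[OF lin_tens(1)[OF lin_basic(1)]])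
qed

lemma S'_grouplike: "grouplike c \<Longrightarrow> S' c = S c"
  using grouplike_S[of c] grouplike_S[OF grouplike_S_grouplike, of c]
  by (metis S'_S S_S' is_inverse_def is_inverse_unique)

lemma sw3_grouplike:
  assumes "\<And>b c. vlinear (\<lambda>a. \<gamma> a b c)" "\<And>a c. vlinear (\<lambda>b. \<gamma> a b c)" "\<And>a b. vlinear (\<lambda>c. \<gamma> a b c)"
    and "grouplike c"
  shows "sw3 \<gamma> c = \<gamma> c c c"
proof -
  have c: "comul H c = c \<otimes>\<^sub>v c" using assms(4) by (simp add: grouplike_def)
  show ?thesis
  unfolding sw3_def c
  by (subst tlift_tens, (intro lin assms)+, subst c, subst tlift_tens) (intro lin assms | rule refl)+
qed

lemma \<iota>_grouplike: "grouplike c \<Longrightarrow> mul D (\<iota> c) (j f) = tw f c c \<otimes>\<^sub>v c"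
  unfolding \<iota>_j by (rule sw3_grouplike) (intro lin | assumption)+

lemma pairing_S_grouplike: "character \<psi> \<Longrightarrow> grouplike c \<Longrightarrow> pairing \<psi> (S c) * pairing \<psi> c = 1"
  using grouplike_S[of c] by (metis character_mul character_unt is_inverse_def)

lemma tw_character_grouplike: "character \<psi> \<Longrightarrow> grouplike c \<Longrightarrow> tw \<psi> c c = \<psi>"
  by (simp add: tw_character S'_grouplike pairing_S_grouplike)

lemma mul_grouplikes:
  assumes "character \<psi>" "grouplike c"
  shows "mul D (f \<otimes>\<^sub>v c) (\<psi> \<otimes>\<^sub>v d) = conv f \<psi> \<otimes>\<^sub>v mul H c d"
  unfolding dmul_decompose \<iota>_grouplike[OF assms(2)] tw_character_grouplike[OF assms] dmul_\<iota> dmul_j ..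

lemma SS_grouplike: "grouplike c \<Longrightarrow> S (S c) = c"
  using S'_grouplike[of c] S_S'[of c] by simp

lemma D_SS_grouplike:
  assumes "D.grouplike l"
  shows "SD (SD l) = l"
  using D.grouplike_S[OF assms] D.grouplike_S[OF D.grouplike_S_grouplike[OF assms]]
  by (metis D.is_inverse_unique is_inverse_def)

lemma w_SS: "mul D s w = mul D w (SD (SD s))"
proof (rule tens_eqI[where t = s], (intro lin)+)
  fix f a
  show "mul D (f \<otimes>\<^sub>v a) w = mul D w (SD (SD (f \<otimes>\<^sub>v a)))"
    unfolding j_\<iota>[symmetric] D.S_mul SD_j SD_\<iota>
    by (simp add: D.mul_assoc w_\<iota>) (simp add: D.mul_assoc[symmetric] w_j)
qed

lemma w_grouplike: "D.grouplike l \<Longrightarrow> mul D l w = mul D w l"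
  using w_SS[of l] by (simp add: D_SS_grouplike)

lemma u_grouplike: "D.grouplike l \<Longrightarrow> mul D l u = mul D u l"
  using w_grouplike[of l] is_inverse_w_u unfolding is_inverse_def
  by (metis D.mul_assoc D.mul_unt)

lemma counit_w: "counit D w = 1"
proof (rule scalar_eqI)
  fix v :: "'k ^ 1"
  have l: "vlinear (\<lambda>x. counit D x *s v)" by (intro lin)
  have l2: "vlinear (\<lambda>f. pairing f (unt H) *s v)" by (intro lin)
  have "counit D w *s v = can (\<lambda>a f. counit H a *s (pairing f (unt H) *s v))"
    unfolding w_def vlinear_can[OF l] dcounit
    by (rule can_cong) (simp add: counit_S vector_smult_assoc mult.commute)
  then show "counit D w *s v = 1 *s v" using can_eval'[OF l2, of eps] by simp
qed

lemma counit_u: "counit D u = 1"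
  using arg_cong[OF w_u, of "counit D"] by (simp add: counit_w)

text \<open>
  The coproduct condition on \<open>v\<close> makes \<open>w v\<close> grouplike, because \<open>Q\<close> commutes with \<open>w \<otimes>\<^sub>v w\<close>. As \<open>u\<close> commutes
  with grouplike elements, both $v^2 = u S_D(u)$ and $S_D(v) = v$ then become \<open>l l = h\<close>.
\<close>
lemma quasi_ribbon_iff:
  "quasi_ribbon D (double_R H) v \<longleftrightarrow> (\<exists>l. D.grouplike l \<and> mul D l l = h \<and> v = mul D u l)"
proof -
  have wu: "mul D w (mul D u t) = t" "mul D u (mul D w t) = t" for t
    using is_inverse_w_u unfolding is_inverse_def by (metis D.mul_assoc D.mul_unt(1))+
  have R: "double_R H = R" by (simp add: double_R_eq R_def)
  have Qi: "inverse_in DD Q = Q_inv"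
    using Q_inverse by (simp add: DT.inverse_in_eq Q_inv_def)
  have qr: "quasi_ribbon D (double_R H) v \<longleftrightarrow> invertible_in D v \<and> mul D v v = mul D u z \<and> SD v = v \<and>
     counit D v = 1 \<and> comul D v = mul DD Q_inv (v \<otimes>\<^sub>v v)"
    unfolding quasi_ribbon_def D.antipode_eq R drinfeld_element_eq[unfolded R] R21_def[symmetric] Q_def[symmetric] Qi z_def Let_def ..
  have cu: "mul DD (w \<otimes>\<^sub>v w) (comul D u) = Q_inv"
  proof -
    have "mul DD (comul D w) (comul D u) = unt DD"
      by (simp add: double_comul_mul[symmetric] w_u D.comul_unt D.tensor_unt)
    then have "mul DD Q_inv (mul DD Q (mul DD (w \<otimes>\<^sub>v w) (comul D u))) = mul DD Q_inv (unt DD)"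
      by (simp add: comul_w DT.mul_assoc)
    then show ?thesis by (simp add: Q_cancel)
  qed
  have cu': "comul D u = mul DD (u \<otimes>\<^sub>v u) Q_inv"
    unfolding cu[symmetric] DT.mul_assoc[symmetric] D.tensor_mul
    using is_inverse_w_u by (simp add: is_inverse_def D.tensor_unt[symmetric])
  have uQ: "mul DD (u \<otimes>\<^sub>v u) Q_inv = mul DD Q_inv (u \<otimes>\<^sub>v u)"
  proof -
    have uw: "mul DD (u \<otimes>\<^sub>v u) (w \<otimes>\<^sub>v w) = unt DD" "mul DD (w \<otimes>\<^sub>v w) (u \<otimes>\<^sub>v u) = unt DD"
      using is_inverse_w_u by (simp_all add: is_inverse_def D.tensor_mul D.tensor_unt)
    have "mul DD Q (u \<otimes>\<^sub>v u) = mul DD (u \<otimes>\<^sub>v u) Q"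
      using w_w_commute_Q uw by (metis DT.mul_assoc DT.mul_unt)
    then show ?thesis using Q_inverse unfolding is_inverse_def Q_inv_def by (metis DT.mul_assoc DT.mul_unt)
  qed
  show ?thesis
  proof
    assume "quasi_ribbon D (double_R H) v"
    then have v: "invertible_in D v" "mul D v v = mul D u z" "counit D v = 1"
      "comul D v = mul DD Q_inv (v \<otimes>\<^sub>v v)" by (auto simp: qr)
    define l where "l = mul D w v"
    have "comul D l = mul DD (mul DD (w \<otimes>\<^sub>v w) Q) (mul DD Q_inv (v \<otimes>\<^sub>v v))"
      unfolding l_def double_comul_mul v(4) comul_w w_w_commute_Q ..
    also have "\<dots> = l \<otimes>\<^sub>v l" by (simp add: DT.mul_assoc Q_cancel D.tensor_mul l_def)
    finally have l: "D.grouplike l" by (simp add: D.grouplike_def l_def counit_w v(3))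
    have vl: "v = mul D u l" by (simp add: l_def wu)
    have "mul D u (mul D u (mul D l l)) = mul D v v"
      unfolding vl D.mul_assoc using u_grouplike[OF l] by (metis D.mul_assoc)
    also have "\<dots> = mul D u (mul D u h)" by (simp add: v(2) u_h)
    finally have "mul D w (mul D w (mul D u (mul D u (mul D l l)))) = mul D w (mul D w (mul D u (mul D u h)))"
      by simp
    then have "mul D l l = h" by (simp add: wu)
    with l vl show "\<exists>l. D.grouplike l \<and> mul D l l = h \<and> v = mul D u l" by blast
  next
    assume "\<exists>l. D.grouplike l \<and> mul D l l = h \<and> v = mul D u l"
    then obtain l where l: "D.grouplike l" "mul D l l = h" and vl: "v = mul D u l" by blast
    have i: "is_inverse D l (SD l)" by (rule D.grouplike_S[OF l(1)])
    have 1: "invertible_in D v"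
      unfolding invertible_in_def vl
      using D.is_inverse_mul[of u w l "SD l"] i is_inverse_w_u by (auto simp: is_inverse_def)
    have "mul D v v = mul D u (mul D u h)"
      unfolding vl l(2)[symmetric] D.mul_assoc using u_grouplike[OF l(1)] by (metis D.mul_assoc)
    then have 2: "mul D v v = mul D u z" by (simp add: u_h)
    have "SD v = mul D (SD l) (mul D u (mul D l l))" by (simp add: vl D.S_mul z_def[symmetric] u_h l(2))
    also have "\<dots> = mul D (mul D (mul D (SD l) l) u) l"
      using u_grouplike[OF l(1)] by (metis D.mul_assoc)
    also have "\<dots> = v" using i by (simp add: is_inverse_def vl)
    finally have 3: "SD v = v" .
    have 4: "counit D v = 1" using l(1) by (simp add: vl counit_u D.grouplike_def)
    have "comul D v = mul DD (mul DD Q_inv (u \<otimes>\<^sub>v u)) (l \<otimes>\<^sub>v l)"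
      using l(1) unfolding vl double_comul_mul cu' uQ by (simp add: D.grouplike_def)
    then have 5: "comul D v = mul DD Q_inv (v \<otimes>\<^sub>v v)" by (simp add: DT.mul_assoc D.tensor_mul vl)
    show "quasi_ribbon D (double_R H) v" using 1 2 3 4 5 by (simp add: qr)
  qed
qed

text \<open>
  The hypotheses say that \<open>l\<close> acts by conjugation as \<open>w\<close>, the inverse of \<open>u\<close>, does, so that the product
  \<open>u l\<close> acts trivially.
\<close>
lemma is_central_u:
  assumes i: "\<And>a. mul D l (\<iota> a) = mul D (\<iota> (S' (S' a))) l"
    and jj: "\<And>f. mul D l (j f) = mul D (j (S_dual (S_dual f))) l"
  shows "is_central D (mul D u l)"
proof -
  have wu: "mul D w (mul D u t) = t" "mul D u (mul D w t) = t" for t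
    using is_inverse_w_u unfolding is_inverse_def by (metis D.mul_assoc D.mul_unt(1))+
  have u_i: "mul D u (\<iota> (S' (S' a))) = mul D (\<iota> a) u" for a
  proof -
    have "mul D u (mul D w (mul D (\<iota> a) u)) = mul D u (\<iota> (S' (S' a)))"
      unfolding D.mul_assoc[symmetric, of w] w_\<iota>' unfolding D.mul_assoc w_u by simp
    then show ?thesis by (simp add: wu)
  qed
  have u_j: "mul D u (j (S_dual (S_dual f))) = mul D (j f) u" for f
  proof -
    have "mul D u (mul D w (mul D (j f) u)) = mul D u (j (S_dual (S_dual f)))"
      unfolding D.mul_assoc[symmetric, of w] w_j' unfolding D.mul_assoc w_u by simp
    then show ?thesis by (simp add: wu)
  qed
  have 1: "mul D (mul D u l) (\<iota> a) = mul D (\<iota> a) (mul D u l)" for a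
    unfolding D.mul_assoc i unfolding D.mul_assoc[symmetric] u_i ..
  have 2: "mul D (mul D u l) (j f) = mul D (j f) (mul D u l)" for f
    unfolding D.mul_assoc jj unfolding D.mul_assoc[symmetric] u_j ..
  have "mul D (mul D u l) t = mul D t (mul D u l)" for t
  proof (rule tens_eqI[where t = t], (intro lin)+)
    show "mul D (mul D u l) (f \<otimes>\<^sub>v a) = mul D (f \<otimes>\<^sub>v a) (mul D u l)" for f a
      unfolding j_\<iota>[symmetric] using 1 2 by (metis D.mul_assoc)
  qed
  then show ?thesis by (simp add: is_central_def)
qed

lemma h_\<iota>: "mul D h (\<iota> a) = mul D (\<iota> (S' (S' (S' (S' a))))) h"
proof -
  have "mul D (\<iota> b) (SD w) = SD (mul D w (\<iota> (S' b)))" for b by (simp add: D.S_mul SD_\<iota>)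
  also have "\<dots> b = mul D (SD w) (\<iota> (S' (S' b)))" for b by (simp add: w_\<iota>' D.S_mul SD_\<iota>)
  finally have 1: "mul D (\<iota> b) (SD w) = mul D (SD w) (\<iota> (S' (S' b)))" for b .
  have 2: "mul D z (\<iota> b) = mul D (\<iota> (S' (S' b))) z" for b
  proof -
    have "mul D z (mul D (mul D (\<iota> b) (SD w)) z) = mul D z (mul D (mul D (SD w) (\<iota> (S' (S' b)))) z)"
      by (simp add: 1)
    then show ?thesis using z_w' by (metis D.mul_assoc D.mul_unt)
  qed
  show ?thesis unfolding h_def D.mul_assoc 2 unfolding D.mul_assoc[symmetric] w_\<iota>' ..
qed

definition tr :: "('k ^ 'i \<Rightarrow> 'k ^ 'i) \<Rightarrow> 'k" where
  "tr F = (\<Sum>i\<in>UNIV. F (axis i 1) $ i)"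

lemma SD_w_eq: "SD w = can (\<lambda>e f. mul D (\<iota> (S (S e))) (j f))"
proof -
  have "SD w = can (\<lambda>e f. mul D (\<iota> (S (S (S e)))) (j (S'_dual f)))"
    unfolding w_def vlinear_can[OF lin_SD[OF lin_basic(1)]] SD_tens ..
  also have "\<dots> = can (\<lambda>e f. mul D (\<iota> (S (S (S (S' e))))) (j f))"
    by (rule can_S_dual) (intro lin)+
  finally show ?thesis by simp
qed

text \<open>
  Both formulas compare the two expressions of \<open>SD w\<close>: as the canonical sum of \<open>SD_w_eq\<close>, and as
  the inverse of \<open>h\<close> times \<open>w\<close>. The projections of the double send \<open>w\<close> to the counit and to the
  unit, so they leave the inverses of \<open>\<psi>\<close> and of \<open>c\<close>.
\<close>
lemma
  assumes h: "h = \<psi> \<otimes>\<^sub>v c" and \<psi>: "character \<psi>" and c: "grouplike c"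
  shows h_character: "pairing \<psi> (S' y) = tr (\<lambda>e. sw (\<lambda>e1 e2. mul H (S e2) (mul H y (S (S e1)))) e)"
    and h_grouplike: "S c = can (\<lambda>e f. sw3 (\<lambda>e1 e2 e3. pairing f (mul H (S e3) (S (S e1))) *s S (S e2)) e)"
proof -
  have P: "vlinear proj_dual" "vlinear proj_alg" by (intro lin)+
  have c': "grouplike (S c)" and Sc: "is_inverse H c (S c)"
    using c by (rule grouplike_S_grouplike, rule grouplike_S)
  have \<psi>': "character (S'_dual \<psi>)"
    using \<psi> by (simp add: character_def S'_mul mult.commute)
  have "SD h = S'_dual \<psi> \<otimes>\<^sub>v S c"
    unfolding h SD_tens \<iota>_grouplike[OF c'] tw_character_grouplike[OF \<psi>' c'] ..
  moreover have "mul D (SD h) w = SD w"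
    using D.grouplike_S[OF grouplike_h] h_w' unfolding is_inverse_def by (metis D.mul_assoc D.mul_unt(1))
  ultimately have "SD w = mul D (S'_dual \<psi> \<otimes>\<^sub>v S c) w" by simp
  also have "\<dots> = can (\<lambda>e f. conv (S'_dual \<psi>) (tw f (S c) (S c)) \<otimes>\<^sub>v mul H (S c) (S (S e)))"
    unfolding w_def D.mul_can dmul_decompose \<iota>_grouplike[OF c'] dmul_\<iota> dmul_j ..
  finally have 1: "SD w = \<dots>" .
  have eps_c: "counit H c = 1" using c by (simp add: grouplike_def)
  have "proj_dual (SD w) = can (\<lambda>e f. counit H e *s conv (S'_dual \<psi>) (tw f (S c) (S c)))"
    unfolding 1 vlinear_can[OF P(1)] proj_dual_tens by (simp add: eps_c counit_S mult.commute)
  also have "\<dots> = conv (S'_dual \<psi>) (tw eps (S c) (S c))"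
  proof -
    have l: "vlinear (\<lambda>f. conv (S'_dual \<psi>) (tw f (S c) (S c)))" by (intro lin)
    show ?thesis using can_eval'[OF l, of eps] by simp
  qed
  finally have proj_dual_w: "proj_dual (SD w) = S'_dual \<psi>" by (simp add: eps_c counit_S)
  have "proj_dual (SD w) = can (\<lambda>e f. sw (\<lambda>a1 a'. sw (\<lambda>a2 a3. counit H a2 *s tw f a3 a1) a') (S (S e)))"
    unfolding SD_w_eq vlinear_can[OF P(1)] \<iota>_j vlinear_sw3[OF P(1)] proj_dual_tens unfolding sw3_def ..
  also have "\<dots> = can (\<lambda>e f. sw (\<lambda>a1 a2. tw f a2 a1) (S (S e)))"
    by (intro can_cong tlift_cong counit_left lin)
  also have "\<dots> = can (\<lambda>e f. sw (\<lambda>e1 e2. tw f (S (S e2)) (S (S e1))) e)"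
    by (rule can_cong, rule sw_SS) (intro lin)+
  finally have 2: "S'_dual \<psi> = \<dots>" unfolding proj_dual_w .
  show "pairing \<psi> (S' y) = tr (\<lambda>e. sw (\<lambda>e1 e2. mul H (S e2) (mul H y (S (S e1)))) e)"
  proof (rule scalar_eqI)
    fix v :: "'k ^ 1"
    have l: "vlinear (\<lambda>F. pairing F y *s v)" by (intro lin)
    have "pairing \<psi> (S' y) *s v = pairing (S'_dual \<psi>) y *s v" by simp
    also have "\<dots> = can (\<lambda>e f. sw (\<lambda>e1 e2. pairing f (mul H (S e2) (mul H y (S (S e1)))) *s v) e)"
      unfolding 2 vlinear_can[OF l] vlinear_tlift[OF l] by simp
    also have "\<dots> = can (\<lambda>e f. pairing f (sw (\<lambda>e1 e2. mul H (S e2) (mul H y (S (S e1)))) e) *s v)"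
      by (intro can_cong vlinear_tlift[symmetric] lin)
    also have "\<dots> = tr (\<lambda>e. sw (\<lambda>e1 e2. mul H (S e2) (mul H y (S (S e1)))) e) *s v"
      by (simp add: can_def tr_def vec.scale_sum_left)
    finally show "pairing \<psi> (S' y) *s v = \<dots>" .
  qed
  have "proj_alg (SD w) = can (\<lambda>e f. pairing f (unt H) *s mul H (S c) (S (S e)))"
  proof -
    have "pairing (conv f p) (unt H) = pairing f (unt H) * pairing p (unt H)" for f p
      by (simp add: pairing_conv comul_unt pairing_tens)
    then show ?thesis
      unfolding 1 vlinear_can[OF P(2)] proj_alg_tens using \<psi> Sc
      by (simp add: character_unt S'_grouplike[OF c'] is_inverse_def)
  qed
  also have "\<dots> = S c"
  proof -
    have l: "vlinear (\<lambda>e. mul H (S c) (S (S e)))" by (intro lin)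
    show ?thesis using can_eval[OF l, of "unt H"] by (simp add: S_unt)
  qed
  finally have "S c = proj_alg (SD w)" by simp
  also have "\<dots> = can (\<lambda>e f. sw3 (\<lambda>a1 a2 a3. pairing f (mul H (S' a3) a1) *s a2) (S (S e)))"
    unfolding SD_w_eq vlinear_can[OF P(2)] \<iota>_j vlinear_sw3[OF P(2)] proj_alg_tens by simp
  also have "\<dots> = can (\<lambda>e f. sw3 (\<lambda>e1 e2 e3. pairing f (mul H (S e3) (S (S e1))) *s S (S e2)) e)"
    by (subst sw3_SS, (intro lin)+) simp
  finally show "S c = \<dots>" .
qed

end

section \<open>Free algebras and a model of the Radford relations\<close>

lemma poly_mapping_single_induct [case_names zero single]:
  fixes p :: "'a \<Rightarrow>\<^sub>0 'b::comm_monoid_add"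
  assumes "P 0" "\<And>w c p. P p \<Longrightarrow> P (Poly_Mapping.single w c + p)"
  shows "P p"
proof (induction p rule: update_induct)
  case const
  show ?case by (rule assms(1))
next
  case (update p w c)
  have "Poly_Mapping.update w c p = Poly_Mapping.single w c + p"
    using update(1)
    by (intro poly_mapping_eqI) (auto simp: lookup_add lookup_single lookup_update in_keys_iff when_def)
  then show ?case using assms(2)[OF update(3)] by simp
qed

text \<open>
  \<open>wsum f\<close> extends a map \<open>f\<close> on words linearly to the free algebra. It is used with values in
  the algebra and with values in the field.
\<close>
locale weighted_sum = vector_space scale for scale :: "'a::field \<Rightarrow> 'b::ab_group_add \<Rightarrow> 'b"
begin

definition wsum :: "('w \<Rightarrow> 'b) \<Rightarrow> ('w \<Rightarrow>\<^sub>0 'a) \<Rightarrow> 'b" where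
  "wsum f p = (\<Sum>w\<in>Poly_Mapping.keys p. scale (Poly_Mapping.lookup p w) (f w))"

lemma wsum_zero [simp]: "wsum f 0 = 0"
  by (simp add: wsum_def)

lemma wsum_single [simp]: "wsum f (Poly_Mapping.single w c) = scale c (f w)"
  by (cases "c = 0") (simp_all add: wsum_def)

lemma wsum_add: "wsum f (p + r) = wsum f p + wsum f r"
  unfolding wsum_def by (rule setsum_keys_plus_distrib) (simp_all add: scale_left_distrib)

lemma wsum_uminus: "wsum f (- p) = - wsum f p"
proof -
  have "wsum f (- p) + wsum f p = 0" unfolding wsum_add[symmetric] by simp
  then show ?thesis by (simp add: add_eq_0_iff2)
qed

lemma wsum_diff: "wsum f (p - r) = wsum f p - wsum f r"
  using wsum_add[of f p "- r"] by (simp add: wsum_uminus)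

lemma wsum_scale_fun: "wsum (\<lambda>w. scale c (f w)) p = scale c (wsum f p)"
  by (simp add: wsum_def scale_sum_right mult.commute)

lemma wsum_mult: "wsum f (p * r) = wsum (\<lambda>v. wsum (\<lambda>w. f (v + w)) r) p"
proof (induction p rule: poly_mapping_single_induct)
  case (single v c p)
  have "wsum f (Poly_Mapping.single v c * r) = scale c (wsum (\<lambda>w. f (v + w)) r)"
    by (induction r rule: poly_mapping_single_induct)
       (simp_all add: distrib_left wsum_add mult_single scale_right_distrib)
  then show ?case by (simp add: distrib_right wsum_add single)
qed simp

end

interpretation vecw: weighted_sum "(*s) :: 'k::field \<Rightarrow> 'k ^ 'l::finite \<Rightarrow> 'k ^ 'l"
  by unfold_locales (simp_all add: vec_eq_iff algebra_simps)

lemma letters_plus [simp]: "letters (v + w) = letters v @ letters w"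
  and letters_zero [simp]: "letters 0 = []"
  by (simp_all add: plus_word_def zero_word_def)

context algebra_on
begin

definition pw :: "'k ^ 'i \<Rightarrow> nat \<Rightarrow> 'k ^ 'i" where
  "pw a k = (mul B a ^^ k) (unt B)"

lemma pw_0 [simp]: "pw a 0 = unt B"
  and pw_Suc: "pw a (Suc k) = mul B a (pw a k)"
  by (simp_all add: pw_def)

lemma pw_1 [simp]: "pw a (Suc 0) = a"
  by (simp add: pw_Suc)

lemma pw_add: "pw a (k + l) = mul B (pw a k) (pw a l)"
  by (induction k) (simp_all add: pw_Suc mul_assoc)

lemma pw_Suc': "pw a (Suc k) = mul B (pw a k) a"
  using pw_add[of a k 1] by simp

lemma pw_mult: "pw a (k * l) = pw (pw a k) l"
  by (induction l) (simp_all add: pw_Suc pw_add)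

lemma pw_unt [simp]: "pw (unt B) k = unt B"
  by (induction k) (simp_all add: pw_Suc)

lemma free_eval_wsum:
  "free_eval B \<gamma> p = vecw.wsum (\<lambda>w. foldr (\<lambda>a. mul B (\<gamma> a)) (letters w) (unt B)) p"
  by (simp add: free_eval_def vecw.wsum_def)

lemma free_eval_add: "free_eval B \<gamma> (p + r) = free_eval B \<gamma> p + free_eval B \<gamma> r"
  and free_eval_diff: "free_eval B \<gamma> (p - r) = free_eval B \<gamma> p - free_eval B \<gamma> r"
  by (simp_all add: free_eval_wsum vecw.wsum_add vecw.wsum_diff)

lemma foldr_mul: "mul B (foldr (\<lambda>a. mul B (\<gamma> a)) us (unt B)) b = foldr (\<lambda>a. mul B (\<gamma> a)) us b"
  by (induction us) (simp_all add: mul_assoc)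

lemma free_eval_mult:
  fixes p r :: "('g, 'k) free_algebra"
  shows "free_eval B \<gamma> (p * r) = mul B (free_eval B \<gamma> p) (free_eval B \<gamma> r)"
proof -
  let ?F = "\<lambda>us b. foldr (\<lambda>a. mul B (\<gamma> a)) us b"
  have 1: "mul B a (vecw.wsum f r) = vecw.wsum (\<lambda>w. mul B a (f w)) r"
    and 2: "mul B (vecw.wsum f' p) b = vecw.wsum (\<lambda>w. mul B (f' w) b) p"
    for a b and f f' :: "'g word \<Rightarrow> 'k ^ 'i"
    by (simp_all add: vecw.wsum_def vlinear_sum[OF lin_mul(1)[OF lin_basic(1)]] vlinear_sum[OF lin_mul(2)[OF lin_basic(1)]])
  show ?thesis
    unfolding free_eval_wsum vecw.wsum_mult 2 unfolding 1 by (simp add: foldr_mul)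
qed

lemma free_eval_one: "free_eval B \<gamma> 1 = unt B"
  by (simp add: free_eval_wsum single_one[symmetric] del: single_one)

lemma free_eval_gen: "free_eval B \<gamma> (gen a) = \<gamma> a"
  by (simp add: free_eval_wsum gen_def)

lemma free_eval_scal: "free_eval B \<gamma> (scal c) = c *s unt B"
  by (simp add: free_eval_wsum scal_def)

lemma free_eval_power: "free_eval B \<gamma> (p ^ k) = pw (free_eval B \<gamma> p) k"
  by (induction k) (simp_all add: free_eval_one free_eval_mult pw_Suc)

lemma generated_induct [consumes 1, case_names unt add scale gen]:
  assumes "surj (free_eval B \<gamma>)"
    and "P (unt B)" "\<And>a b. P a \<Longrightarrow> P b \<Longrightarrow> P (a + b)" "\<And>c a. P a \<Longrightarrow> P (c *s a)"
    and "\<And>a b. P b \<Longrightarrow> P (mul B (\<gamma> a) b)"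
  shows "P a"
proof -
  obtain p where p: "a = free_eval B \<gamma> p" using assms(1) by (metis surjD)
  have "P (foldr (\<lambda>a. mul B (\<gamma> a)) us (unt B))" for us
    by (induction us) (use assms in auto)
  moreover have "P 0" using assms(4)[OF assms(2), of 0] by simp
  ultimately have "P (free_eval B \<gamma> p)"
    by (induction p rule: poly_mapping_single_induct)
       (simp_all add: free_eval_wsum vecw.wsum_add assms)
  then show ?thesis by (simp add: p)
qed

end

lemma ideal_generated_by_subset: "two_sided_ideal J \<Longrightarrow> G \<subseteq> J \<Longrightarrow> ideal_generated_by G \<subseteq> J"
  by (auto simp: ideal_generated_by_def)

lemma ideal_generated_by_superset: "G \<subseteq> ideal_generated_by G"
  by (auto simp: ideal_generated_by_def)

text \<open>
  To see that the defining relations do not force the monomials \<open>g\<^sup>i x\<^sup>l\<close> with \<open>i < m n\<close>, \<open>l < n\<close> to be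
  dependent, let \<open>g\<close> and \<open>x\<close> act on functions of two indices by shifting the first or the second index,
  with a weight $r^i$, \<open>r\<close> the inverse of \<open>q\<close>, that produces \<open>x g = q g x\<close>. The other relations become the
  two conditions that define \<open>model_space\<close>, on which the free algebra therefore acts through its quotient.
\<close>
definition model_op :: "'k::field \<Rightarrow> radford_gen \<Rightarrow> (nat \<Rightarrow> nat \<Rightarrow> 'k) \<Rightarrow> nat \<Rightarrow> nat \<Rightarrow> 'k" where
  "model_op r a F = (case a of Gg \<Rightarrow> (\<lambda>i j. F (Suc i) j) | Gx \<Rightarrow> (\<lambda>i j. r ^ i * F i (Suc j)))"

definition model_space :: "nat \<Rightarrow> nat \<Rightarrow> (nat \<Rightarrow> nat \<Rightarrow> 'k::field) set" where
  "model_space m n = {F. (\<forall>i j. F (i + m * n) j = F i j) \<and> (\<forall>i j. F i (j + n) = F (i + n) j - F i j)}"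

lemma model_op_simps [simp]: "model_op r Gg F i j = F (Suc i) j" "model_op r Gx F i j = r ^ i * F i (Suc j)"
  by (simp_all add: model_op_def)

lemma model_op_space:
  assumes "r ^ n = 1" "F \<in> model_space m n"
  shows "model_op r a F \<in> model_space m n"
proof -
  have F: "F (i + m * n) j = F i j" "F i (j + n) = F (i + n) j - F i j" for i j
    using assms(2) by (simp_all add: model_space_def)
  have F_Suc: "F (Suc (i + m * n)) j = F (Suc i) j" "F i (Suc (j + n)) = F (i + n) (Suc j) - F i (Suc j)"
    "F (Suc i) (j + n) = F (Suc (i + n)) j - F (Suc i) j" for i j
    using F(1)[of "Suc i" j] F(2)[of i "Suc j"] F(2)[of "Suc i" j] by simp_all
  have r: "r ^ (i + n) = r ^ i" "r ^ (i + m * n) = r ^ i" for i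
    using assms(1) by (simp_all add: power_add power_mult mult.commute[of m])
  show ?thesis
    by (cases a) (simp_all add: model_space_def F F_Suc r right_diff_distrib)
qed

lemma foldr_model_space: "r ^ n = 1 \<Longrightarrow> F \<in> model_space m n \<Longrightarrow> foldr (model_op r) us F \<in> model_space m n"
  by (induction us) (simp_all add: model_op_space)

text \<open>
  A word acts by evaluating at a shifted point and scaling. This lets the action of a word pass
  through the finite sum over the words of a second element.
\<close>
lemma foldr_model_monomial: "\<exists>c i' j'. \<forall>F. foldr (model_op r) us F i j = c * F i' j'"
proof (induction us arbitrary: i j)
  case Nil
  show ?case by (rule exI[of _ 1], rule exI[of _ i], rule exI[of _ j]) simp
next
  case (Cons a us)
  show ?case
  proof (cases a)
    case Gg then show ?thesis using Cons[of "Suc i" j] by simp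
  next
    case Gx
    obtain c i' j' where "\<forall>F. foldr (model_op r) us F i (Suc j) = c * F i' j'" using Cons by blast
    with Gx show ?thesis by (intro exI[of _ "r ^ i * c"] exI[of _ i'] exI[of _ j']) simp
  qed
qed

interpretation fld: weighted_sum "(*) :: 'k::field \<Rightarrow> 'k \<Rightarrow> 'k"
  by unfold_locales (simp_all add: algebra_simps)

definition model_eval where
  "model_eval r p F i j = fld.wsum (\<lambda>w. foldr (model_op r) (letters w) F i j) p"

lemma model_eval_simps [simp]:
  "model_eval r 0 F i j = 0"
  "model_eval r 1 F i j = F i j"
  "model_eval r (p + p') F i j = model_eval r p F i j + model_eval r p' F i j"
  "model_eval r (p - p') F i j = model_eval r p F i j - model_eval r p' F i j"
  "model_eval r (gen a) F i j = model_op r a F i j"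
  "model_eval r (scal c) F i j = c * F i j"
  by (simp_all add: model_eval_def fld.wsum_add fld.wsum_diff gen_def scal_def single_one[symmetric] del: single_one)

lemma model_eval_mult: "model_eval r (p * p') F i j = model_eval r p (model_eval r p' F) i j"
proof -
  have "fld.wsum (\<lambda>w. foldr (model_op r) us (foldr (model_op r) (letters w) F) i j) p' =
     foldr (model_op r) us (model_eval r p' F) i j" for us
  proof -
    obtain c i' j' where "\<forall>F. foldr (model_op r) us F i j = c * F i' j'"
      using foldr_model_monomial by blast
    then show ?thesis by (simp add: model_eval_def fld.wsum_scale_fun)
  qed
  then show ?thesis by (simp add: model_eval_def[of r "p * p'"] fld.wsum_mult model_eval_def[of r p])
qed

lemma model_eval_space:
  assumes "r ^ n = 1" "F \<in> model_space m n"
  shows "model_eval r p F \<in> model_space m n"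
proof (induction p rule: poly_mapping_single_induct)
  case zero
  then show ?case by (simp add: model_space_def)
next
  case (single w c p)
  have "model_eval r (Poly_Mapping.single w c + p) F =
      (\<lambda>i j. c * foldr (model_op r) (letters w) F i j + model_eval r p F i j)"
    by (simp add: fun_eq_iff) (simp add: model_eval_def)
  moreover have "(\<lambda>i j. c * G i j + G' i j) \<in> model_space m n"
    if "G \<in> model_space m n" "G' \<in> model_space m n" for G G'
    using that by (simp add: model_space_def right_diff_distrib)
  ultimately show ?case using single foldr_model_space[OF assms] by simp
qed

lemma model_eval_power: "model_eval r (p ^ k) F = (model_eval r p ^^ k) F"
proof (induction k)
  case (Suc k)
  have "model_eval r (p * p ^ k) F = model_eval r p (model_eval r (p ^ k) F)"
    by (simp add: fun_eq_iff model_eval_mult)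
  with Suc show ?case by simp
qed (simp add: fun_eq_iff)

lemma model_eval_power_gen:
  "(model_eval r (gen Gg) ^^ k) F i j = F (i + k) j"
  "(model_eval r (gen Gx) ^^ k) F i j = r ^ (i * k) * F i (j + k)"
proof -
  have 1: "model_eval r (gen a) F = model_op r a F" for a F by (simp add: fun_eq_iff)
  show "(model_eval r (gen Gg) ^^ k) F i j = F (i + k) j" by (induction k arbitrary: i) (simp_all add: 1)
  show "(model_eval r (gen Gx) ^^ k) F i j = r ^ (i * k) * F i (j + k)"
    by (induction k arbitrary: j) (simp_all add: 1 power_add)
qed

lemma radford_ideal_model:
  fixes q :: "'k::field"
  assumes q: "q ^ n = 1" "q \<noteq> 0" and p: "p \<in> ideal_generated_by (radford_relations m n q)" and F: "F \<in> model_space m n"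
  shows "model_eval (inverse q) p F = (\<lambda>i j. 0)"
proof -
  let ?r = "inverse q"
  have r: "?r ^ n = 1" using q by (simp add: power_inverse)
  define J where "J = {p. \<forall>F\<in>model_space m n. model_eval ?r p F = (\<lambda>i j. 0)}"
  have z: "model_eval ?r p (\<lambda>i j. 0) = (\<lambda>i j. 0)" for p
  proof -
    have "foldr (model_op ?r) us (\<lambda>i j. 0) = (\<lambda>i j. 0)" for us
      by (induction us) (auto simp: fun_eq_iff model_op_def split: radford_gen.split)
    then show ?thesis by (simp add: fun_eq_iff model_eval_def fld.wsum_def)
  qed
  have J: "p \<in> J \<longleftrightarrow> (\<forall>F\<in>model_space m n. \<forall>i j. model_eval ?r p F i j = 0)" for p
    by (simp add: J_def fun_eq_iff)
  have "two_sided_ideal J"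
    unfolding two_sided_ideal_def
  proof (intro conjI ballI allI)
    fix p r assume p: "p \<in> J"
    then have "model_eval ?r p F = (\<lambda>i j. 0)" if "F \<in> model_space m n" for F using that by (simp add: J_def)
    then show "r * p \<in> J" by (simp add: J model_eval_mult z)
    show "p * r \<in> J" using p model_eval_space[OF r] by (simp add: J model_eval_mult)
  qed (simp_all add: J)
  moreover have "radford_relations m n q \<subseteq> J"
  proof -
    have "?r ^ (i * n) = 1" for i using r by (metis mult.commute power_mult power_one)
    then show ?thesis using q(2)
      unfolding radford_relations_def J_def model_space_def
      by (auto simp: fun_eq_iff model_eval_mult model_eval_power model_eval_power_gen)
  qed
  ultimately have "p \<in> J" using ideal_generated_by_subset p by blast
  then show ?thesis using F by (simp add: J_def)
qed

text \<open>
  The function of \<open>model_space\<close> that is the indicator of \<open>(a, b)\<close> on the points with \<open>i < m n\<close>, \<open>j < n\<close>;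
  the values at larger \<open>j\<close> are forced by the relation for \<open>x\<^sup>n\<close>.
\<close>
function model_unit :: "nat \<Rightarrow> nat \<Rightarrow> nat \<Rightarrow> nat \<Rightarrow> nat \<Rightarrow> nat \<Rightarrow> 'k::field" where
  "model_unit m n a b i j = (if n = 0 \<or> j < n then (if i mod (m * n) = a \<and> j = b then 1 else 0)
     else model_unit m n a b (i + n) (j - n) - model_unit m n a b i (j - n))"
  by auto
termination by (relation "Wellfounded.measure (\<lambda>(m, n, a, b, i, j). j)") auto

declare model_unit.simps [simp del]

lemma model_unit_space:
  assumes n: "n > 0"
  shows "(model_unit m n a b :: nat \<Rightarrow> nat \<Rightarrow> 'k::field) \<in> model_space m n"
proof -
  have "model_unit m n a b (i + m * n) j = (model_unit m n a b i j :: 'k)" for i j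
  proof (induction j arbitrary: i rule: less_induct)
    case (less j)
    show ?case
    proof (cases "j < n")
      case True then show ?thesis by (simp add: model_unit.simps)
    next
      case False
      then have "j - n < j" using n by simp
      from less[OF this, of i] less[OF this, of "i + n"] show ?thesis
        unfolding model_unit.simps[of m n a b _ j] using n False by (simp add: algebra_simps)
    qed
  qed
  moreover have "model_unit m n a b i (j + n) = (model_unit m n a b (i + n) j - model_unit m n a b i j :: 'k)" for i j
    using n by (subst model_unit.simps) simp
  ultimately show ?thesis by (simp add: model_space_def)
qed
section \<open>The basis of a Radford Hopf algebra\<close>

locale radford_hopf = hopf H S for H :: "('k::field, 'i::finite) bialg" and S +
  fixes m n :: nat and q :: 'k and g x :: "'k ^ 'i"
  assumes m_pos: "m > 0" and n_pos: "n > 0"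
    and prim: "primitive_root_of_unity n q"
    and pres: "presented_by H (case_radford_gen g x) (radford_relations m n q)"
    and comul_g: "comul H g = g \<otimes>\<^sub>v g"
    and comul_x: "comul H x = x \<otimes>\<^sub>v g + unt H \<otimes>\<^sub>v x"
    and counit_g: "counit H g = 1"
    and S_x: "S x = - mul H x (S g)"
begin

abbreviation N where "N \<equiv> m * n"

lemma q_n: "q ^ n = 1" and q_primitive: "0 < k \<Longrightarrow> k < n \<Longrightarrow> q ^ k \<noteq> 1"
  using prim by (auto simp: primitive_root_of_unity_def)

lemma q_0: "q \<noteq> 0"
  using q_n n_pos by (metis power_eq_0_iff zero_neq_one power_0_left neq0_conv)

lemma N_pos: "N > 0"
  using m_pos n_pos by simp

lemma surj_eval: "surj (free_eval H (case_radford_gen g x))"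
  using pres by (simp add: presented_by_def)

lemma relation: "p \<in> radford_relations m n q \<Longrightarrow> free_eval H (case_radford_gen g x) p = 0"
  using pres ideal_generated_by_superset[of "radford_relations m n q"] by (auto simp: presented_by_def)

lemma pw_g_N: "pw g N = unt H"
  using relation[of "gen Gg ^ (m * n) - 1"]
  by (simp add: radford_relations_def free_eval_diff free_eval_power free_eval_gen free_eval_one)

lemma pw_x_n: "pw x n = pw g n - unt H"
  using relation[of "gen Gx ^ n - (gen Gg ^ n - 1)"]
  by (simp add: radford_relations_def free_eval_diff free_eval_power free_eval_gen free_eval_one)

lemma x_g: "mul H x g = q *s mul H g x"
  using relation[of "gen Gx * gen Gg - scal q * gen Gg * gen Gx"]
  by (simp add: radford_relations_def free_eval_diff free_eval_mult free_eval_gen free_eval_scal)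

lemma induct_generators [case_names unt add scale g x]:
  assumes "P (unt H)" "\<And>a b. P a \<Longrightarrow> P b \<Longrightarrow> P (a + b)" "\<And>c a. P a \<Longrightarrow> P (c *s a)"
    and "\<And>b. P b \<Longrightarrow> P (mul H g b)" "\<And>b. P b \<Longrightarrow> P (mul H x b)"
  shows "P a"
  using surj_eval assms(1-3)
proof (rule generated_induct)
  show "P (mul H (case_radford_gen g x c) b)" if "P b" for c b
    using assms(4,5)[OF that] by (cases c) simp_all
qed

lemma pw_x_g: "mul H (pw x l) (pw g k) = q ^ (l * k) *s mul H (pw g k) (pw x l)"
proof -
  have 1: "mul H x (pw g k) = q ^ k *s mul H (pw g k) x" for k
  proof (induction k)
    case (Suc k)
    have "mul H x (pw g (Suc k)) = mul H (mul H x g) (pw g k)" by (simp add: pw_Suc mul_assoc)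
    also have "\<dots> = q *s mul H g (mul H x (pw g k))" by (simp add: x_g mul_assoc)
    also have "\<dots> = q ^ Suc k *s mul H (pw g (Suc k)) x" unfolding Suc by (simp add: pw_Suc mul_assoc vector_smult_assoc)
    finally show ?case .
  qed simp
  show ?thesis
  proof (induction l)
    case (Suc l)
    have "mul H (pw x (Suc l)) (pw g k) = mul H x (mul H (pw x l) (pw g k))" by (simp add: pw_Suc mul_assoc)
    also have "\<dots> = q ^ (l * k) *s mul H (mul H x (pw g k)) (pw x l)" unfolding Suc by (simp add: mul_assoc)
    also have "\<dots> = q ^ (Suc l * k) *s mul H (pw g k) (pw x (Suc l))"
      unfolding 1 by (simp add: pw_Suc mul_assoc vector_smult_assoc power_add mult.commute)
    finally show ?case .
  qed simp
qed

definition bas :: "nat \<Rightarrow> nat \<Rightarrow> 'k ^ 'i" where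
  "bas i l = mul H (pw g i) (pw x l)"

lemma bas_0: "bas i 0 = pw g i"
  by (simp add: bas_def)

lemma bas_mul: "mul H (bas i l) (bas k r) = q ^ (l * k) *s bas (i + k) (l + r)"
proof -
  have "mul H (bas i l) (bas k r) = mul H (pw g i) (mul H (mul H (pw x l) (pw g k)) (pw x r))"
    by (simp add: bas_def mul_assoc)
  then show ?thesis unfolding pw_x_g by (simp add: bas_def pw_add mul_assoc)
qed

lemma pw_g_mod: "pw g (i mod N) = pw g i"
proof -
  have "pw g i = pw g (i mod N + N * (i div N))" by simp
  also have "\<dots> = pw g (i mod N)" by (simp only: pw_add pw_mult[of g N] pw_g_N pw_unt mul_unt)
  finally show ?thesis by simp
qed

lemma bas_mod: "bas (i mod N) l = bas i l"
  by (simp add: bas_def pw_g_mod)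

lemma bas_n: "bas i n = bas (i + n) 0 - bas i 0"
  by (simp add: bas_def pw_x_n pw_add vlinear_diff[OF lin_mul(2)[OF lin_basic(1)]])

text \<open>
  A preimage in the free algebra acts on \<open>model_unit\<close>, and the value at the origin does not depend on
  the preimage. The prefactor cancels the weight that \<open>x\<close> picks up in the model, so that \<open>coord a b\<close> is the
  coordinate with respect to \<open>bas a b\<close>.
\<close>
definition coord :: "nat \<Rightarrow> nat \<Rightarrow> 'k ^ 'i \<Rightarrow> 'k" where
  "coord a b y = q ^ (a * b) *
     model_eval (inverse q) (SOME p. free_eval H (case_radford_gen g x) p = y) (model_unit m n a b) 0 0"

lemma coord_free_eval: "coord a b (free_eval H (case_radford_gen g x) p) =
   q ^ (a * b) * model_eval (inverse q) p (model_unit m n a b) 0 0"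
proof -
  define p' where "p' = (SOME p'. free_eval H (case_radford_gen g x) p' = free_eval H (case_radford_gen g x) p)"
  have "free_eval H (case_radford_gen g x) p' = free_eval H (case_radford_gen g x) p"
    unfolding p'_def by (rule someI[of _ p]) simp
  then have "p' - p \<in> ideal_generated_by (radford_relations m n q)"
    using pres by (auto simp: presented_by_def free_eval_diff)
  from radford_ideal_model[OF q_n q_0 this model_unit_space[OF n_pos]]
  have "model_eval (inverse q) (p' - p) (model_unit m n a b) 0 0 = 0" by simp
  then show ?thesis by (simp add: coord_def p'_def)
qed

lemma slinear_coord: "slinear (coord a b)"
proof -
  have ev: "\<exists>p. y = free_eval H (case_radford_gen g x) p" for y
    using surj_eval by (metis surjD)
  have "coord a b (y + y') = coord a b y + coord a b y'" for y y'
  proof -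
    obtain p p' where "y = free_eval H (case_radford_gen g x) p" "y' = free_eval H (case_radford_gen g x) p'"
      using ev by blast
    then show ?thesis
      by (simp only: free_eval_add[symmetric] coord_free_eval model_eval_simps distrib_left)
  qed
  moreover have "coord a b (c *s y) = c * coord a b y" for c y
  proof -
    obtain p where p: "y = free_eval H (case_radford_gen g x) p" using ev by blast
    then have "c *s y = free_eval H (case_radford_gen g x) (scal c * p)"
      by (simp add: free_eval_mult free_eval_scal)
    then show ?thesis by (simp add: p coord_free_eval model_eval_mult)
  qed
  ultimately show ?thesis by (simp add: slinear_def)
qed

definition dual_bas :: "nat \<Rightarrow> nat \<Rightarrow> 'k ^ 'i" where
  "dual_bas a b = functional (coord a b)"

lemma dual_bas_bas: "l < n \<Longrightarrow> pairing (dual_bas a b) (bas i l) = (if i mod N = a \<and> l = b then 1 else 0)"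
proof -
  assume l: "l < n"
  have "bas i l = free_eval H (case_radford_gen g x) (gen Gg ^ i * gen Gx ^ l)"
    by (simp add: bas_def free_eval_mult free_eval_power free_eval_gen)
  then have "pairing (dual_bas a b) (bas i l) = q ^ (a * b) * (inverse q ^ (i * l) * model_unit m n a b i l)"
    unfolding dual_bas_def pairing_functional[OF slinear_coord]
    by (simp add: coord_free_eval model_eval_mult model_eval_power model_eval_power_gen)
  also have "\<dots> = (if i mod N = a \<and> l = b then 1 else 0)"
  proof (cases "i mod N = a \<and> l = b")
    case True
    have "q ^ i = q ^ (i mod N + N * (i div N))" by simp
    also have "\<dots> = q ^ (i mod N) * ((q ^ n) ^ m) ^ (i div N)"
      by (simp only: power_add power_mult mult.commute[of m n])
    finally have "q ^ i = q ^ (i mod N)" by (simp add: q_n)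
    then have "q ^ (a * b) * inverse q ^ (i * l) = 1"
      using True q_0 by (simp add: power_mult power_inverse)
    then show ?thesis using True l by (simp add: model_unit.simps mult.assoc[symmetric])
  qed (use l in \<open>auto simp: model_unit.simps\<close>)
  finally show ?thesis .
qed

text \<open>
  The vectors fixed by the expansion map \<open>E\<close> form a subspace that contains the unit and is stable under
  left multiplication by \<open>g\<close> and by \<open>x\<close>; by \<open>bas_n\<close> it stays inside the span when the exponent of \<open>x\<close> reaches \<open>n\<close>.
\<close>
lemma expansion: "y = (\<Sum>i<N. \<Sum>l<n. pairing (dual_bas i l) y *s bas i l)"
proof -
  define E where "E y = (\<Sum>i<N. \<Sum>l<n. pairing (dual_bas i l) y *s bas i l)" for y
  have E: "vlinear E" unfolding E_def by (intro lin)
  have E_bas: "E (bas i l) = bas i l" if "l < n" for i l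
  proof -
    have scale_if: "(if P then (1::'k) else 0) *s v = (if P then v else 0)" for P and v :: "'k ^ 'i"
      by simp
    have "E (bas i l) = (\<Sum>k<N. \<Sum>r<n. if i mod N = k \<and> l = r then bas k r else 0)"
      unfolding E_def dual_bas_bas[OF that] scale_if ..
    also have "\<dots> = (\<Sum>k<N. if k = i mod N then (\<Sum>r<n. if r = l then bas k r else 0) else 0)"
      by (intro sum.cong refl) (auto intro!: sum.cong)
    also have "\<dots> = bas i l" using that N_pos by (simp add: bas_mod)
    finally show ?thesis .
  qed
  have step: "E (mul H a b) = mul H a b" if b: "E b = b" and a: "\<And>i l. l < n \<Longrightarrow> E (mul H a (bas i l)) = mul H a (bas i l)" for a b
  proof -
    have "mul H a b = (\<Sum>i<N. \<Sum>l<n. pairing (dual_bas i l) b *s mul H a (bas i l))"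
      using arg_cong[OF b, of "mul H a"] unfolding E_def
      by (simp add: vlinear_sum[OF lin_mul(2)[OF lin_basic(1)]])
    then show ?thesis by (simp add: vlinear_sum[OF E] vlinear_scale[OF E] a)
  qed
  have "E y = y"
  proof (induction y rule: induct_generators)
    case unt
    show ?case using E_bas[OF n_pos, of 0] by (simp add: bas_0)
  next
    case (g b)
    show ?case
    proof (rule step[OF g])
      fix i l assume "l < n"
      moreover have "mul H g (bas i l) = bas (Suc i) l" by (simp add: bas_def pw_Suc mul_assoc)
      ultimately show "E (mul H g (bas i l)) = mul H g (bas i l)" by (simp add: E_bas)
    qed
  next
    case (x b)
    show ?case
    proof (rule step[OF x])
      fix i l assume l: "l < n"
      have "mul H x (bas i l) = q ^ i *s bas i (Suc l)"
        using bas_mul[of 0 1 i l] by (simp add: bas_def)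
      moreover have "E (bas i (Suc l)) = bas i (Suc l)"
      proof (cases "Suc l < n")
        case False
        then have "Suc l = n" using l by simp
        then show ?thesis using E_bas[OF n_pos] by (simp add: bas_n vlinear_diff[OF E])
      qed (rule E_bas)
      ultimately show "E (mul H x (bas i l)) = mul H x (bas i l)" by (simp add: vlinear_scale[OF E])
    qed
  qed (simp_all add: vlinear_add[OF E] vlinear_scale[OF E])
  then show ?thesis by (simp add: E_def)
qed

lemma dual_expansion_bas: "f = (\<Sum>i<N. \<Sum>l<n. pairing f (bas i l) *s dual_bas i l)"
proof (rule pairing_eqI)
  fix y
  have "pairing f y = pairing f (\<Sum>i<N. \<Sum>l<n. pairing (dual_bas i l) y *s bas i l)" using expansion[of y] by simp
  also have "\<dots> = pairing (\<Sum>i<N. \<Sum>l<n. pairing f (bas i l) *s dual_bas i l) y"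
    by (simp add: slinear_sum[OF slinear_pairing(1)] slinear_sum[OF slinear_pairing(2)] mult.commute)
  finally show "pairing f y = \<dots>" .
qed

lemma can_basis:
  assumes "\<And>f. vlinear (\<lambda>a. \<beta> a f)" "\<And>a. vlinear (\<lambda>f. \<beta> a f)"
  shows "can \<beta> = (\<Sum>i<N. \<Sum>l<n. \<beta> (bas i l) (dual_bas i l))"
proof -
  have "can \<beta> = (\<Sum>k\<in>UNIV. \<Sum>i<N. \<Sum>l<n. bas i l $ k *s \<beta> (axis k 1) (dual_bas i l))"
    unfolding can_def
  proof (rule sum.cong[OF refl])
    fix k :: 'i
    have "\<beta> (axis k 1) (axis k 1) = \<beta> (axis k 1) (\<Sum>i<N. \<Sum>l<n. pairing (axis k 1) (bas i l) *s dual_bas i l)"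
      by (rule arg_cong[where f = "\<beta> (axis k 1)"]) (rule dual_expansion_bas)
    then show "\<beta> (axis k 1) (axis k 1) = (\<Sum>i<N. \<Sum>l<n. bas i l $ k *s \<beta> (axis k 1) (dual_bas i l))"
      by (simp add: vlinear_sum[OF assms(2)] vlinear_scale[OF assms(2)])
  qed
  also have "\<dots> = (\<Sum>i<N. \<Sum>l<n. \<Sum>k\<in>UNIV. bas i l $ k *s \<beta> (axis k 1) (dual_bas i l))"
    by (subst sum.swap, rule sum.cong[OF refl], rule sum.swap)
  also have "\<dots> = (\<Sum>i<N. \<Sum>l<n. \<beta> (bas i l) (dual_bas i l))"
    by (simp add: vlinear_expansion[OF assms(1), symmetric])
  finally show ?thesis .
qed

lemma pw_g_eq_iff: "pw g i = pw g k \<longleftrightarrow> i mod N = k mod N"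
proof
  assume "pw g i = pw g k"
  then have "pairing (dual_bas (i mod N) 0) (bas i 0) = pairing (dual_bas (i mod N) 0) (bas k 0)" by (simp add: bas_0)
  then show "i mod N = k mod N" by (simp add: dual_bas_bas n_pos split: if_splits)
qed (metis pw_g_mod)

lemma grouplike_g: "grouplike g"
  by (simp add: grouplike_def comul_g counit_g)

lemma grouplike_pw_g: "grouplike (pw g i)"
  by (induction i) (simp_all add: pw_Suc grouplike_mul grouplike_unt grouplike_g)

lemma S_g: "S g = pw g (N - 1)"
proof (rule inverse_unique)
  show "mul H (S g) g = unt H" using grouplike_S[OF grouplike_g] by (simp add: is_inverse_def)
  show "mul H g (pw g (N - 1)) = unt H"
    using N_pos pw_g_N pw_Suc[of g "N - 1"] by simp
qed

lemma S_pw_g: "S (pw g i) = pw g (i * (N - 1))"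
  by (induction i) (simp_all add: S_unt pw_Suc' S_mul S_g pw_add[symmetric] add.commute)

lemma g_Sg: "mul H g (S g) = unt H" "mul H (S g) g = unt H"
  using grouplike_S[OF grouplike_g] by (simp_all add: is_inverse_def)

lemma S_S_g: "S (S g) = g"
proof (rule inverse_unique)
  show "mul H (S (S g)) (S g) = unt H" using g_Sg S_mul[of g "S g"] S_unt by simp
qed (rule g_Sg)

lemma S_S_x: "S (S x) = inverse q *s x"
proof -
  have "S (S x) = mul H g (mul H x (S g))"
    by (simp add: S_x vlinear_uminus[OF lin_S[OF lin_basic(1)]] S_mul S_S_g
        vlinear_uminus[OF lin_mul(2)[OF lin_basic(1)]])
  also have "\<dots> = inverse q *s mul H (q *s mul H g x) (S g)"
    using q_0 by (simp add: mul_assoc vector_smult_assoc)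
  also have "\<dots> = inverse q *s x" by (simp add: x_g[symmetric] mul_assoc g_Sg)
  finally show ?thesis .
qed

text \<open>
  The range of \<open>S\<close> is a subspace containing \<open>g\<close> and \<open>x\<close>, namely \<open>g = S (S g)\<close> and \<open>x = S (q *s S x)\<close>, and is
  closed under multiplication.
\<close>
lemma bij_S: "bij S"
proof -
  have "surj S"
  proof (unfold surj_def, rule allI)
    fix a
    show "\<exists>b. a = S b"
    proof (induction a rule: induct_generators)
      case unt
      show ?case using S_unt by metis
    next
      case (add a b)
      then show ?case using vlinear_add[OF lin_S[OF lin_basic(1)]] by metis
    next
      case (scale c a)
      then show ?case using vlinear_scale[OF lin_S[OF lin_basic(1)]] by metis
    next
      case (g b)
      then show ?case using S_mul S_S_g by metis
    next
      case (x b)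
      have "x = S (q *s S x)" using S_S_x q_0 by (simp add: vlinear_scale[OF lin_S[OF lin_basic(1)]] vector_smult_assoc)
      then show ?case using x S_mul by metis
    qed
  qed
  moreover have "vlinear S" by (intro lin)
  ultimately show ?thesis using vec.linear_surj_imp_inj unfolding bij_def by blast
qed

sublocale double H S "inv S"
  using bij_S by unfold_locales (simp_all add: bij_def surj_f_inv_f)

section \<open>Grouplike elements and characters\<close>

abbreviation S' where "S' \<equiv> inv S"

text \<open>
  The coefficients are \<open>q\<close>-binomial. Only the exponents matter below, so the coefficients are left
  unspecified.
\<close>
lemma comul_bas: "\<exists>d. comul H (bas i l) = (\<Sum>s\<le>l. d s *s (bas i s \<otimes>\<^sub>v bas (i + s) (l - s)))"
proof (induction l)
  case 0
  show ?case using grouplike_pw_g[of i] by (intro exI[of _ "\<lambda>_. 1"]) (simp add: bas_0 grouplike_def)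
next
  case (Suc l)
  then obtain d where d: "comul H (bas i l) = (\<Sum>s\<le>l. d s *s (bas i s \<otimes>\<^sub>v bas (i + s) (l - s)))" by blast
  define d' where "d' s = (if s = 0 then 0 else d (s - 1) * q ^ (l - (s - 1))) + (if s \<le> l then d s else 0)" for s
  have lin_T: "vlinear (\<lambda>t. mul (tensor_square H) t (comul H x))" by (intro T.lin_mul lin_basic)
  have add_T: "mul (tensor_square H) s (t + t') = mul (tensor_square H) s t + mul (tensor_square H) s t'" for s t t'
    by (rule vlinear_add[OF T.lin_mul(2)[OF lin_basic(1)]])
  have t_scale: "a \<otimes>\<^sub>v (c *s b) = c *s (a \<otimes>\<^sub>v b)" for a b :: "'k ^ 'i" and c
    by (rule vlinear_scale[OF lin_tens(2)[OF lin_basic(1)]])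
  have x1: "mul H (bas i s) x = bas i (Suc s)" for i s by (simp add: bas_def pw_Suc' mul_assoc)
  have g1: "mul H (bas i s) g = q ^ s *s bas (Suc i) s" for i s
    using bas_mul[of i s 1 0] by (simp add: bas_0)
  have "bas i (Suc l) = mul H (bas i l) x" by (simp add: x1)
  then have "comul H (bas i (Suc l)) = mul (tensor_square H) (comul H (bas i l)) (comul H x)"
    by (simp add: comul_mul)
  also have "\<dots> = (\<Sum>s\<le>l. d s *s (mul H (bas i s) x \<otimes>\<^sub>v mul H (bas (i + s) (l - s)) g + bas i s \<otimes>\<^sub>v mul H (bas (i + s) (l - s)) x))"
    unfolding d vlinear_sum[OF lin_T] by (simp add: comul_x add_T tensor_mul)
  also have "\<dots> = (\<Sum>s\<le>l. (d s * q ^ (l - s)) *s (bas i (Suc s) \<otimes>\<^sub>v bas (i + Suc s) (Suc l - Suc s))) +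
      (\<Sum>s\<le>l. d s *s (bas i s \<otimes>\<^sub>v bas (i + s) (Suc l - s)))"
    unfolding x1 g1 t_scale
    by (simp add: vec.scale_right_distrib sum.distrib vector_smult_assoc Suc_diff_le)
  also have "\<dots> = (\<Sum>s\<le>Suc l. d' s *s (bas i s \<otimes>\<^sub>v bas (i + s) (Suc l - s)))"
  proof -
    let ?B = "\<lambda>s. bas i s \<otimes>\<^sub>v bas (i + s) (Suc l - s)"
    have "(\<Sum>s\<le>Suc l. (if s = 0 then 0 else d (s - 1) * q ^ (l - (s - 1))) *s ?B s) =
       (\<Sum>s\<le>l. (d s * q ^ (l - s)) *s ?B (Suc s))"
      by (subst sum.atMost_Suc_shift) simp
    moreover have "(\<Sum>s\<le>Suc l. (if s \<le> l then d s else 0) *s ?B s) = (\<Sum>s\<le>l. d s *s ?B s)"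
      by simp
    ultimately show ?thesis unfolding d'_def vec.scale_left_distrib sum.distrib by simp
  qed
  finally show ?case by blast
qed

lemma dual_bas_eq_0: "l < n \<Longrightarrow> l \<noteq> b \<Longrightarrow> pairing (dual_bas a b) (bas i l) = 0"
  by (simp add: dual_bas_bas)

text \<open>
  Let \<open>b > 0\<close> be the largest exponent of \<open>x\<close> in \<open>c\<close>. In the coproduct of \<open>c\<close> the exponents of the two legs
  add up to at most \<open>b\<close>, whereas \<open>c \<otimes>\<^sub>v c\<close> has a term with exponent \<open>b\<close> in both. So \<open>c\<close> is a combination of
  powers of \<open>g\<close>, and comparing coefficients in the coproduct once more leaves a single power.
\<close>
lemma grouplike_cases:
  assumes c: "grouplike c"
  obtains i where "i < N" "c = pw g i"
proof -
  have Dc: "comul H c = c \<otimes>\<^sub>v c" "counit H c = 1" using c by (simp_all add: grouplike_def)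
  have pt: "pairing F (\<Sum>i\<in>I. v i) = (\<Sum>i\<in>I. pairing F (v i))" for F :: "'k ^ ('i \<times> 'i)" and I :: "nat set" and v
    by (rule slinear_sum[OF slinear_pairing(1)])
  have split: "pairing F (comul H c) = (\<Sum>i<N. \<Sum>l<n. pairing (dual_bas i l) c * pairing F (comul H (bas i l)))" for F
  proof -
    have "pairing F (comul H c) = pairing F (comul H (\<Sum>i<N. \<Sum>l<n. pairing (dual_bas i l) c *s bas i l))"
      using expansion[of c] by simp
    then show ?thesis
      by (simp add: slinear_sum[OF slinear_conv] slinear_conv[unfolded slinear_def])
  qed
  have high: "pairing (dual_bas a b) c = 0" if "0 < b" "b < n" for a b
    using that
  proof (induction "n - b" arbitrary: a b rule: less_induct)
    case less
    have "pairing (dual_bas a b) c * pairing (dual_bas a b) c = pairing (dual_bas a b \<otimes>\<^sub>v dual_bas a b) (comul H c)"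
      by (simp add: Dc pairing_tens)
    also have "\<dots> = 0"
      unfolding split
    proof (intro sum.neutral ballI)
      fix i l assume "l \<in> {..<n}"
      then have l: "l < n" by simp
      show "pairing (dual_bas i l) c * pairing (dual_bas a b \<otimes>\<^sub>v dual_bas a b) (comul H (bas i l)) = 0"
      proof (cases "b < l")
        case True
        then have "pairing (dual_bas i l) c = 0" using less l by (intro less.hyps) auto
        then show ?thesis by simp
      next
        case False
        obtain d where d: "comul H (bas i l) = (\<Sum>s\<le>l. d s *s (bas i s \<otimes>\<^sub>v bas (i + s) (l - s)))"
          using comul_bas by blast
        have "pairing (dual_bas a b \<otimes>\<^sub>v dual_bas a b) (comul H (bas i l)) = 0"
          unfolding d pt
        proof (intro sum.neutral ballI)
          fix s assume "s \<in> {..l}"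
          then have "s < n" "l - s < n" "s \<noteq> b \<or> l - s \<noteq> b" using l False less.prems by auto
          then show "pairing (dual_bas a b \<otimes>\<^sub>v dual_bas a b) (d s *s (bas i s \<otimes>\<^sub>v bas (i + s) (l - s))) = 0"
            using dual_bas_eq_0[of s b a i] dual_bas_eq_0[of "l - s" b a "i + s"] by (auto simp: pairing_tens)
        qed
        then show ?thesis by simp
      qed
    qed
    finally show ?case by simp
  qed
  have c_eq: "c = (\<Sum>i<N. pairing (dual_bas i 0) c *s pw g i)"
  proof -
    have "(\<Sum>l<n. pairing (dual_bas i l) c *s bas i l) = pairing (dual_bas i 0) c *s pw g i" for i
      using n_pos high by (subst sum.remove[of _ 0]) (auto simp: bas_0 intro!: sum.neutral)
    then show ?thesis using expansion[of c] by simp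
  qed
  have prod: "pairing (dual_bas a 0) c * pairing (dual_bas b 0) c = 0" if "a \<noteq> b" for a b
  proof -
    have "pairing (dual_bas a 0) c * pairing (dual_bas b 0) c = pairing (dual_bas a 0 \<otimes>\<^sub>v dual_bas b 0) (comul H c)"
      by (simp add: Dc pairing_tens)
    also have "\<dots> = 0" unfolding split
    proof (intro sum.neutral ballI)
      fix i l assume "l \<in> {..<n}"
      then show "pairing (dual_bas i l) c * pairing (dual_bas a 0 \<otimes>\<^sub>v dual_bas b 0) (comul H (bas i l)) = 0"
        using high grouplike_pw_g[of i] that n_pos
        by (cases "l = 0") (auto simp: bas_0[symmetric] grouplike_def pairing_tens dual_bas_bas)
    qed
    finally show ?thesis .
  qed
  have "\<exists>i<N. pairing (dual_bas i 0) c \<noteq> 0"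
  proof (rule ccontr)
    assume "\<not> (\<exists>i<N. pairing (dual_bas i 0) c \<noteq> 0)"
    then have "(\<Sum>i<N. pairing (dual_bas i 0) c *s pw g i) = 0" by (intro sum.neutral) auto
    then have "c = 0" using c_eq by simp
    then show False using Dc(2) slinear_counit by (metis counit_simps(4) mult_zero_left vec.scale_zero_left zero_neq_one)
  qed
  then obtain i where i: "i < N" "pairing (dual_bas i 0) c \<noteq> 0" by blast
  have "pairing (dual_bas k 0) c = 0" if "k \<noteq> i" for k using prod[OF that] i(2) by simp
  then have "(\<Sum>k<N. pairing (dual_bas k 0) c *s pw g k) = pairing (dual_bas i 0) c *s pw g i"
    using i(1) by (subst sum.remove[of _ i]) (auto intro!: sum.neutral)
  then have ci: "c = pairing (dual_bas i 0) c *s pw g i" using c_eq by simp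
  then have "1 = counit H (pairing (dual_bas i 0) c *s pw g i)" using Dc(2) by metis
  also have "\<dots> = pairing (dual_bas i 0) c" using grouplike_pw_g[of i] by (simp add: grouplike_def)
  finally have "c = pw g i" using ci by simp
  with i(1) show thesis by (rule that)
qed

lemma character_pw: "character \<psi> \<Longrightarrow> pairing \<psi> (pw a k) = pairing \<psi> a ^ k"
  by (induction k) (simp_all add: pw_Suc character_mul character_unt)

lemma character_g_N: "character \<psi> \<Longrightarrow> pairing \<psi> g ^ N = 1"
  using character_pw[of \<psi> g N] by (simp add: pw_g_N character_unt)

lemma character_x:
  assumes "character \<psi>" "pairing \<psi> g ^ n = 1"
  shows "pairing \<psi> x = 0"
proof -
  have "pairing \<psi> x ^ n = pairing \<psi> (pw g n) - pairing \<psi> (unt H)"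
    using character_pw[OF assms(1), of x n] unfolding pw_x_n
    by (simp add: pairing_def algebra_simps sum_subtractf)
  then show ?thesis using assms n_pos by (simp add: character_pw character_unt)
qed

lemma character_g_n:
  assumes \<psi>: "character \<psi>" and "n \<ge> 2"
  shows "pairing \<psi> g ^ n = 1"
proof -
  have "pairing \<psi> (mul H x g) = pairing \<psi> (q *s mul H g x)" by (simp add: x_g)
  then have "pairing \<psi> x * pairing \<psi> g = q * (pairing \<psi> x * pairing \<psi> g)"
    by (simp add: character_mul[OF \<psi>] mult.commute)
  moreover have "q \<noteq> 1" using q_primitive[of 1] assms(2) by simp
  moreover have "pairing \<psi> g \<noteq> 0" using character_g_N[OF \<psi>] N_pos by (metis power_0_left zero_neq_one less_not_refl)
  ultimately have "pairing \<psi> x = 0" by simp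
  moreover have "pairing \<psi> (pw x n) = pairing \<psi> (pw g n) - 1"
    unfolding pw_x_n using character_unt[OF \<psi>] by (simp add: pairing_def algebra_simps sum_subtractf)
  ultimately show ?thesis using n_pos by (simp add: character_pw[OF \<psi>] power_0_left)
qed

lemma pairing_add: "pairing f (a + b) = pairing f a + pairing f b"
  using slinear_pairing(1)[of f] by (simp add: slinear_def)

lemma character_eqI:
  assumes \<psi>: "character \<psi>" "character \<psi>'" and g: "pairing \<psi> g = pairing \<psi>' g" and x: "pairing \<psi> x = pairing \<psi>' x"
  shows "\<psi> = \<psi>'"
proof (rule pairing_eqI)
  show "pairing \<psi> a = pairing \<psi>' a" for a
    by (induction a rule: induct_generators)
       (simp_all add: \<psi>[THEN character_unt] \<psi>[THEN character_mul] g x pairing_add)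
qed

text \<open>
  The functional that sends \<open>bas i 0\<close> to $s^i$ and the other basis vectors to zero is multiplicative: this
  has to be checked only for left multiplication by \<open>g\<close> and by \<open>x\<close>. For \<open>x\<close> it uses $s^n = 1$, since \<open>x\<^sup>n\<close> is
  \<open>g\<^sup>n - 1\<close>.
\<close>
lemma character_exists:
  assumes s: "s ^ n = 1"
  obtains \<psi> where "character \<psi>" "pairing \<psi> g = s" "pairing \<psi> x = 0"
proof -
  define \<psi> where "\<psi> = (\<Sum>i<N. s ^ i *s dual_bas i 0)"
  have p: "pairing \<psi> y = (\<Sum>i<N. s ^ i * pairing (dual_bas i 0) y)" for y
    unfolding \<psi>_def by (simp add: slinear_sum[OF slinear_pairing(2)])
  have s_mod: "s ^ (i mod N) = s ^ i" for i
  proof -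
    have "s ^ i = s ^ (i mod N + N * (i div N))" by simp
    also have "\<dots> = s ^ (i mod N) * ((s ^ n) ^ m) ^ (i div N)"
      by (simp only: power_add power_mult mult.commute[of m n])
    finally show ?thesis by (simp add: s)
  qed
  have \<psi>_bas: "pairing \<psi> (bas i l) = (if l = 0 then s ^ i else 0)" if "l < n" for i l
  proof (cases "l = 0")
    case True
    have "pairing \<psi> (bas i l) = (\<Sum>k<N. if i mod N = k then s ^ k else 0)"
      unfolding p dual_bas_bas[OF that] using True by (intro sum.cong) auto
    then show ?thesis using True N_pos by (simp add: s_mod)
  qed (simp add: p dual_bas_bas that)
  have step: "pairing \<psi> (mul H a b) = c * pairing \<psi> b"
    if "\<And>i l. l < n \<Longrightarrow> pairing \<psi> (mul H a (bas i l)) = c * pairing \<psi> (bas i l)" for a b c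
  proof -
    have "pairing \<psi> (mul H a b) = pairing \<psi> (mul H a (\<Sum>i<N. \<Sum>l<n. pairing (dual_bas i l) b *s bas i l))"
      using expansion[of b] by simp
    also have "\<dots> = c * pairing \<psi> (\<Sum>i<N. \<Sum>l<n. pairing (dual_bas i l) b *s bas i l)"
      by (simp add: vlinear_sum[OF lin_mul(2)[OF lin_basic(1)]] slinear_sum[OF slinear_pairing(1)] that
          sum_distrib_left algebra_simps)
    finally show ?thesis using expansion[of b] by simp
  qed
  have g_step: "pairing \<psi> (mul H g b) = s * pairing \<psi> b" for b
  proof (rule step)
    fix i l assume "l < n"
    moreover have "mul H g (bas i l) = bas (Suc i) l" by (simp add: bas_def pw_Suc mul_assoc)
    ultimately show "pairing \<psi> (mul H g (bas i l)) = s * pairing \<psi> (bas i l)" by (simp add: \<psi>_bas)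
  qed
  have x_step: "pairing \<psi> (mul H x b) = 0 * pairing \<psi> b" for b
  proof (rule step)
    fix i l assume l: "l < n"
    have x: "mul H x (bas i l) = q ^ i *s bas i (Suc l)"
      using bas_mul[of 0 1 i l] by (simp add: bas_def)
    show "pairing \<psi> (mul H x (bas i l)) = 0 * pairing \<psi> (bas i l)"
    proof (cases "Suc l < n")
      case False
      then have "Suc l = n" using l by simp
      then have "pairing \<psi> (bas i (Suc l)) = pairing \<psi> (bas (i + n) 0) - pairing \<psi> (bas i 0)"
        by (simp add: bas_n pairing_def algebra_simps sum_subtractf)
      then show ?thesis using n_pos s by (simp add: x \<psi>_bas power_add)
    qed (simp add: x \<psi>_bas)
  qed
  have one: "pairing \<psi> (unt H) = 1" using \<psi>_bas[OF n_pos, of 0] by (simp add: bas_0)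
  have "pairing \<psi> (mul H a b) = pairing \<psi> a * pairing \<psi> b" for a b
    by (induction a rule: induct_generators)
       (simp_all add: one mul_assoc g_step x_step pairing_add vlinear_add[OF lin_mul(1)[OF lin_basic(1)]] algebra_simps)
  then have "character \<psi>" using one by (simp add: character_def)
  then show thesis using g_step[of "unt H"] x_step[of "unt H"] one by (intro that) simp_all
qed

section \<open>The grouplike element whose square roots are sought\<close>

lemma sw3_bas:
  assumes "\<And>b c. vlinear (\<lambda>a. \<gamma> a b c)" "\<And>a c. vlinear (\<lambda>b. \<gamma> a b c)" "\<And>a b. vlinear (\<lambda>c. \<gamma> a b c)"
  shows "\<exists>d. sw3 \<gamma> (bas i l) = (\<Sum>s\<le>l. \<Sum>r\<le>l - s. d s r *s \<gamma> (bas i s) (bas (i + s) r) (bas (i + s + r) (l - s - r)))"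
proof -
  note l = vlinear_compose[OF assms(1)] vlinear_compose[OF assms(2)] vlinear_compose[OF assms(3)]
  define d where "d i l = (SOME d. comul H (bas i l) = (\<Sum>s\<le>l. d s *s (bas i s \<otimes>\<^sub>v bas (i + s) (l - s))))" for i l
  have d: "comul H (bas i l) = (\<Sum>s\<le>l. d i l s *s (bas i s \<otimes>\<^sub>v bas (i + s) (l - s)))" for i l
    unfolding d_def by (rule someI_ex[OF comul_bas])
  have tl: "sw \<beta> (bas i l) = (\<Sum>s\<le>l. d i l s *s \<beta> (bas i s) (bas (i + s) (l - s)))"
    if "\<And>b. vlinear (\<lambda>a. \<beta> a b)" "\<And>a. vlinear (\<lambda>b. \<beta> a b)" for \<beta> :: "'k ^ 'i \<Rightarrow> 'k ^ 'i \<Rightarrow> 'k ^ 'l" and i l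
    unfolding d by (simp add: vlinear_sum[OF lin_tlift[OF lin_basic(1)]] vlinear_scale[OF lin_tlift[OF lin_basic(1)]]
        tlift_tens that)
  have "sw3 \<gamma> (bas i l) = (\<Sum>s\<le>l. d i l s *s sw (\<gamma> (bas i s)) (bas (i + s) (l - s)))"
    unfolding sw3_def by (rule tl) (intro lin l)+
  also have "\<dots> = (\<Sum>s\<le>l. \<Sum>r\<le>l - s. (d i l s * d (i + s) (l - s) r) *s \<gamma> (bas i s) (bas (i + s) r) (bas (i + s + r) (l - s - r)))"
    by (subst tl, (rule assms)+) (simp add: vec.scale_sum_right vector_smult_assoc)
  finally show ?thesis by (rule exI[where x = "\<lambda>s r. d i l s * d (i + s) (l - s) r"])
qed

lemma S_bas: "\<exists>c. S (bas i l) = c *s bas ((i + l) * (N - 1)) l"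
proof -
  have "\<exists>c. S (pw x l) = c *s bas (l * (N - 1)) l"
  proof (induction l)
    case 0
    show ?case by (rule exI[of _ 1]) (simp add: S_unt bas_def)
  next
    case (Suc l)
    then obtain c where c: "S (pw x l) = c *s bas (l * (N - 1)) l" by blast
    have "S x = - (mul H (bas 0 1) (bas (N - 1) 0))" by (simp add: S_x S_g bas_def)
    also have "\<dots> = (- (q ^ (N - 1))) *s bas (N - 1) 1" unfolding bas_mul by simp
    finally obtain e where e: "S x = e *s bas (N - 1) 1" by blast
    have "S (pw x (Suc l)) = (c * (e * q ^ (l * (N - 1)))) *s bas (l * (N - 1) + (N - 1)) (l + 1)"
      unfolding pw_Suc S_mul c e mul_scale bas_mul by (simp add: vector_smult_assoc mult_ac)
    then have "S (pw x (Suc l)) = (c * (e * q ^ (l * (N - 1)))) *s bas (Suc l * (N - 1)) (Suc l)"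
      by (simp add: add.commute)
    then show ?case by blast
  qed
  then obtain c where c: "S (pw x l) = c *s bas (l * (N - 1)) l" by blast
  have "S (bas i l) = mul H (S (pw x l)) (bas (i * (N - 1)) 0)"
    by (simp add: bas_def S_mul S_pw_g)
  also have "\<dots> = (c * q ^ (l * (i * (N - 1)))) *s bas ((i + l) * (N - 1)) l"
    unfolding c by (simp add: bas_mul vector_smult_assoc distrib_right add.commute)
  finally show ?thesis by blast
qed

lemma SS_bas: "S (S (bas i l)) = inverse q ^ l *s bas i l"
proof -
  have "S (S (pw g i)) = pw g i" by (rule SS_grouplike[OF grouplike_pw_g])
  moreover have "S (S (pw x l)) = inverse q ^ l *s pw x l"
    by (induction l) (simp_all add: S_unt pw_Suc S_mul S_S_x vector_smult_assoc mult.commute)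
  ultimately show ?thesis by (simp add: bas_def S_mul)
qed

lemma tr_basis: "vlinear F \<Longrightarrow> tr F = (\<Sum>i<N. \<Sum>l<n. pairing (dual_bas i l) (F (bas i l)))"
proof (rule scalar_eqI)
  fix v :: "'k ^ 1" assume F: "vlinear F"
  have "tr F *s v = can (\<lambda>e f. pairing f (F e) *s v)"
    by (simp add: tr_def can_def vec.scale_sum_left)
  also have "\<dots> = (\<Sum>i<N. \<Sum>l<n. pairing (dual_bas i l) (F (bas i l)) *s v)"
    by (rule can_basis) (intro lin F)+
  finally show "tr F *s v = (\<Sum>i<N. \<Sum>l<n. pairing (dual_bas i l) (F (bas i l))) *s v"
    by (simp add: vec.scale_sum_left)
qed

text \<open>
  The operator whose trace gives the character in \<open>h_character\<close>. It is a right action of the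
  algebra on itself, which makes it computable on the monomials \<open>bas i l\<close>: starting from \<open>g\<close>, the
  powers of \<open>g\<close> fix \<open>g\<close>, one \<open>x\<close> leads to a multiple of \<open>x\<close>, and a second one to zero.
\<close>
definition \<Theta> where "\<Theta> y e = sw (\<lambda>e1 e2. mul H (S e2) (mul H y (S (S e1)))) e"

lemma lin_\<Theta>: "vlinear f \<Longrightarrow> vlinear (\<lambda>x. \<Theta> y (f x))" "vlinear f \<Longrightarrow> vlinear (\<lambda>x. \<Theta> (f x) e)"
  unfolding \<Theta>_def by (intro lin; assumption)+

lemma \<Theta>_mul: "\<Theta> y (mul H a b) = \<Theta> (\<Theta> y a) b"
proof -
  have "\<Theta> y (mul H a b) = sw (\<lambda>a1 a2. sw (\<lambda>b1 b2. 
      mul H (S (mul H a2 b2)) (mul H y (S (S (mul H a1 b1))))) b) a"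
    unfolding \<Theta>_def by (rule comul_mul_tlift) (intro lin)+
  also have "\<dots> = sw (\<lambda>a1 a2. \<Theta> (mul H (S a2) (mul H y (S (S a1)))) b) a"
    by (simp add: \<Theta>_def S_mul mul_assoc)
  also have "\<dots> = \<Theta> (\<Theta> y a) b"
    unfolding \<Theta>_def[of y a] by (rule vlinear_tlift[symmetric]) (intro lin_\<Theta> lin_basic)
  finally show ?thesis .
qed

lemma \<Theta>_unt: "\<Theta> y (unt H) = y"
  unfolding \<Theta>_def comul_unt by (subst tlift_tens) (intro lin | simp add: S_unt)+

lemma \<Theta>_g: "\<Theta> g (pw g i) = g"
proof (induction i)
  case (Suc i)
  have "\<Theta> g g = g"
    unfolding \<Theta>_def comul_g by (subst tlift_tens) (intro lin | simp add: S_S_g mul_assoc[symmetric] g_Sg)+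
  with Suc show ?case by (simp add: pw_Suc \<Theta>_mul)
qed (simp add: \<Theta>_unt)

lemma \<Theta>_x: "\<Theta> y x = inverse q *s mul H (S g) (mul H y x) - mul H x (mul H (S g) y)"
proof -
  have "\<Theta> y x = tlift (\<lambda>e1 e2. mul H (S e2) (mul H y (S (S e1)))) (x \<otimes>\<^sub>v g) +
     tlift (\<lambda>e1 e2. mul H (S e2) (mul H y (S (S e1)))) (unt H \<otimes>\<^sub>v x)"
    unfolding \<Theta>_def comul_x by (rule vlinear_add) (intro lin)
  also have "\<dots> = mul H (S g) (mul H y (S (S x))) + mul H (S x) (mul H y (S (S (unt H))))"
    by (subst tlift_tens, (intro lin)+)+ (rule refl)
  also have "\<dots> = inverse q *s mul H (S g) (mul H y x) - mul H x (mul H (S g) y)"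
    by (simp only: S_S_x, simp add: S_unt S_x vlinear_uminus[OF lin_mul(1)[OF lin_basic(1)]] mul_assoc)
  finally show ?thesis .
qed

lemma Sg_x: "mul H (S g) x = q *s mul H x (S g)"
proof -
  have "mul H (S g) (mul H (mul H x g) (S g)) = q *s mul H (mul H (S g) g) (mul H x (S g))"
    by (simp add: x_g mul_assoc)
  then show ?thesis by (simp add: mul_assoc g_Sg)
qed

lemma \<Theta>_g_bas: "\<Theta> g (bas i l) = (if l = 0 then g else if l = 1 then (inverse q - 1) *s x else 0)"
proof -
  have gx: "\<Theta> g x = (inverse q - 1) *s x"
    by (simp add: \<Theta>_x mul_assoc[symmetric] g_Sg vec.scale_left_diff_distrib)
  have xx: "\<Theta> x x = 0"
  proof -
    have "mul H (mul H (S g) x) x = q *s mul H (mul H x (S g)) x"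
      by (simp only: Sg_x mul_scale)
    then have "mul H (S g) (mul H x x) = q *s mul H x (mul H (S g) x)"
      by (simp only: mul_assoc)
    then show ?thesis using q_0 by (simp add: \<Theta>_x vector_smult_assoc)
  qed
  have "\<Theta> g (bas i (Suc k)) = (if k = 0 then (inverse q - 1) *s x else 0)" for k
  proof (induction k)
    case 0
    show ?case by (simp add: bas_def \<Theta>_mul \<Theta>_g gx)
  next
    case (Suc k)
    have "bas i (Suc (Suc k)) = mul H (bas i (Suc k)) x" by (simp only: bas_def pw_Suc'[of x "Suc k"] mul_assoc)
    then have "\<Theta> g (bas i (Suc (Suc k))) = \<Theta> (if k = 0 then (inverse q - 1) *s x else 0) x"
      by (simp only: \<Theta>_mul Suc)
    moreover have "\<Theta> (c *s x) x = 0" "\<Theta> 0 x = 0" for c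
      using vlinear_scale[OF lin_\<Theta>(2)[OF lin_basic(1)]] vlinear_zero[OF lin_\<Theta>(2)[OF lin_basic(1)]]
      by (simp_all add: xx)
    ultimately show ?case by (simp only: split: if_split) simp
  qed
  then show ?thesis by (cases l) (simp_all add: bas_0 \<Theta>_g)
qed

lemma S'_g: "S' g = S g"
  by (rule S'_grouplike[OF grouplike_g])

lemma character_Sg: "character \<psi> \<Longrightarrow> pairing \<psi> (S g) = inverse (pairing \<psi> g)"
  using pairing_S_grouplike[OF _ grouplike_g, of \<psi>]
  by (cases "pairing \<psi> g = 0") (simp_all add: field_simps)

lemma pairing_diff: "pairing f (a - b) = pairing f a - pairing f b"
  by (simp add: pairing_def algebra_simps sum_subtractf)

text \<open>
  Only \<open>bas 1 0\<close> and, if \<open>n > 1\<close>, \<open>bas 0 1\<close> contribute to the trace, and the contributions 1 and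
  \<open>inverse q - 1\<close> add up to \<open>inverse q\<close>.
\<close>
lemma h_character_g:
  assumes h: "h = \<psi> \<otimes>\<^sub>v c" "character \<psi>" "grouplike c" and N: "N \<ge> 2"
  shows "pairing \<psi> g = q"
proof -
  have "inverse (pairing \<psi> g) = tr (\<Theta> g)"
    using h_character[OF h, of g, folded \<Theta>_def] by (simp add: S'_g character_Sg[OF h(2)])
  also have "\<dots> = (\<Sum>i<N. \<Sum>l<n. pairing (dual_bas i l) (\<Theta> g (bas i l)))"
    by (rule tr_basis) (intro lin_\<Theta> lin_basic)
  also have "\<dots> = (\<Sum>i<N. \<Sum>l<n. (if i = 1 \<and> l = 0 then 1 else 0) + (if i = 0 \<and> l = 1 then inverse q - 1 else 0))"
  proof (intro sum.cong refl)
    fix i l assume il: "i \<in> {..<N}" "l \<in> {..<n}"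
    have "1 mod N = (1::nat)" using N by (intro mod_less) simp
    then have "pairing (dual_bas i 0) g = (if i = 1 then 1 else 0)"
      using dual_bas_bas[OF n_pos, of i 0 1] by (auto simp only: bas_0 pw_1 One_nat_def split: if_splits)
    moreover have "pairing (dual_bas i 1) x = (if i = 0 then 1 else 0)" if "1 < n"
      using dual_bas_bas[OF that, of i 1 0] by (simp add: bas_def)
    ultimately show "pairing (dual_bas i l) (\<Theta> g (bas i l)) =
       (if i = 1 \<and> l = 0 then 1 else 0) + (if i = 0 \<and> l = 1 then inverse q - 1 else 0)"
      using il by (auto simp: \<Theta>_g_bas pairing_def[of _ 0] pairing_diff)
  qed
  also have "\<dots> = (\<Sum>i<N. \<Sum>l<n. if i = 1 \<and> l = 0 then 1 else 0) + (\<Sum>i<N. \<Sum>l<n. if i = 0 \<and> l = 1 then inverse q - 1 else 0)"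
    by (simp add: sum.distrib)
  also have "\<dots> = (\<Sum>i<N. if i = 1 then (\<Sum>l<n. if l = 0 then 1 else 0) else 0) +
     (\<Sum>i<N. if i = 0 then (\<Sum>l<n. if l = 1 then inverse q - 1 else 0) else 0)"
    by (intro arg_cong2[where f = "(+)"] sum.cong refl) auto
  also have "\<dots> = 1 + (if 1 < n then inverse q - 1 else 0)"
    using N n_pos N_pos by simp
  also have "\<dots> = inverse q"
  proof (cases "1 < n")
    case False
    then have "n = 1" using n_pos by simp
    then show ?thesis using q_n by simp
  qed simp
  finally show ?thesis by simp
qed

text \<open>
  Expand \<open>h_grouplike\<close> in the basis. A term for \<open>bas i l\<close> survives only if the outer two legs of the
  coproduct carry the whole exponent of \<open>x\<close>, so the middle leg is a power of \<open>g\<close>; matching the powers of \<open>g\<close> then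
  forces it to be the inverse of some $g^t$ with \<open>t \<le> l\<close>.
\<close>
lemma h_grouplike_bound:
  assumes h: "h = \<psi> \<otimes>\<^sub>v c" "character \<psi>" "grouplike c"
  obtains t where "t < n" "c = pw g t"
proof -
  obtain k where k: "k < N" "S c = pw g k" using grouplike_cases[OF grouplike_S_grouplike[OF h(3)]] .
  let ?\<gamma> = "\<lambda>f e1 e2 e3. pairing f (mul H (S e3) (S (S e1))) *s S (S e2)"
  have "S c = (\<Sum>i<N. \<Sum>l<n. sw3 (?\<gamma> (dual_bas i l)) (bas i l))"
    unfolding h_grouplike[OF h] by (rule can_basis) (intro lin)+
  moreover have "pairing (dual_bas k 0) (S c) = 1"
    using dual_bas_bas[OF n_pos, of k 0 k] k by (simp add: bas_0)
  ultimately have "(\<Sum>i<N. \<Sum>l<n. pairing (dual_bas k 0) (sw3 (?\<gamma> (dual_bas i l)) (bas i l))) = 1"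
    by (simp add: slinear_sum[OF slinear_pairing(1)])
  then obtain i l where i: "i < N" and l: "l < n" and nz: "pairing (dual_bas k 0) (sw3 (?\<gamma> (dual_bas i l)) (bas i l)) \<noteq> 0"
    by (metis (no_types, lifting) lessThan_iff sum.neutral zero_neq_one)
  obtain d where d: "sw3 (?\<gamma> (dual_bas i l)) (bas i l) =
     (\<Sum>s\<le>l. \<Sum>r\<le>l - s. d s r *s ?\<gamma> (dual_bas i l) (bas i s) (bas (i + s) r) (bas (i + s + r) (l - s - r)))"
    using sw3_bas[where \<gamma> = "?\<gamma> (dual_bas i l)" and i = i and l = l] by (auto simp: lin)
  have "\<exists>s\<le>l. \<exists>r\<le>l - s. pairing (dual_bas k 0) (?\<gamma> (dual_bas i l) (bas i s) (bas (i + s) r) (bas (i + s + r) (l - s - r))) \<noteq> 0"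
  proof (rule ccontr)
    assume "\<not> ?thesis"
    then have "pairing (dual_bas k 0) (sw3 (?\<gamma> (dual_bas i l)) (bas i l)) = 0"
      unfolding d slinear_sum[OF slinear_pairing(1)] by (intro sum.neutral ballI) simp
    with nz show False by contradiction
  qed
  then obtain s r where sr: "s \<le> l" "r \<le> l - s"
    and 1: "pairing (dual_bas i l) (mul H (S (bas (i + s + r) (l - s - r))) (S (S (bas i s)))) \<noteq> 0"
    and 2: "pairing (dual_bas k 0) (S (S (bas (i + s) r))) \<noteq> 0" by auto
  obtain e where e: "S (bas (i + s + r) (l - s - r)) = e *s bas ((i + s + r + (l - s - r)) * (N - 1)) (l - s - r)"
    using S_bas by blast
  have "pairing (dual_bas i l) (bas ((i + s + r + (l - s - r)) * (N - 1) + i) (l - s - r + s)) \<noteq> 0"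
    using 1 unfolding e SS_bas by (auto simp: bas_mul)
  moreover have "i + s + r + (l - s - r) = i + l" "l - s - r + s < n" using sr l by auto
  ultimately have "((i + l) * (N - 1) + i) mod N = i" and lr: "l - s - r + s = l"
    by (auto simp: dual_bas_bas split: if_splits)
  then have "((i + l) * (N - 1) + i) mod N = i mod N" using i by simp
  then have "((i + l) * (N - 1) + i + l) mod N = (i + l) mod N" by (metis mod_add_left_eq)
  moreover have "(i + l) * (N - 1) + i + l = (i + l) * N"
    using N_pos by (metis Suc_diff_1 add.assoc add.commute mult_Suc_right)
  ultimately have il: "(i + l) mod N = 0" by simp
  have r: "r = 0" using lr sr by simp
  have "pairing (dual_bas k 0) (bas (i + s) 0) \<noteq> 0" using 2 unfolding r SS_bas by auto
  then have "(i + s) mod N = k" by (simp add: dual_bas_bas n_pos split: if_splits)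
  then have "pw g k = pw g (i + s)" by (metis pw_g_mod)
  then have "mul H (S c) (pw g (l - s)) = pw g (i + l)"
    using k(2) sr by (simp add: pw_add[symmetric])
  also have "\<dots> = unt H" using pw_g_mod[of "i + l"] il by simp
  finally have "mul H (S c) (pw g (l - s)) = unt H" .
  moreover have "mul H c (S c) = unt H" using grouplike_S[OF h(3)] by (simp add: is_inverse_def)
  ultimately have "c = pw g (l - s)" by (intro inverse_unique[of c "S c"])
  then show thesis using l by (intro that[of "l - s"]) auto
qed

lemma S'_x: "S' x = - mul H (S g) x"
proof -
  have "S (- mul H (S g) x) = x"
    by (simp add: vlinear_uminus[OF lin_S[OF lin_basic(1)]] S_mul S_S_g S_x
       vlinear_uminus[OF lin_mul(1)[OF lin_basic(1)]] mul_assoc g_Sg)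
  then show ?thesis using S'_S by metis
qed

lemma S'_S'_g: "S' (S' g) = g" and S'_S'_x: "S' (S' x) = q *s x"
proof -
  show "S' (S' g) = g" using S_S_g by (metis S'_S)
  have "S' (S' (S (S (q *s x)))) = S' (S' x)"
    using q_0 by (simp add: S_S_x vlinear_scale[OF lin_S[OF lin_basic(1)]] vector_smult_assoc)
  then show "S' (S' x) = q *s x" by simp
qed

text \<open>
  Moving \<open>\<iota> a\<close> past \<open>j \<psi>\<close> for a character \<open>\<psi>\<close> changes \<open>a\<close> by an automorphism of the
  algebra, which scales \<open>x\<close> if \<open>\<psi>\<close> kills \<open>x\<close>.
\<close>
definition conj_char where
  "conj_char \<psi> a = sw3 (\<lambda>a1 a2 a3. (pairing \<psi> (S' a3) * pairing \<psi> a1) *s a2) a"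

lemma lin_conj_char: "vlinear f \<Longrightarrow> vlinear (\<lambda>x. conj_char \<psi> (f x))"
  unfolding conj_char_def by (intro lin)

lemma lin_conj_char_arg:
  "vlinear (\<lambda>a1. (pairing \<psi> (S' a3) * pairing \<psi> a1) *s a2)"
  "vlinear (\<lambda>a2. (pairing \<psi> (S' a3) * pairing \<psi> a1) *s a2)"
  "vlinear (\<lambda>a3. (pairing \<psi> (S' a3) * pairing \<psi> a1) *s a2)"
  unfolding vector_smult_assoc[symmetric] by (intro lin)+

lemma \<iota>_conj_char: "character \<psi> \<Longrightarrow> mul D (\<iota> a) (j \<psi>) = mul D (j \<psi>) (\<iota> (conj_char \<psi> a))"
  unfolding conj_char_def by (rule \<iota>_character)

lemma conj_char_mul:
  assumes "character \<psi>"
  shows "conj_char \<psi> (mul H a b) = mul H (conj_char \<psi> a) (conj_char \<psi> b)"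
proof -
  have "conj_char \<psi> (mul H a b) = sw3 (\<lambda>a1 a2 a3. sw3 (\<lambda>b1 b2 b3.
     (pairing \<psi> (S' (mul H a3 b3)) * pairing \<psi> (mul H a1 b1)) *s mul H a2 b2) b) a"
    unfolding conj_char_def by (rule sw3_mul) (rule lin_conj_char_arg)+
  also have "\<dots> = mul H (conj_char \<psi> a) (conj_char \<psi> b)"
    unfolding conj_char_def
    unfolding vlinear_sw3[OF lin_mul(1)[OF lin_basic(1)]] unfolding vlinear_sw3[OF lin_mul(2)[OF lin_basic(1)]]
    by (intro sw3_cong) (simp add: S'_mul character_mul[OF assms] vector_smult_assoc algebra_simps)
  finally show ?thesis .
qed

lemma conj_char_unt: "character \<psi> \<Longrightarrow> conj_char \<psi> (unt H) = unt H"
  unfolding conj_char_def by (subst sw3_grouplike[OF lin_conj_char_arg grouplike_unt]) (simp add: character_unt)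

lemma conj_char_g: "character \<psi> \<Longrightarrow> conj_char \<psi> g = g"
  unfolding conj_char_def
  by (subst sw3_grouplike[OF lin_conj_char_arg grouplike_g]) (simp add: S'_g pairing_S_grouplike grouplike_g)

lemma conj_char_x:
  assumes \<psi>: "character \<psi>" and x0: "pairing \<psi> x = 0"
  shows "conj_char \<psi> x = inverse (pairing \<psi> g) *s x"
proof -
  have S'x0: "pairing \<psi> (S' x) = 0"
    unfolding S'_x using x0 slinear_pairing(1)[of \<psi>]
    by (simp add: vec.scale_minus_left[symmetric] pairing_def sum_negf)
       (simp add: pairing_def[symmetric] character_mul[OF \<psi>])
  let ?\<gamma> = "\<lambda>a1 a2 a3. (pairing \<psi> (S' a3) * pairing \<psi> a1) *s a2"
  note l = lin_conj_char_arg
  have "conj_char \<psi> x = tlift (\<lambda>a1 a'. sw (\<lambda>a2 a3. ?\<gamma> a1 a2 a3) a') (x \<otimes>\<^sub>v g) +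
      tlift (\<lambda>a1 a'. sw (\<lambda>a2 a3. ?\<gamma> a1 a2 a3) a') (unt H \<otimes>\<^sub>v x)"
    unfolding conj_char_def sw3_def comul_x by (rule vlinear_add) (intro lin)
  also have "\<dots> = sw (\<lambda>a2 a3. ?\<gamma> x a2 a3) g + sw (\<lambda>a2 a3. ?\<gamma> (unt H) a2 a3) x"
    by (subst tlift_tens, (intro lin l)+)+ (rule refl)
  also have "sw (\<lambda>a2 a3. ?\<gamma> x a2 a3) g = 0" by (simp add: x0 tlift_def)
  also have "sw (\<lambda>a2 a3. ?\<gamma> (unt H) a2 a3) x = tlift (\<lambda>a2 a3. ?\<gamma> (unt H) a2 a3) (x \<otimes>\<^sub>v g) + tlift (\<lambda>a2 a3. ?\<gamma> (unt H) a2 a3) (unt H \<otimes>\<^sub>v x)"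
    unfolding comul_x by (rule vlinear_add) (intro lin)
  also have "\<dots> = ?\<gamma> (unt H) x g + ?\<gamma> (unt H) (unt H) x"
    by (subst tlift_tens, (intro lin l)+)+ (rule refl)
  also have "\<dots> = inverse (pairing \<psi> g) *s x"
    using S'x0 by (simp add: character_unt[OF \<psi>] S'_g character_Sg[OF \<psi>])
  finally show ?thesis by simp
qed

lemma x_pw_g: "mul H x (pw g k) = q ^ k *s mul H (pw g k) x"
  using pw_x_g[of 1 k] by simp

text \<open>
  By \<open>h_\<iota>\<close>, conjugation by \<open>h\<close> multiplies \<open>x\<close> by \<open>q\<^sup>2\<close>. Conjugation by \<open>j \<psi>\<close> contributes \<open>q\<close>, and
  $g^t$ contributes $q^{-t}$.
\<close>
lemma h_eq:
  assumes N: "N \<ge> 2"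
  obtains \<psi> where "character \<psi>" "pairing \<psi> g = q" "h = \<psi> \<otimes>\<^sub>v pw g (n - 1)"
proof -
  obtain \<psi> c where h: "h = \<psi> \<otimes>\<^sub>v c" "character \<psi>" "grouplike c"
    using grouplike_double[OF grouplike_h] .
  obtain t where t: "t < n" "c = pw g t" using h_grouplike_bound[OF h] .
  have \<psi>_g: "pairing \<psi> g = q" by (rule h_character_g[OF h N])
  then have \<psi>_x: "pairing \<psi> x = 0" by (intro character_x h) (simp add: q_n)
  have "t = n - 1"
  proof (cases "n = 1")
    case True
    then show ?thesis using t by simp
  next
    case False
    then have n: "1 < n" using n_pos by simp
    have x_j: "mul D (\<iota> x) (j \<psi>) = inverse q *s mul D (j \<psi>) (\<iota> x)"
      by (simp add: \<iota>_conj_char[OF h(2)] conj_char_x[OF h(2) \<psi>_x] \<psi>_g vlinear_scale[OF lin_\<iota>[OF lin_basic(1)]])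
    have "\<psi> \<otimes>\<^sub>v mul H c x = mul D h (\<iota> x)" by (simp add: h(1) dmul_\<iota>)
    also have "\<dots> = mul D (\<iota> ((q * q) *s x)) (mul D (j \<psi>) (\<iota> c))"
      unfolding h_\<iota> by (simp add: S'_S'_x vlinear_scale[OF lin_S'[OF lin_basic(1)]] vector_smult_assoc h(1) j_\<iota>)
    also have "\<dots> = (q * q) *s mul D (mul D (\<iota> x) (j \<psi>)) (\<iota> c)"
      by (simp add: D.mul_assoc vlinear_scale[OF lin_\<iota>[OF lin_basic(1)]])
    also have "\<dots> = q *s mul D (mul D (j \<psi>) (\<iota> x)) (\<iota> c)"
      unfolding x_j using q_0 by (simp add: vector_smult_assoc)
    also have "\<dots> = \<psi> \<otimes>\<^sub>v (q *s mul H x c)"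
      unfolding j_\<iota> dmul_\<iota> vlinear_scale[OF lin_tens(2)[OF lin_basic(1)]] ..
    also have "\<dots> = \<psi> \<otimes>\<^sub>v (q ^ Suc t *s mul H c x)"
      by (simp add: t(2) x_pw_g vector_smult_assoc)
    finally have "pairing (unt H \<otimes>\<^sub>v dual_bas t 1) (\<psi> \<otimes>\<^sub>v mul H c x) = pairing (unt H \<otimes>\<^sub>v dual_bas t 1) (\<psi> \<otimes>\<^sub>v (q ^ Suc t *s mul H c x))"
      by simp
    moreover have "pairing (unt H) \<psi> = 1"
      using character_unt[OF h(2)] by (simp add: pairing_def mult.commute)
    moreover have "pairing (dual_bas t 1) (mul H c x) = 1"
    proof -
      have "t < N" using t(1) m_pos by (cases m) auto
      then show ?thesis using dual_bas_bas[OF n, of t 1 t] by (simp add: t(2) bas_def)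
    qed
    ultimately have "q ^ Suc t = 1" by (simp add: pairing_tens)
    then have "\<not> Suc t < n" using q_primitive[of "Suc t"] by auto
    then show ?thesis using t(1) by simp
  qed
  then show thesis using that[OF h(2) \<psi>_g] h(1) t(2) by simp
qed

section \<open>Counting ribbon elements\<close>

abbreviation quasi_ribbons where "quasi_ribbons \<equiv> {v. quasi_ribbon D (double_R H) v}"
abbreviation ribbons where "ribbons \<equiv> {v. ribbon D (double_R H) v}"

lemma tens_cancel:
  assumes "f \<otimes>\<^sub>v a = f' \<otimes>\<^sub>v a'" "pairing f (unt H) = 1" "pairing f' (unt H) = 1" "counit H a = 1" "counit H a' = 1"
  shows "f = f'" "a = a'"
  using arg_cong[OF assms(1), of proj_dual] arg_cong[OF assms(1), of proj_alg]
  unfolding proj_dual_tens proj_alg_tens assms(2-5) by simp_all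

lemma pairing_conv_g: "pairing (conv f p) g = pairing f g * pairing p g"
  by (simp add: pairing_conv comul_g pairing_tens)

lemma character_conv:
  assumes "character \<psi>" "character \<psi>'"
  shows "character (conv \<psi> \<psi>')"
proof -
  have "D.grouplike (mul D (\<psi> \<otimes>\<^sub>v unt H) (\<psi>' \<otimes>\<^sub>v unt H))"
    using assms by (intro D.grouplike_mul grouplike_tens grouplike_unt)
  then have "D.grouplike (conv \<psi> \<psi>' \<otimes>\<^sub>v unt H)"
    by (simp add: mul_grouplikes assms(2) grouplike_unt)
  then obtain \<phi> c where \<phi>: "conv \<psi> \<psi>' \<otimes>\<^sub>v unt H = \<phi> \<otimes>\<^sub>v c" "character \<phi>" "grouplike c"
    using grouplike_double by blast
  have "pairing (conv \<psi> \<psi>') (unt H) = 1"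
    using assms by (simp add: pairing_conv comul_unt pairing_tens character_unt)
  then have "conv \<psi> \<psi>' = \<phi>"
    using \<phi> by (intro tens_cancel(1)[OF \<phi>(1)]) (simp_all add: character_unt grouplike_def)
  then show ?thesis using \<phi> by simp
qed

lemma square_root_iff:
  assumes N: "N \<ge> 2" and \<psi>: "character \<psi>"
  shows "mul D (\<psi> \<otimes>\<^sub>v pw g b) (\<psi> \<otimes>\<^sub>v pw g b) = h \<longleftrightarrow>
    pairing \<psi> g ^ 2 = q \<and> (b + b) mod N = (n - 1) mod N \<and> pairing (conv \<psi> \<psi>) x = 0"
proof -
  obtain \<phi> where \<phi>: "character \<phi>" "pairing \<phi> g = q" "h = \<phi> \<otimes>\<^sub>v pw g (n - 1)" using h_eq[OF N] .
  have \<phi>_x: "pairing \<phi> x = 0" by (rule character_x[OF \<phi>(1)]) (simp add: \<phi>(2) q_n)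
  have eq: "mul D (\<psi> \<otimes>\<^sub>v pw g b) (\<psi> \<otimes>\<^sub>v pw g b) = conv \<psi> \<psi> \<otimes>\<^sub>v pw g (b + b)"
    by (simp add: mul_grouplikes[OF \<psi> grouplike_pw_g] pw_add)
  note c = character_conv[OF \<psi> \<psi>]
  have "conv \<psi> \<psi> \<otimes>\<^sub>v pw g (b + b) = \<phi> \<otimes>\<^sub>v pw g (n - 1) \<longleftrightarrow> conv \<psi> \<psi> = \<phi> \<and> pw g (b + b) = pw g (n - 1)"
    using tens_cancel[of "conv \<psi> \<psi>" "pw g (b + b)" \<phi> "pw g (n - 1)"] c \<phi>(1) grouplike_pw_g
    by (auto simp: character_unt grouplike_def)
  also have "conv \<psi> \<psi> = \<phi> \<longleftrightarrow> pairing \<psi> g ^ 2 = q \<and> pairing (conv \<psi> \<psi>) x = 0"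
  proof
    assume "conv \<psi> \<psi> = \<phi>"
    then have "pairing (conv \<psi> \<psi>) g = q" "pairing (conv \<psi> \<psi>) x = 0" using \<phi>(2) \<phi>_x by simp_all
    then show "pairing \<psi> g ^ 2 = q \<and> pairing (conv \<psi> \<psi>) x = 0" by (simp add: pairing_conv_g power2_eq_square)
  next
    assume "pairing \<psi> g ^ 2 = q \<and> pairing (conv \<psi> \<psi>) x = 0"
    then show "conv \<psi> \<psi> = \<phi>"
      by (intro character_eqI[OF c \<phi>(1)]) (simp_all add: pairing_conv_g \<phi>(2) \<phi>_x power2_eq_square)
  qed
  finally show ?thesis unfolding eq \<phi>(3) pw_g_eq_iff by blast
qed

lemma pairing_conv_x:
  assumes "character \<psi>"
  shows "pairing (conv \<psi> \<psi>) x = pairing \<psi> x * pairing \<psi> g + pairing \<psi> x"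
  using slinear_pairing(1)[of "\<psi> \<otimes>\<^sub>v \<psi>"]
  by (simp add: pairing_conv comul_x slinear_def pairing_tens character_unt[OF assms])

lemma quasi_ribbons_eq:
  assumes N: "N \<ge> 2"
  shows "quasi_ribbons = {mul D u (\<psi> \<otimes>\<^sub>v pw g b) | \<psi> b. b < N \<and> character \<psi> \<and> pairing \<psi> g ^ 2 = q \<and>
     (b + b) mod N = (n - 1) mod N \<and> pairing (conv \<psi> \<psi>) x = 0}" (is "_ = ?Q")
proof (intro set_eqI iffI)
  fix v assume "v \<in> quasi_ribbons"
  then obtain l where l: "D.grouplike l" "mul D l l = h" "v = mul D u l" by (auto simp: quasi_ribbon_iff)
  obtain \<psi> c where c: "l = \<psi> \<otimes>\<^sub>v c" "character \<psi>" "grouplike c" using grouplike_double[OF l(1)] .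
  obtain b where "b < N" "c = pw g b" using grouplike_cases[OF c(3)] .
  with l c square_root_iff[OF N c(2), of b] show "v \<in> ?Q" by auto
next
  fix v assume "v \<in> ?Q"
  then obtain \<psi> b where v: "v = mul D u (\<psi> \<otimes>\<^sub>v pw g b)" and \<psi>: "character \<psi>" "pairing \<psi> g ^ 2 = q"
     "(b + b) mod N = (n - 1) mod N" "pairing (conv \<psi> \<psi>) x = 0" by auto
  then have "mul D (\<psi> \<otimes>\<^sub>v pw g b) (\<psi> \<otimes>\<^sub>v pw g b) = h" by (simp add: square_root_iff[OF N])
  with v grouplike_tens[OF \<psi>(1) grouplike_pw_g] show "v \<in> quasi_ribbons" by (auto simp: quasi_ribbon_iff)
qed

lemma mul_u_inj: "mul D u l = mul D u l' \<Longrightarrow> l = l'"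
  using is_inverse_w_u unfolding is_inverse_def by (metis D.mul_assoc D.mul_unt(1))

lemma u_grouplike_inj:
  assumes "mul D u (\<psi> \<otimes>\<^sub>v pw g b) = mul D u (\<psi> \<otimes>\<^sub>v pw g b')" "character \<psi>"
  shows "b mod N = b' mod N"
  using tens_cancel(2)[OF mul_u_inj[OF assms(1)]] assms(2) grouplike_pw_g
  by (simp add: character_unt grouplike_def pw_g_eq_iff)

text \<open>
  Both conditions of \<open>is_central_u\<close> compare algebra homomorphisms, so they have to be verified on \<open>g\<close>
  and on \<open>x\<close>. On \<open>g\<close> they hold anyway, and on \<open>x\<close> both amount to the hypothesis on \<open>pairing \<psi> g\<close>.
\<close>
lemma central_if:
  assumes \<psi>: "character \<psi>" "pairing \<psi> x = 0" "pairing \<psi> g = q ^ Suc b"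
  shows "is_central D (mul D u (\<psi> \<otimes>\<^sub>v pw g b))"
proof (rule is_central_u)
  let ?c = "pw g b"
  have c: "grouplike ?c" by (rule grouplike_pw_g)
  have Sc: "mul H (S ?c) ?c = unt H" "mul H ?c (S ?c) = unt H"
    using grouplike_S[OF c] by (simp_all add: is_inverse_def)
  have gc: "mul H ?c g = mul H g ?c" using pw_Suc[of g b] pw_Suc'[of g b] by simp
  have linS': "vlinear (\<lambda>a. S' (S' a))" by (intro lin)
  have 1: "mul H ?c a = mul H (conj_char \<psi> (S' (S' a))) ?c" for a
  proof (induction a rule: induct_generators)
    case unt
    show ?case by (simp add: conj_char_unt[OF \<psi>(1)])
  next
    case (add a b)
    then show ?case
      by (simp add: vlinear_add[OF lin_mul(2)[OF lin_basic(1)]] vlinear_add[OF lin_mul(1)[OF lin_basic(1)]]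
          vlinear_add[OF linS'] vlinear_add[OF lin_conj_char[OF lin_basic(1)]])
  next
    case (scale c a)
    then show ?case
      by (simp add: vlinear_scale[OF linS'] vlinear_scale[OF lin_conj_char[OF lin_basic(1)]])
  next
    case (g a)
    have "mul H ?c (mul H g a) = mul H g (mul H ?c a)" by (simp only: mul_assoc[symmetric] gc)
    then show ?case by (simp add: g S'_mul S'_S'_g conj_char_mul[OF \<psi>(1)] conj_char_g[OF \<psi>(1)] mul_assoc)
  next
    case (x a)
    have "conj_char \<psi> (S' (S' x)) = (q * inverse (q ^ Suc b)) *s x"
      using \<psi>(3) by (simp add: S'_S'_x vlinear_scale[OF lin_conj_char[OF lin_basic(1)]]
          conj_char_x[OF \<psi>(1,2)] vector_smult_assoc)
    moreover have "q * inverse (q ^ Suc b) = inverse (q ^ b)" using q_0 by (simp add: field_simps)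
    moreover have "mul H ?c x = inverse (q ^ b) *s mul H x ?c"
      using q_0 by (simp add: x_pw_g vector_smult_assoc)
    ultimately show ?case
      by (simp add: S'_mul conj_char_mul[OF \<psi>(1)] mul_assoc[symmetric])
         (simp add: mul_assoc x)
  qed
  show "mul D (\<psi> \<otimes>\<^sub>v ?c) (\<iota> a) = mul D (\<iota> (S' (S' a))) (\<psi> \<otimes>\<^sub>v ?c)" for a
  proof -
    have "mul D (\<iota> (S' (S' a))) (\<psi> \<otimes>\<^sub>v ?c) = mul D (mul D (\<iota> (S' (S' a))) (j \<psi>)) (\<iota> ?c)"
      by (simp add: D.mul_assoc j_\<iota>)
    also have "\<dots> = \<psi> \<otimes>\<^sub>v mul H (conj_char \<psi> (S' (S' a))) ?c"
      by (simp add: \<iota>_conj_char[OF \<psi>(1)] j_\<iota> dmul_\<iota>)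
    finally show ?thesis by (simp add: dmul_\<iota> 1)
  qed
  \<comment> \<open>Evaluated at \<open>y\<close>, the two sides of the condition for \<open>j f\<close> are \<open>f (A1 y)\<close> and \<open>f (A2 y)\<close>.\<close>
  define A1 where "A1 y = sw (\<lambda>y1 y2. pairing \<psi> y1 *s mul H (S ?c) (mul H y2 ?c)) y" for y
  define A2 where "A2 y = sw (\<lambda>y1 y2. pairing \<psi> y2 *s S (S y1)) y" for y
  have A: "vlinear A1" "vlinear A2" unfolding A1_def A2_def by (intro lin)+
  have A1_mul: "A1 (mul H a b) = mul H (A1 a) (A1 b)" for a b
  proof -
    have "A1 (mul H a b) = sw (\<lambda>a1 a2. sw (\<lambda>b1 b2. pairing \<psi> (mul H a1 b1) *s
        mul H (S ?c) (mul H (mul H a2 b2) ?c)) b) a"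
      unfolding A1_def by (rule comul_mul_tlift) (intro lin)+
    also have "\<dots> = sw (\<lambda>a1 a2. sw (\<lambda>b1 b2. mul H (pairing \<psi> a1 *s mul H (S ?c) (mul H a2 ?c))
        (pairing \<psi> b1 *s mul H (S ?c) (mul H b2 ?c))) b) a"
    proof (intro tlift_cong)
      fix a1 a2 b1 b2
      have "mul H ?c (mul H (S ?c) (mul H b2 ?c)) = mul H b2 ?c" by (simp add: mul_assoc[symmetric] Sc)
      then show "pairing \<psi> (mul H a1 b1) *s mul H (S ?c) (mul H (mul H a2 b2) ?c) =
        mul H (pairing \<psi> a1 *s mul H (S ?c) (mul H a2 ?c)) (pairing \<psi> b1 *s mul H (S ?c) (mul H b2 ?c))"
        by (simp add: character_mul[OF \<psi>(1)] vector_smult_assoc mul_assoc mult.commute)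
    qed
    also have "\<dots> = mul H (A1 a) (A1 b)"
      unfolding A1_def unfolding mul_tlift(1) unfolding mul_tlift(2) ..
    finally show ?thesis .
  qed
  have A2_mul: "A2 (mul H a b) = mul H (A2 a) (A2 b)" for a b
  proof -
    have "A2 (mul H a b) = sw (\<lambda>a1 a2. sw (\<lambda>b1 b2. pairing \<psi> (mul H a2 b2) *s
        S (S (mul H a1 b1))) b) a"
      unfolding A2_def by (rule comul_mul_tlift) (intro lin)+
    also have "\<dots> = mul H (A2 a) (A2 b)"
      unfolding A2_def unfolding mul_tlift(1) unfolding mul_tlift(2)
      by (intro tlift_cong) (simp add: S_mul character_mul[OF \<psi>(1)] vector_smult_assoc mult.commute)
    finally show ?thesis .
  qed
  have A_unt: "A1 (unt H) = unt H" "A2 (unt H) = unt H"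
    unfolding A1_def A2_def comul_unt
    by (subst tlift_tens; (intro lin | simp add: character_unt[OF \<psi>(1)] Sc S_unt))+
  have A_g: "A1 g = A2 g"
    unfolding A1_def A2_def comul_g
    by (subst tlift_tens, (intro lin)+)+ (simp add: gc[symmetric] mul_assoc[symmetric] Sc S_S_g)
  have A_x: "A1 x = A2 x"
  proof -
    have "A1 x = tlift (\<lambda>y1 y2. pairing \<psi> y1 *s mul H (S ?c) (mul H y2 ?c)) (x \<otimes>\<^sub>v g) +
       tlift (\<lambda>y1 y2. pairing \<psi> y1 *s mul H (S ?c) (mul H y2 ?c)) (unt H \<otimes>\<^sub>v x)"
      unfolding A1_def comul_x by (rule vlinear_add) (intro lin)
    also have "\<dots> = mul H (S ?c) (mul H x ?c)"
      by (subst tlift_tens, (intro lin)+)+ (simp add: \<psi> character_unt)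
    also have "\<dots> = q ^ b *s x" by (simp add: x_pw_g mul_assoc[symmetric] Sc)
    finally have 1: "A1 x = q ^ b *s x" .
    have "A2 x = tlift (\<lambda>y1 y2. pairing \<psi> y2 *s S (S y1)) (x \<otimes>\<^sub>v g) +
       tlift (\<lambda>y1 y2. pairing \<psi> y2 *s S (S y1)) (unt H \<otimes>\<^sub>v x)"
      unfolding A2_def comul_x by (rule vlinear_add) (intro lin)
    also have "\<dots> = q ^ Suc b *s (inverse q *s x)"
      by (subst tlift_tens, (intro lin)+)+ (simp add: \<psi> S_S_x)
    finally show ?thesis using 1 q_0 by (simp add: vector_smult_assoc)
  qed
  have A12: "A1 y = A2 y" for y
    by (induction y rule: induct_generators)
       (simp_all add: A_unt A1_mul A2_mul A_g A_x vlinear_add[OF A(1)] vlinear_add[OF A(2)]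
         vlinear_scale[OF A(1)] vlinear_scale[OF A(2)])
  show "mul D (\<psi> \<otimes>\<^sub>v ?c) (j f) = mul D (j (S_dual (S_dual f))) (\<psi> \<otimes>\<^sub>v ?c)" for f
  proof -
    have "conv \<psi> (tw f ?c ?c) = conv (S_dual (S_dual f)) \<psi>"
    proof (rule pairing_eqI, rule scalar_eqI)
      fix y and v :: "'k ^ 1"
      have l: "vlinear (\<lambda>y. pairing f y *s v)" by (intro lin)
      have "pairing (conv \<psi> (tw f ?c ?c)) y *s v = pairing f (A1 y) *s v"
        unfolding pairing_conv' A1_def vlinear_tlift[OF l]
        by (simp add: S'_grouplike[OF c] vector_smult_assoc)
      moreover have "pairing (conv (S_dual (S_dual f)) \<psi>) y *s v = pairing f (A2 y) *s v"
        unfolding pairing_conv' A2_def vlinear_tlift[OF l]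
        by (simp add: vector_smult_assoc mult.commute)
      ultimately show "pairing (conv \<psi> (tw f ?c ?c)) y *s v = pairing (conv (S_dual (S_dual f)) \<psi>) y *s v"
        by (simp only: A12)
    qed
    moreover have "mul D (\<psi> \<otimes>\<^sub>v ?c) (j f) = conv \<psi> (tw f ?c ?c) \<otimes>\<^sub>v ?c"
      by (simp only: j_\<iota>[of \<psi> ?c, symmetric] D.mul_assoc \<iota>_grouplike[OF c] dmul_j)
    ultimately show ?thesis by (simp add: dmul_j j_\<iota>)
  qed
qed

lemma no_quasi_ribbon_if_even:
  assumes N: "N \<ge> 2" and n: "even n"
  shows "quasi_ribbons = {}"
proof -
  have n2: "n \<ge> 2" using n n_pos by presburger
  have "pairing \<psi> g ^ 2 \<noteq> q" if "character \<psi>" for \<psi>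
  proof
    assume "pairing \<psi> g ^ 2 = q"
    then have "q ^ (n div 2) = pairing \<psi> g ^ (2 * (n div 2))" by (simp only: power_mult)
    also have "2 * (n div 2) = n" using n by simp
    also have "pairing \<psi> g ^ n = 1" by (rule character_g_n[OF that n2])
    finally show False using q_primitive[of "n div 2"] n2 by simp
  qed
  then show ?thesis unfolding quasi_ribbons_eq[OF N] by auto
qed

text \<open>
  The exponents \<open>b\<close> with \<open>2 b = n - 1\<close> modulo \<open>m n\<close> are \<open>b0\<close> and, if \<open>m\<close> is even, \<open>b1\<close>. As \<open>m n / 2\<close> is then a
  multiple of \<open>n\<close>, both satisfy the condition of \<open>central_if\<close> for the same character. The hypothesis of the last
  claim makes every character send \<open>g\<close> to an \<open>n\<close>-th root of unity if its square sends \<open>g\<close> to \<open>q\<close>; among these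
  roots \<open>q\<close> has only one square root, since \<open>n\<close> is odd.
\<close>
lemma odd_case:
  assumes N: "N \<ge> 2" and n: "odd n"
  obtains v0 v1 where "v0 \<in> ribbons" "v1 \<in> ribbons" "v0 = v1 \<longleftrightarrow> odd m"
    "n \<ge> 2 \<or> odd m \<Longrightarrow> quasi_ribbons \<subseteq> {v0, v1}"
proof -
  define b0 where "b0 = (n - 1) div 2"
  define b1 where "b1 = (if even m then b0 + (m div 2) * n else b0)"
  have n_eq: "n = 2 * b0 + 1" using n by (auto simp: b0_def elim: oddE)
  have q2: "(q ^ Suc b0) ^ 2 = q"
  proof -
    have "(q ^ Suc b0) ^ 2 = q ^ (Suc b0 * 2)" by (simp only: power_mult)
    also have "Suc b0 * 2 = n + 1" by (simp add: n_eq)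
    finally show ?thesis by (simp add: power_add q_n)
  qed
  have qn: "(q ^ Suc b0) ^ n = 1" by (metis mult.commute power_mult power_one q_n)
  obtain \<psi> where \<psi>: "character \<psi>" "pairing \<psi> g = q ^ Suc b0" "pairing \<psi> x = 0"
    using character_exists[OF qn] .
  have b1: "q ^ Suc b1 = q ^ Suc b0"
  proof -
    have "q ^ (m div 2 * n) = 1" by (metis mult.commute power_mult power_one q_n)
    then show ?thesis by (simp add: b1_def power_add)
  qed
  have b0_less: "b0 < n" using n_eq by simp
  have n_N: "n \<le> N" using m_pos by simp
  have even_N: "m div 2 * n + m div 2 * n = N" if "even m"
    using that by (metis distrib_right mult_2 dvd_mult_div_cancel)
  have b1_less: "b1 < N"
  proof (cases "even m")
    case True
    then have "1 \<le> m div 2" using m_pos by presburger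
    then have "n \<le> m div 2 * n" by simp
    then have "b0 + m div 2 * n < N" using b0_less even_N[OF True] by linarith
    then show ?thesis using True by (simp add: b1_def)
  next
    case False
    have "b0 < N" using b0_less n_N by (rule less_le_trans)
    then show ?thesis using False by (simp add: b1_def)
  qed
  have rib: "mul D u (\<psi> \<otimes>\<^sub>v pw g b) \<in> ribbons" if "b = b0 \<or> b = b1" for b
  proof -
    have "(b + b) mod N = (n - 1) mod N"
    proof (cases "even m \<and> b = b1")
      case True
      then have "b + b = n - 1 + N" using even_N n_eq by (simp add: b1_def)
      then show ?thesis by simp
    next
      case False
      then have "b = b0" using that by (auto simp: b1_def)
      then have "b + b = n - 1" using n_eq by simp
      then show ?thesis by (simp only:)
    qed
    moreover have "b < N" using that b1_less less_le_trans[OF b0_less n_N] by blast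
    moreover have "pairing (conv \<psi> \<psi>) x = 0" by (simp add: pairing_conv_x[OF \<psi>(1)] \<psi>(3))
    moreover have "pairing \<psi> g ^ 2 = q" unfolding \<psi>(2) by (rule q2)
    ultimately have "mul D u (\<psi> \<otimes>\<^sub>v pw g b) \<in> quasi_ribbons"
      unfolding quasi_ribbons_eq[OF N] using \<psi>(1) by blast
    moreover have "pairing \<psi> g = q ^ Suc b" using that b1 \<psi>(2) by auto
    ultimately show ?thesis using central_if[OF \<psi>(1,3)] by (simp add: ribbon_def)
  qed
  show thesis
  proof (rule that)
    show "mul D u (\<psi> \<otimes>\<^sub>v pw g b0) \<in> ribbons" "mul D u (\<psi> \<otimes>\<^sub>v pw g b1) \<in> ribbons" using rib by auto
    show "mul D u (\<psi> \<otimes>\<^sub>v pw g b0) = mul D u (\<psi> \<otimes>\<^sub>v pw g b1) \<longleftrightarrow> odd m"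
    proof
      assume "mul D u (\<psi> \<otimes>\<^sub>v pw g b0) = mul D u (\<psi> \<otimes>\<^sub>v pw g b1)"
      from u_grouplike_inj[OF this \<psi>(1)] have "b0 = b1" using b1_less less_le_trans[OF b0_less n_N] by (simp only: mod_less)
      moreover have "m div 2 * n > 0" if "even m" using even_N[OF that] N_pos by (cases "m div 2 * n") auto
      ultimately show "odd m" by (auto simp: b1_def)
    qed (simp add: b1_def)
    assume nm: "n \<ge> 2 \<or> odd m"
    show "quasi_ribbons \<subseteq> {mul D u (\<psi> \<otimes>\<^sub>v pw g b0), mul D u (\<psi> \<otimes>\<^sub>v pw g b1)}"
    proof
      fix v assume "v \<in> quasi_ribbons"
      then obtain \<phi> b where v: "v = mul D u (\<phi> \<otimes>\<^sub>v pw g b)" and b: "b < N" "(b + b) mod N = (n - 1) mod N"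
        and \<phi>: "character \<phi>" "pairing \<phi> g ^ 2 = q"
        unfolding quasi_ribbons_eq[OF N] by auto
      have \<phi>_n: "pairing \<phi> g ^ n = 1"
      proof (cases "n \<ge> 2")
        case True
        then show ?thesis by (rule character_g_n[OF \<phi>(1)])
      next
        case False
        then have n1: "n = 1" and "odd m" using n_pos nm by auto
        then obtain k where k: "m = 2 * k + 1" by (elim oddE)
        have "pairing \<phi> g ^ 2 = 1" using \<phi>(2) q_n n1 by simp
        then have "pairing \<phi> g ^ N = pairing \<phi> g" by (simp add: n1 k power_mult)
        then show ?thesis using character_g_N[OF \<phi>(1)] n1 by simp
      qed
      have "pairing \<phi> g = pairing \<phi> g ^ n * pairing \<phi> g" by (simp add: \<phi>_n)
      also have "\<dots> = (pairing \<phi> g ^ 2) ^ Suc b0"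
        by (subst (1) n_eq) (simp add: power_mult power_add power2_eq_square)
      finally have "pairing \<phi> g = pairing \<psi> g" by (simp add: \<phi>(2) \<psi>(2))
      then have "\<phi> = \<psi>"
        using character_eqI[OF \<phi>(1) \<psi>(1)] character_x[OF \<phi>(1) \<phi>_n] \<psi>(3) by simp
      moreover have "b = b0 \<or> b = b1"
      proof -
        have "(b + b) mod N = b0 + b0" using b(2) n_N n_eq by simp
        moreover have "b + b < 2 * N" using b(1) by simp
        ultimately have "b + b = b0 + b0 \<or> b + b = b0 + b0 + N"
          by (metis add.commute add_diff_inverse_nat less_diff_conv2 linorder_not_less mod_if mod_less mult_2)
        moreover have "b = b1" if bb: "b + b = b0 + b0 + N"
        proof -
          have "even N" using bb by (metis add.commute dvd_add_right_iff even_add)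
          then have "even m" using n by simp
          then show ?thesis using even_N bb by (simp add: b1_def)
        qed
        ultimately show ?thesis by auto
      qed
      ultimately show "v \<in> {mul D u (\<psi> \<otimes>\<^sub>v pw g b0), mul D u (\<psi> \<otimes>\<^sub>v pw g b1)}" using v by auto
    qed
  qed
qed

end

lemma radford_hopfI:
  assumes "m \<ge> 2" "n \<ge> 1" "primitive_root_of_unity n q" "is_radford m n q H"
  obtains g x where "radford_hopf H (antipode H) m n q g x"
proof -
  have bi: "is_bialgebra H" and "\<exists>S. is_antipode H S"
    using assms(4) by (auto simp: is_radford_def is_hopf_algebra_def)
  then obtain S where "is_antipode H S" by blast
  then interpret hopf H S using bi by unfold_locales
  obtain g x where gx: "presented_by H (case_radford_gen g x) (radford_relations m n q)"
    "comul H g = g \<otimes>\<^sub>v g" "comul H x = x \<otimes>\<^sub>v g + unt H \<otimes>\<^sub>v x" "counit H g = 1" "counit H x = 0"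
    "antipode H x = - mul H x (inverse_in H g)"
    using assms(4) by (auto simp: is_radford_def)
  have "inverse_in H g = S g"
    by (intro inverse_in_eq grouplike_S) (simp add: grouplike_def gx)
  then have "radford_hopf H S m n q g x"
    using assms gx by unfold_locales (simp_all add: antipode_eq)
  then show thesis by (intro that) (simp add: antipode_eq)
qed

theorem theorem4p6:
  fixes m n :: nat and q :: "'k::alg_closed_field" and H :: "('k, 'i::finite) bialg"
  assumes "m \<ge> 2" and "n \<ge> 1" and "\<not> CHAR('k) dvd m * n"
    and "primitive_root_of_unity n q"
    and "is_radford m n q H"
  shows
    "((\<exists>v. quasi_ribbon (drinfeld_double H) (double_R H) v) \<longleftrightarrow> odd n) \<and>
     ((\<exists>!v. ribbon (drinfeld_double H) (double_R H) v) \<longleftrightarrow> odd m \<and> odd n) \<and>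
     (((\<exists>v w. v \<noteq> w \<and> ribbon (drinfeld_double H) (double_R H) v
               \<and> ribbon (drinfeld_double H) (double_R H) w) \<longleftrightarrow> even m \<and> odd n) \<and>
      (n \<ge> 2 \<longrightarrow> (card {v. ribbon (drinfeld_double H) (double_R H) v} = 2 \<longleftrightarrow> even m \<and> odd n)))"
proof -
  obtain g x where "radford_hopf H (antipode H) m n q g x"
    using radford_hopfI[OF assms(1,2,4,5)] .
  then interpret radford_hopf H "antipode H" m n q g x .
  have N: "m * n \<ge> 2" using assms(1,2) mult_le_mono[of 2 m 1 n] by simp
  have sub: "ribbons \<subseteq> quasi_ribbons" by (auto simp: ribbon_def)
  let ?P = "ribbon (drinfeld_double H) (double_R H)"
  show ?thesis
  proof (cases "odd n")
    case False
    then have "quasi_ribbons = {}" by (intro no_quasi_ribbon_if_even N) simp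
    then have "\<not> quasi_ribbon (drinfeld_double H) (double_R H) v" "\<not> ?P v" for v using sub by auto
    then show ?thesis using False by auto
  next
    case True
    obtain v0 v1 where v: "?P v0" "?P v1" "v0 = v1 \<longleftrightarrow> odd m"
      "n \<ge> 2 \<or> odd m \<Longrightarrow> quasi_ribbons \<subseteq> {v0, v1}"
      using odd_case[OF N True] by auto
    have ribbons_eq: "ribbons = {v0, v1}" if "n \<ge> 2 \<or> odd m"
      using v(1,2) v(4)[OF that] sub by auto
    have 1: "\<exists>v. quasi_ribbon (drinfeld_double H) (double_R H) v" using v(1) by (auto simp: ribbon_def)
    have 2: "(\<exists>!v. ?P v) \<longleftrightarrow> odd m"
    proof
      show "odd m" if "\<exists>!v. ?P v" using that v(1,2,3) by auto
      show "\<exists>!v. ?P v" if "odd m"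
      proof -
        have "ribbons = {v0}" using ribbons_eq that v(3) by auto
        then have "?P v \<longleftrightarrow> v = v0" for v by blast
        then show ?thesis by simp
      qed
    qed
    have 3: "(\<exists>v w. v \<noteq> w \<and> ?P v \<and> ?P w) \<longleftrightarrow> even m"
      using v(1-3) 2 by metis
    have 4: "card {v. ?P v} = 2 \<longleftrightarrow> even m" if "n \<ge> 2"
    proof -
      have "card {v. ?P v} = card {v0, v1}" using ribbons_eq that by simp
      also have "\<dots> = (if v0 = v1 then 1 else 2)" by simp
      finally show ?thesis using v(3) by simp
    qed
    show ?thesis using True 1 2 3 4 by auto
  qed
qed

end
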